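(* Let $J\subsetneq\binom{[n]}2$ be a vanishing set, i.e. $J=J(x)$ for some $x\in\mathcal{T}\mathrm{Gr}(2,n)$, let $ij\notin J$, and view $\mathrm{Gr}_J(2,n)$ as a closed subscheme of the torus $\operatorname{Spec}K[u_{kl}^{\pm}:kl\notin J\cup\{ij\}]$. Then, given any $y\in\mathbb R^{\binom{[n]}2\smallsetminus(J\cup\{ij\})}$, the initial degeneration $\mathrm{in}_y\mathrm{Gr}_J(2,n)$ is an integral scheme.
   Context: Convention: the empty scheme $\operatorname{Spec}(0)$ is counted as an integral scheme. $K$ is a field complete with respect to a non-Archimedean valuation $\nu$, $|\cdot|=\exp(-\nu(\cdot))$ (possibly trivial). $L|K$ is an algebraically closed complete extension field whose valuation $\nu\colon L^\ast\to\mathbb R$ extends that of $K$ and is surjective; $\widetilde L$ is its residue field. Pairs $kl\in\binom{[n]}2$ are unordered. $\mathrm{Gr}(2,n)\subset\mathbb{P}_K^{\binom n2-1}$ is embedded by Plücker coordinates $p_{kl}$ ($p_{lk}=-p_{kl}$); $^{\mathrm{an}}$ is Berkovich analytification. $\overline{\mathbb R}=\mathbb R\cup\{-\infty\}$, $\log0=-\infty$; $\mathrm{trop}\colon\mathrm{Gr}(2,n)^{\mathrm{an}}\to(\overline{\mathbb R}^{\binom n2}\smallsetminus\{(-\infty,\dots,-\infty)\})/\mathbb R\cdot(1,\dots,1)$ sends $\gamma$ over $\{p_{ij}\ne0\}$ to the class of $x$ with $x_{kl}-x_{ij}=\log\gamma(p_{kl}/p_{ij})$; $\mathcal{T}\mathrm{Gr}(2,n)$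 is its image; $J(x)=\{kl:x_{kl}=-\infty\}$. $\mathrm{Gr}_J(2,n)$ is the reduced locally closed subscheme of $\mathrm{Gr}(2,n)$ where exactly the Plücker coordinates in $J$ vanish; via $u_{kl}=p_{kl}/p_{ij}$ it is a closed subscheme of $\operatorname{Spec}K[u_{kl}^{\pm}:kl\notin J\cup\{ij\}]$, with ideal $\mathfrak I$. Initial degeneration: fix an $L$-point $\tau$ of the torus with $\log|\tau_{kl}|=y_{kl}$. For a nonzero Laurent polynomial $f=\sum_\alpha c_\alpha u^\alpha$ over $L$, $\mathrm{in}_y(f)=\sum_\alpha\overline{\lambda c_\alpha\tau^\alpha}\,u^\alpha\in\widetilde L[u_{kl}^\pm]$, where $\lambda\in L$ satisfies $\nu(\lambda)=\max_\alpha\{-\nu(c_\alpha)+\langle\alpha,y\rangle\}$ and the bar is the residue class. $\mathrm{in}_y\mathfrak I\subset\widetilde L[u_{kl}^{\pm}:kl\notin J\cup\{ij\}]$ is the ideal generated by all $\mathrm{in}_y(f)$ with $f\in\mathfrak I\otimes_KL$, and $\mathrm{in}_y\mathrm{Gr}_J(2,n)=\operatorname{Spec}\bigl(\widetilde L[u_{kl}^{\pm}:kl\notin J\cup\{ij\}]/\mathrm{in}_y\mathfrak I\bigr)$. (Up to base change it does not depend on $L$.) *)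

theory Defs
  imports
    "HOL-Library.Poly_Mapping"
    "HOL-Library.Ramsey"
    "HOL-Library.Extended_Real"
    "HOL-Library.FuncSet"
    "HOL-Computational_Algebra.Polynomial"
    "HOL-Analysis.Abstract_Metric_Spaces"
    "HOL-Algebra.QuotRing"
begin

section \<open>Valued fields\<close>

text \<open>A valuation is real-valued on nonzero elements; its value at \<open>0\<close>, which should be
  \<open>\<infinity>\<close>, is left unspecified and is never used. The trivial valuation is allowed.\<close>

definition valuation :: "('a::field \<Rightarrow> real) \<Rightarrow> bool" where
  "valuation v \<longleftrightarrow>
     (\<forall>x y. x \<noteq> 0 \<longrightarrow> y \<noteq> 0 \<longrightarrow> v (x * y) = v x + v y) \<and>
     (\<forall>x y. x \<noteq> 0 \<longrightarrow> y \<noteq> 0 \<longrightarrow> x + y \<noteq> 0 \<longrightarrow> min (v x) (v y) \<le> v (x + y))"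

definition absval :: "('a::field \<Rightarrow> real) \<Rightarrow> 'a \<Rightarrow> real" where
  "absval v x = (if x = 0 then 0 else exp (- v x))"

definition complete_valuation :: "('a::field \<Rightarrow> real) \<Rightarrow> bool" where
  "complete_valuation v \<longleftrightarrow>
     valuation v \<and> Metric_space.mcomplete UNIV (\<lambda>x y. absval v (x - y))"

definition valued_extension ::
    "('k::field \<Rightarrow> real) \<Rightarrow> ('l::field \<Rightarrow> real) \<Rightarrow> ('k \<Rightarrow> 'l) \<Rightarrow> bool" where
  "valued_extension vK vL \<iota> \<longleftrightarrow>
     \<iota> 1 = 1 \<and> (\<forall>a b. \<iota> (a + b) = \<iota> a + \<iota> b) \<and> (\<forall>a b. \<iota> (a * b) = \<iota> a * \<iota> b) \<and>
     (\<forall>a. a \<noteq> 0 \<longrightarrow> vL (\<iota> a) = vK a)"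

definition valuation_ring :: "('a::field \<Rightarrow> real) \<Rightarrow> 'a set" where
  "valuation_ring v = {x. x = 0 \<or> v x \<ge> 0}"

text \<open>The residue field depends on the valuation, hence is not available as a type constructed from
  it. It is given by an arbitrary field together with a surjective homomorphism from the valuation
  ring whose kernel is the maximal ideal. Values outside the valuation ring are irrelevant.\<close>

definition residue_map :: "('a::field \<Rightarrow> real) \<Rightarrow> ('a \<Rightarrow> 'r::field) \<Rightarrow> bool" where
  "residue_map v res \<longleftrightarrow>
     res 1 = 1 \<and>
     (\<forall>a\<in>valuation_ring v. \<forall>b\<in>valuation_ring v.
        res (a + b) = res a + res b \<and> res (a * b) = res a * res b) \<and>
     res ` valuation_ring v = UNIV \<and>
     (\<forall>a\<in>valuation_ring v. res a = 0 \<longleftrightarrow> a = 0 \<or> v a > 0)"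


section \<open>Polynomial and Laurent polynomial rings\<close>

text \<open>A polynomial is a finitely supported map from exponents to coefficients, and an exponent is a
  finitely supported map from variables to \<open>nat\<close> (polynomials) or \<open>int\<close> (Laurent polynomials).
  The set \<open>E\<close> lists the variables that may occur.\<close>

definition monoid_ring_on ::
    "'x set \<Rightarrow> (('x \<Rightarrow>\<^sub>0 'e::comm_monoid_add) \<Rightarrow>\<^sub>0 'a::comm_ring_1) ring" where
  "monoid_ring_on E =
     \<lparr>carrier = {f. \<forall>\<alpha>\<in>Poly_Mapping.keys f. Poly_Mapping.keys \<alpha> \<subseteq> E},
      mult = (*), one = 1, zero = 0, add = (+)\<rparr>"

abbreviation poly_ring :: "'x set \<Rightarrow> (('x \<Rightarrow>\<^sub>0 nat) \<Rightarrow>\<^sub>0 'a::comm_ring_1) ring" where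
  "poly_ring \<equiv> monoid_ring_on"

abbreviation laurent_ring :: "'x set \<Rightarrow> (('x \<Rightarrow>\<^sub>0 int) \<Rightarrow>\<^sub>0 'a::comm_ring_1) ring" where
  "laurent_ring \<equiv> monoid_ring_on"

definition const :: "'a::zero \<Rightarrow> ('x \<Rightarrow>\<^sub>0 'e::comm_monoid_add) \<Rightarrow>\<^sub>0 'a" where
  "const c = Poly_Mapping.single 0 c"

definition var :: "'x \<Rightarrow> ('x \<Rightarrow>\<^sub>0 'e::{comm_monoid_add,one}) \<Rightarrow>\<^sub>0 'a::{zero,one}" where
  "var x = Poly_Mapping.single (Poly_Mapping.single x 1) 1"

text \<open>Apply the ring homomorphism \<open>h\<close> to the coefficients and substitute \<open>\<sigma>\<close> for the variables.\<close>

definition subst ::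
    "('a::zero \<Rightarrow> 'b::comm_ring_1) \<Rightarrow> ('x \<Rightarrow> 'b) \<Rightarrow> (('x \<Rightarrow>\<^sub>0 nat) \<Rightarrow>\<^sub>0 'a) \<Rightarrow> 'b" where
  "subst h \<sigma> f =
     (\<Sum>\<alpha>\<in>Poly_Mapping.keys f. h (Poly_Mapping.lookup f \<alpha>) *
        (\<Prod>x\<in>Poly_Mapping.keys \<alpha>. \<sigma> x ^ Poly_Mapping.lookup \<alpha> x))"

definition radical :: "('a, 'm) ring_scheme \<Rightarrow> 'a set \<Rightarrow> 'a set" where
  "radical R I = {f \<in> carrier R. \<exists>m::nat. f [^]\<^bsub>R\<^esub> m \<in> I}"


section \<open>Affine schemes and integrality\<close>

text \<open>The class of the fraction \<open>a/f\<close> in the localization of \<open>A\<close> at the prime ideal \<open>p\<close>.\<close>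

definition fraction :: "('a, 'm) ring_scheme \<Rightarrow> 'a set \<Rightarrow> 'a \<Rightarrow> 'a \<Rightarrow> ('a \<times> 'a) set" where
  "fraction A p a f =
     {(b, g). b \<in> carrier A \<and> g \<in> carrier A - p \<and>
        (\<exists>h\<in>carrier A - p. h \<otimes>\<^bsub>A\<^esub> (g \<otimes>\<^bsub>A\<^esub> a \<ominus>\<^bsub>A\<^esub> f \<otimes>\<^bsub>A\<^esub> b) = \<zero>\<^bsub>A\<^esub>)}"

definition localization :: "('a, 'm) ring_scheme \<Rightarrow> 'a set \<Rightarrow> ('a \<times> 'a) set ring" where
  "localization A p =
     \<lparr>carrier = {fraction A p a f | a f. a \<in> carrier A \<and> f \<in> carrier A - p},
      mult = (\<lambda>X Y. \<Union>(a, f)\<in>X. \<Union>(b, g)\<in>Y. fraction A p (a \<otimes>\<^bsub>A\<^esub> b) (f \<otimes>\<^bsub>A\<^esub> g)),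
      one = fraction A p \<one>\<^bsub>A\<^esub> \<one>\<^bsub>A\<^esub>,
      zero = fraction A p \<zero>\<^bsub>A\<^esub> \<one>\<^bsub>A\<^esub>,
      add = (\<lambda>X Y. \<Union>(a, f)\<in>X. \<Union>(b, g)\<in>Y.
               fraction A p (a \<otimes>\<^bsub>A\<^esub> g \<oplus>\<^bsub>A\<^esub> b \<otimes>\<^bsub>A\<^esub> f) (f \<otimes>\<^bsub>A\<^esub> g))\<rparr>"

definition zariski_opens :: "('a, 'm) ring_scheme \<Rightarrow> 'a set set set" where
  "zariski_opens A = {{p. primeideal p A \<and> \<not> S \<subseteq> p} | S. S \<subseteq> carrier A}"

text \<open>Sections over \<open>U\<close> are families of germs that are locally given by a single fraction.\<close>

definition structure_sheaf ::
    "('a, 'm) ring_scheme \<Rightarrow> 'a set set \<Rightarrow> ('a set \<Rightarrow> ('a \<times> 'a) set) ring" where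
  "structure_sheaf A U =
     \<lparr>carrier = {s \<in> (\<Pi>\<^sub>E p\<in>U. carrier (localization A p)).
        \<forall>p\<in>U. \<exists>V\<in>zariski_opens A. p \<in> V \<and> V \<subseteq> U \<and>
          (\<exists>a\<in>carrier A. \<exists>f\<in>carrier A. \<forall>q\<in>V. f \<notin> q \<and> s q = fraction A q a f)},
      mult = (\<lambda>s t. \<lambda>p\<in>U. s p \<otimes>\<^bsub>localization A p\<^esub> t p),
      one = (\<lambda>p\<in>U. \<one>\<^bsub>localization A p\<^esub>),
      zero = (\<lambda>p\<in>U. \<zero>\<^bsub>localization A p\<^esub>),
      add = (\<lambda>s t. \<lambda>p\<in>U. s p \<oplus>\<^bsub>localization A p\<^esub> t p)\<rparr>"

text \<open>A scheme is recorded by its open sets and its structure sheaf.\<close>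

definition Spec ::
    "('a, 'm) ring_scheme \<Rightarrow> 'a set set set \<times> ('a set set \<Rightarrow> ('a set \<Rightarrow> ('a \<times> 'a) set) ring)" where
  "Spec A = (zariski_opens A, structure_sheaf A)"

text \<open>Nonemptiness of the scheme is not required, so the empty scheme is integral.\<close>

definition integral_scheme :: "'p set set \<times> ('p set \<Rightarrow> 's ring) \<Rightarrow> bool" where
  "integral_scheme X \<longleftrightarrow> (\<forall>U\<in>fst X. U \<noteq> {} \<longrightarrow> domain (snd X U))"


section \<open>The Grassmannian of planes\<close>

text \<open>An unordered pair \<open>kl\<close> is the two-element set \<open>{k, l}\<close>, and \<open>p\<^sub>e\<close> for such a set \<open>e\<close> stands for
  \<open>p\<^sub>k\<^sub>l\<close> with \<open>k < l\<close>.\<close>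

abbreviation pairs :: "nat \<Rightarrow> nat set set" where
  "pairs n \<equiv> [{1..n}]\<^bsup>2\<^esup>"

text \<open>The \<open>2 \<times> 2\<close> minors of the generic \<open>2 \<times> n\<close> matrix, whose entry in row \<open>r\<close> and column \<open>k\<close> is
  the variable \<open>(r, k)\<close>. The homogeneous ideal of the Plucker embedding consists of the polynomial
  relations between them.\<close>

definition minor :: "nat set \<Rightarrow> (nat \<times> nat \<Rightarrow>\<^sub>0 nat) \<Rightarrow>\<^sub>0 'k::comm_ring_1" where
  "minor e = var (1, Min e) * var (2, Max e) - var (1, Max e) * var (2, Min e)"

definition plucker_ideal :: "nat \<Rightarrow> ((nat set \<Rightarrow>\<^sub>0 nat) \<Rightarrow>\<^sub>0 'k::field) set" where
  "plucker_ideal n = {f \<in> carrier (poly_ring (pairs n)). subst const minor f = 0}"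

text \<open>The affine chart of the Grassmannian where \<open>p\<^sub>e\<close> does not vanish, for \<open>e = ij\<close>: its coordinate
  ring is the quotient of the polynomial ring in \<open>u\<^sub>k\<^sub>l = p\<^sub>k\<^sub>l/p\<^sub>i\<^sub>j\<close>, \<open>kl \<noteq> ij\<close>, by the dehomogenized
  Plucker ideal.\<close>

definition chart_coord :: "nat set \<Rightarrow> nat set \<Rightarrow> (nat set \<Rightarrow>\<^sub>0 nat) \<Rightarrow>\<^sub>0 'k::field" where
  "chart_coord e d = (if d = e then 1 else var d)"

definition chart_ideal :: "nat \<Rightarrow> nat set \<Rightarrow> ((nat set \<Rightarrow>\<^sub>0 nat) \<Rightarrow>\<^sub>0 'k::field) set" where
  "chart_ideal n e = subst const (chart_coord e) ` plucker_ideal n"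

definition chart_ring :: "nat \<Rightarrow> nat set \<Rightarrow> ((nat set \<Rightarrow>\<^sub>0 nat) \<Rightarrow>\<^sub>0 'k::field) set ring" where
  "chart_ring n e = poly_ring (pairs n - {e}) Quot chart_ideal n e"

definition chart_class ::
    "nat \<Rightarrow> nat set \<Rightarrow> ((nat set \<Rightarrow>\<^sub>0 nat) \<Rightarrow>\<^sub>0 'k::field) \<Rightarrow> ((nat set \<Rightarrow>\<^sub>0 nat) \<Rightarrow>\<^sub>0 'k) set" where
  "chart_class n e f = chart_ideal n e +>\<^bsub>poly_ring (pairs n - {e})\<^esub> f"


section \<open>Tropicalization and vanishing sets\<close>

text \<open>The Berkovich analytification of an affine scheme \<open>Spec A\<close> over the valued field, where \<open>s\<close> is
  the structure map of the algebra \<open>A\<close>: multiplicative seminorms extending the absolute value.\<close>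

definition affine_analytification ::
    "('k::field \<Rightarrow> real) \<Rightarrow> ('k \<Rightarrow> 'c) \<Rightarrow> ('c, 'm) ring_scheme \<Rightarrow> ('c \<Rightarrow> real) set" where
  "affine_analytification v s A =
     {\<gamma> \<in> carrier A \<rightarrow>\<^sub>E {0..}.
        (\<forall>a\<in>carrier A. \<forall>b\<in>carrier A.
           \<gamma> (a \<otimes>\<^bsub>A\<^esub> b) = \<gamma> a * \<gamma> b \<and> \<gamma> (a \<oplus>\<^bsub>A\<^esub> b) \<le> \<gamma> a + \<gamma> b) \<and>
        (\<forall>c. \<gamma> (s c) = absval v c)}"

definition chart_analytification ::
    "('k::field \<Rightarrow> real) \<Rightarrow> nat \<Rightarrow> nat set \<Rightarrow> (((nat set \<Rightarrow>\<^sub>0 nat) \<Rightarrow>\<^sub>0 'k) set \<Rightarrow> real) set" where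
  "chart_analytification v n e =
     affine_analytification v (\<lambda>c. chart_class n e (const c)) (chart_ring n e)"

definition log_ext :: "real \<Rightarrow> ereal" where
  "log_ext r = (if r = 0 then -\<infinity> else ereal (ln r))"

text \<open>A point of the tropical projective space is a class modulo adding a real constant to all
  coordinates. It is represented as the set of its members.\<close>

definition trop_chart ::
    "nat \<Rightarrow> nat set \<Rightarrow> (((nat set \<Rightarrow>\<^sub>0 nat) \<Rightarrow>\<^sub>0 'k::field) set \<Rightarrow> real) \<Rightarrow> (nat set \<Rightarrow> ereal) set" where
  "trop_chart n e \<gamma> =
     {x \<in> pairs n \<rightarrow>\<^sub>E {..<\<infinity>}. x e \<noteq> -\<infinity> \<and>
        (\<forall>d\<in>pairs n. x d - x e = log_ext (\<gamma> (chart_class n e (chart_coord e d))))}"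

text \<open>The analytification of the Grassmannian is covered by those of the charts, so the image of
  the tropicalization map is the union of the images of the charts.\<close>

definition trop_grassmannian ::
    "('k::field \<Rightarrow> real) \<Rightarrow> nat \<Rightarrow> (nat set \<Rightarrow> ereal) set set" where
  "trop_grassmannian v n = (\<Union>e\<in>pairs n. trop_chart n e ` chart_analytification v n e)"

definition infinite_coords :: "nat \<Rightarrow> (nat set \<Rightarrow> ereal) \<Rightarrow> nat set set" where
  "infinite_coords n x = {d \<in> pairs n. x d = -\<infinity>}"

definition is_vanishing_set ::
    "('k::field \<Rightarrow> real) \<Rightarrow> nat \<Rightarrow> nat set set \<Rightarrow> bool" where
  "is_vanishing_set v n J \<longleftrightarrow>
     (\<exists>X\<in>trop_grassmannian v n. \<exists>x\<in>X. J = infinite_coords n x)"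


section \<open>The stratum and its initial degenerations\<close>

definition torus_coords :: "nat \<Rightarrow> nat set set \<Rightarrow> nat set \<Rightarrow> nat set set" where
  "torus_coords n J e = pairs n - (J \<union> {e})"

text \<open>On the stratum \<open>p\<^sub>e\<close> is normalized to \<open>1\<close>, the Plucker coordinates in \<open>J\<close> are set to \<open>0\<close> and
  the others are inverted; the radical yields the reduced structure.\<close>

definition stratum_coord ::
    "nat set set \<Rightarrow> nat set \<Rightarrow> nat set \<Rightarrow> (nat set \<Rightarrow>\<^sub>0 int) \<Rightarrow>\<^sub>0 'k::field" where
  "stratum_coord J e d = (if d \<in> J then 0 else if d = e then 1 else var d)"

definition stratum_ideal ::
    "nat \<Rightarrow> nat set set \<Rightarrow> nat set \<Rightarrow> ((nat set \<Rightarrow>\<^sub>0 int) \<Rightarrow>\<^sub>0 'k::field) set" where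
  "stratum_ideal n J e =
     (let R = laurent_ring (torus_coords n J e)
      in radical R (Idl\<^bsub>R\<^esub> (subst const (stratum_coord J e) ` plucker_ideal n)))"

definition extended_ideal ::
    "('k::comm_ring_1 \<Rightarrow> 'l::comm_ring_1) \<Rightarrow> 'x set \<Rightarrow> (('x \<Rightarrow>\<^sub>0 int) \<Rightarrow>\<^sub>0 'k) set \<Rightarrow>
     (('x \<Rightarrow>\<^sub>0 int) \<Rightarrow>\<^sub>0 'l) set" where
  "extended_ideal \<iota> E I = Idl\<^bsub>laurent_ring E\<^esub> (Poly_Mapping.map \<iota> ` I)"

definition torus_point ::
    "('l::field \<Rightarrow> real) \<Rightarrow> 'x set \<Rightarrow> ('x \<Rightarrow> 'l) \<Rightarrow> ('x \<Rightarrow> real) \<Rightarrow> bool" where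
  "torus_point v E \<tau> y \<longleftrightarrow> (\<forall>d\<in>E. \<tau> d \<noteq> 0 \<and> ln (absval v (\<tau> d)) = y d)"

definition exp_eval :: "('x \<Rightarrow> 'l::field) \<Rightarrow> ('x \<Rightarrow>\<^sub>0 int) \<Rightarrow> 'l" where
  "exp_eval \<tau> \<alpha> = (\<Prod>d\<in>Poly_Mapping.keys \<alpha>. \<tau> d powi Poly_Mapping.lookup \<alpha> d)"

definition exp_pairing :: "('x \<Rightarrow>\<^sub>0 int) \<Rightarrow> ('x \<Rightarrow> real) \<Rightarrow> real" where
  "exp_pairing \<alpha> y = (\<Sum>d\<in>Poly_Mapping.keys \<alpha>. of_int (Poly_Mapping.lookup \<alpha> d) * y d)"

definition initial_scalar ::
    "('l::field \<Rightarrow> real) \<Rightarrow> ('x \<Rightarrow> real) \<Rightarrow> (('x \<Rightarrow>\<^sub>0 int) \<Rightarrow>\<^sub>0 'l) \<Rightarrow> 'l \<Rightarrow> bool" where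
  "initial_scalar v y f \<mu> \<longleftrightarrow> \<mu> \<noteq> 0 \<and>
     v \<mu> = Max ((\<lambda>\<alpha>. - v (Poly_Mapping.lookup f \<alpha>) + exp_pairing \<alpha> y) ` Poly_Mapping.keys f)"

definition initial_form ::
    "('l::field \<Rightarrow> 'r::field) \<Rightarrow> ('x \<Rightarrow> 'l) \<Rightarrow> 'l \<Rightarrow> (('x \<Rightarrow>\<^sub>0 int) \<Rightarrow>\<^sub>0 'l) \<Rightarrow>
     (('x \<Rightarrow>\<^sub>0 int) \<Rightarrow>\<^sub>0 'r)" where
  "initial_form res \<tau> \<mu> f = Poly_Mapping.mapp (\<lambda>\<alpha> c. res (\<mu> * c * exp_eval \<tau> \<alpha>)) f"

text \<open>The initial form of \<open>f\<close> depends on the choice of the scalar only up to a nonzero factor; the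
  forms for all admissible scalars are taken as generators.\<close>

definition initial_ideal ::
    "('l::field \<Rightarrow> real) \<Rightarrow> ('l \<Rightarrow> 'r::field) \<Rightarrow> 'x set \<Rightarrow> ('x \<Rightarrow> 'l) \<Rightarrow> ('x \<Rightarrow> real) \<Rightarrow>
     (('x \<Rightarrow>\<^sub>0 int) \<Rightarrow>\<^sub>0 'l) set \<Rightarrow> (('x \<Rightarrow>\<^sub>0 int) \<Rightarrow>\<^sub>0 'r) set" where
  "initial_ideal v res E \<tau> y I =
     Idl\<^bsub>laurent_ring E\<^esub>
       {initial_form res \<tau> \<mu> f | \<mu> f. f \<in> I \<and> f \<noteq> 0 \<and> initial_scalar v y f \<mu>}"

definition initial_coordinate_ring ::
    "('l::field \<Rightarrow> real) \<Rightarrow> ('k::field \<Rightarrow> 'l) \<Rightarrow> ('l \<Rightarrow> 'r::field) \<Rightarrow> nat \<Rightarrow> nat set set \<Rightarrow> nat set \<Rightarrow>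
     (nat set \<Rightarrow> 'l) \<Rightarrow> (nat set \<Rightarrow> real) \<Rightarrow> ((nat set \<Rightarrow>\<^sub>0 int) \<Rightarrow>\<^sub>0 'r) set ring" where
  "initial_coordinate_ring v \<iota> res n J e \<tau> y =
     (let E = torus_coords n J e
      in laurent_ring E Quot
           initial_ideal v res E \<tau> y (extended_ideal \<iota> E (stratum_ideal n J e)))"

end

theory Submission
  imports Defs
begin

text \<open>With \<open>p\<^sub>i\<^sub>j = 1\<close>, a point of the stratum is a \<open>2 \<times> n\<close> matrix whose nonzero columns are
  \<open>s\<^sub>k (x\<^sub>k, 1)\<close> or \<open>s\<^sub>k (1, 0)\<close>, so every torus coordinate is a monomial in the \<open>s\<^sub>k\<close>, possibly times a linear
  form \<open>x\<^sub>k - x\<^sub>l\<close>, and the \<open>s\<^sub>k\<close> are themselves torus coordinates up to sign. The linear forms, normalized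
  by \<open>\<tau>\<close>, span a lattice over the valuation ring that has a basis among them. Hence modulo the
  initial ideal all coordinates are Laurent polynomials in a set \<open>base\<close> of coordinates. If a product
  lies in the proper initial ideal but its factors do not, these reduce to nonzero Laurent
  polynomials in \<open>base\<close>, which are nonzero at some point over the (infinite) residue field. This point
  lifts to an integral point of the stratum, at whose reduction the initial ideal vanishes: a
  contradiction. If the initial ideal is improper, the scheme is empty.\<close>

section \<open>Evaluation of monoid rings\<close>

text \<open>Radical and extension of scalars hide the generators of the ideal \<open>I\<close> of
  the stratum, so \<open>I\<close> is never determined. What is used about it is that it contains
  the three-term Plucker relations and that it vanishes at every torus point given by the minors of
  a matrix whose minors are 0 on \<open>J\<close> and 1 at \<open>ij\<close>. The relations yield
  congruences modulo the initial ideal, the matrices yield points at which it vanishes, and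
  primality follows from the two together. The obstacle is the lifting of points. Every coordinate
  of the lift must have exactly the valuation prescribed by \<open>y\<close>, whereas a minor of a
  matrix assembled from lifted values may have a larger one by cancellation. The Laurent polynomial
  to which a coordinate reduces is nonzero, because the coordinate is a unit and the initial ideal
  is proper. There are finitely many coordinates, so the point over the residue field can be chosen
  off the zeros of all these polynomials as well, and then no cancellation occurs.\<close>

abbreviation keys where "keys \<equiv> Poly_Mapping.keys"
abbreviation lookup where "lookup \<equiv> Poly_Mapping.lookup"
abbreviation single where "single \<equiv> Poly_Mapping.single"

definition unital_hom :: "('a::comm_ring_1 \<Rightarrow> 'b::comm_ring_1) \<Rightarrow> bool" where
  "unital_hom \<phi> \<longleftrightarrow> \<phi> 1 = 1 \<and> (\<forall>a b. \<phi> (a + b) = \<phi> a + \<phi> b) \<and> (\<forall>a b. \<phi> (a * b) = \<phi> a * \<phi> b)"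

lemma unital_homD:
  assumes "unital_hom \<phi>"
  shows "\<phi> 1 = 1" "\<phi> (a + b) = \<phi> a + \<phi> b" "\<phi> (a * b) = \<phi> a * \<phi> b"
    "\<phi> 0 = 0" "\<phi> (- a) = - \<phi> a" "\<phi> (a - b) = \<phi> a - \<phi> b" "\<phi> (a ^ n) = \<phi> a ^ n"
proof -
  show 1: "\<phi> 1 = 1" and 2: "\<And>a b. \<phi> (a + b) = \<phi> a + \<phi> b" and 3: "\<And>a b. \<phi> (a * b) = \<phi> a * \<phi> b"
    using assms unfolding unital_hom_def by auto
  show 0: "\<phi> 0 = 0" using 2[of 0 0] by simp
  show 4: "\<And>a. \<phi> (- a) = - \<phi> a" proof -
    fix a show "\<phi> (- a) = - \<phi> a" using 2[of "- a" a] 0 by (simp add: eq_neg_iff_add_eq_0)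
  qed
  show "\<phi> (a - b) = \<phi> a - \<phi> b" using 2[of a "- b"] 4 by simp
  show "\<phi> (a ^ n) = \<phi> a ^ n" by (induction n) (simp_all add: 1 3)
qed

lemma unital_hom_sum: "unital_hom \<phi> \<Longrightarrow> \<phi> (sum g A) = (\<Sum>x\<in>A. \<phi> (g x))"
  by (induction A rule: infinite_finite_induct) (simp_all add: unital_homD)

lemma unital_hom_prod: "unital_hom \<phi> \<Longrightarrow> \<phi> (prod g A) = (\<Prod>x\<in>A. \<phi> (g x))"
  by (induction A rule: infinite_finite_induct) (simp_all add: unital_homD)

lemma poly_mapping_sum_singles: "(\<Sum>\<alpha>\<in>keys f. single \<alpha> (lookup f \<alpha>)) = f"
proof (rule poly_mapping_eqI)
  fix k
  show "lookup (\<Sum>\<alpha>\<in>keys f. single \<alpha> (lookup f \<alpha>)) k = lookup f k"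
    by (cases "k \<in> keys f") (simp_all add: lookup_sum lookup_single when_def in_keys_iff)
qed

text \<open>Restricting the case of a monomial to exponents of \<open>f\<close> keeps the
  information that \<open>f\<close> lies in a given carrier available during the induction.\<close>

lemma poly_mapping_add_induct [case_names zero single add]:
  fixes f :: "'m \<Rightarrow>\<^sub>0 'a::comm_monoid_add"
  assumes "P 0" "\<And>\<alpha> c. \<alpha> \<in> keys f \<Longrightarrow> P (single \<alpha> c)" "\<And>g h. P g \<Longrightarrow> P h \<Longrightarrow> P (g + h)"
  shows "P f"
proof -
  have "P (\<Sum>\<alpha>\<in>A. single \<alpha> (lookup f \<alpha>))" if "finite A" "A \<subseteq> keys f" for A
    using that by (induction A rule: finite_induct) (auto intro: assms)
  from this[of "keys f"] show ?thesis by (simp add: poly_mapping_sum_singles)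
qed

text \<open>Leaving the value \<xi> of a monomial arbitrary makes substitution into polynomials,
  evaluation of Laurent polynomials and change of coefficients instances of one
  construction.\<close>

definition monoid_eval :: "('a::comm_ring_1 \<Rightarrow> 'b::comm_ring_1) \<Rightarrow> ('m \<Rightarrow> 'b) \<Rightarrow> ('m \<Rightarrow>\<^sub>0 'a) \<Rightarrow> 'b" where
  "monoid_eval h \<xi> f = (\<Sum>\<alpha>\<in>keys f. h (lookup f \<alpha>) * \<xi> \<alpha>)"

lemma monoid_eval_superset:
  assumes "finite A" "keys f \<subseteq> A" "h 0 = 0"
  shows "monoid_eval h \<xi> f = (\<Sum>\<alpha>\<in>A. h (lookup f \<alpha>) * \<xi> \<alpha>)"
  unfolding monoid_eval_def using assms
  by (intro sum.mono_neutral_left) (auto simp: in_keys_iff)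

lemma monoid_eval_add:
  assumes "h 0 = 0" "\<And>a b. h (a + b) = h a + h b"
  shows "monoid_eval h \<xi> (f + g) = monoid_eval h \<xi> f + monoid_eval h \<xi> g"
proof -
  have "monoid_eval h \<xi> p = (\<Sum>\<alpha>\<in>keys f \<union> keys g. h (lookup p \<alpha>) * \<xi> \<alpha>)" if "keys p \<subseteq> keys f \<union> keys g" for p
    using monoid_eval_superset[of "keys f \<union> keys g" p h \<xi>] that assms by simp
  from this[of "f + g"] this[of f] this[of g] keys_add[of f g] show ?thesis
    by (simp add: lookup_add assms sum.distrib distrib_right)
qed

lemma monoid_eval_single: "h 0 = 0 \<Longrightarrow> monoid_eval h \<xi> (single \<alpha> c) = h c * \<xi> \<alpha>"
  unfolding monoid_eval_def by simp

lemma monoid_eval_hom: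
  assumes h: "unital_hom h" and \<xi>: "\<xi> 0 = 1" "\<And>\<alpha> \<beta>. \<xi> (\<alpha> + \<beta>) = \<xi> \<alpha> * \<xi> \<beta>"
  shows "unital_hom (monoid_eval h (\<xi> :: 'm::comm_monoid_add \<Rightarrow> _))"
proof -
  note h = unital_homD[OF h]
  have add: "monoid_eval h \<xi> (f + g) = monoid_eval h \<xi> f + monoid_eval h \<xi> g" for f g
    by (rule monoid_eval_add) (simp_all add: h)
  have zero: "monoid_eval h \<xi> 0 = 0" unfolding monoid_eval_def by simp
  have single: "monoid_eval h \<xi> (single \<alpha> c * g) = monoid_eval h \<xi> (single \<alpha> c) * monoid_eval h \<xi> g" for \<alpha> c g
    by (induction g rule: poly_mapping_add_induct)
      (simp_all add: zero add distrib_left mult_single monoid_eval_single h \<xi> mult.assoc mult.left_commute)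
  have "monoid_eval h \<xi> (f * g) = monoid_eval h \<xi> f * monoid_eval h \<xi> g" for f g
    by (induction f rule: poly_mapping_add_induct) (simp_all add: zero add single distrib_right)
  moreover have "monoid_eval h \<xi> 1 = 1"
    using monoid_eval_single[of h \<xi> 0 1] by (simp add: h \<xi>)
  ultimately show ?thesis unfolding unital_hom_def using add by blast
qed

lemma subst_eq_monoid_eval: "subst h \<sigma> = monoid_eval h (\<lambda>\<alpha>. \<Prod>x\<in>keys \<alpha>. \<sigma> x ^ lookup \<alpha> x)"
  unfolding subst_def monoid_eval_def by (rule ext) simp

lemma prod_power_add:
  fixes \<sigma> :: "'x \<Rightarrow> 'b::comm_ring_1" and \<alpha> \<beta> :: "'x \<Rightarrow>\<^sub>0 nat"
  shows "(\<Prod>x\<in>keys (\<alpha> + \<beta>). \<sigma> x ^ lookup (\<alpha> + \<beta>) x) =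
    (\<Prod>x\<in>keys \<alpha>. \<sigma> x ^ lookup \<alpha> x) * (\<Prod>x\<in>keys \<beta>. \<sigma> x ^ lookup \<beta> x)"
proof -
  have "(\<Prod>x\<in>keys \<gamma>. \<sigma> x ^ lookup \<gamma> x) = (\<Prod>x\<in>keys \<alpha> \<union> keys \<beta>. \<sigma> x ^ lookup \<gamma> x)"
    if "keys \<gamma> \<subseteq> keys \<alpha> \<union> keys \<beta>" for \<gamma>
    using that by (intro prod.mono_neutral_left) (auto simp: in_keys_iff)
  from this[of "\<alpha> + \<beta>"] this[of \<alpha>] this[of \<beta>] keys_add[of \<alpha> \<beta>] show ?thesis
    by (simp add: lookup_add power_add prod.distrib)
qed

lemma subst_hom: "unital_hom h \<Longrightarrow> unital_hom (subst h \<sigma>)"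
  unfolding subst_eq_monoid_eval by (rule monoid_eval_hom) (simp_all add: prod_power_add)

lemma subst_const: "unital_hom h \<Longrightarrow> subst h \<sigma> (const c) = h c"
  unfolding subst_eq_monoid_eval const_def by (simp add: monoid_eval_single unital_homD)

lemma subst_var: "unital_hom h \<Longrightarrow> subst h \<sigma> (var x) = \<sigma> x"
  unfolding subst_eq_monoid_eval var_def by (simp add: monoid_eval_single unital_homD)

lemma const_hom: "unital_hom const"
  unfolding unital_hom_def const_def by (simp add: single_add mult_single)

lemma hom_subst:
  assumes "unital_hom \<phi>"
  shows "\<phi> (subst h \<sigma> f) = subst (\<phi> \<circ> h) (\<phi> \<circ> \<sigma>) f"
  unfolding subst_def
  by (simp add: unital_hom_sum[OF assms] unital_hom_prod[OF assms] unital_homD(3,7)[OF assms])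

lemma exp_eval_superset:
  assumes "finite A" "keys \<alpha> \<subseteq> A"
  shows "exp_eval \<sigma> \<alpha> = (\<Prod>d\<in>A. \<sigma> d powi lookup \<alpha> d)"
  unfolding exp_eval_def using assms by (intro prod.mono_neutral_left) (auto simp: in_keys_iff)

lemma exp_eval_zero: "exp_eval \<sigma> 0 = 1"
  unfolding exp_eval_def by simp

text \<open>Exponents may cancel, so additivity fails at a point with a zero coordinate. Points that
  are meaningful on the torus coordinates only are therefore extended by the value 1
  elsewhere.\<close>

lemma exp_eval_add:
  assumes "\<And>d. \<sigma> d \<noteq> 0"
  shows "exp_eval \<sigma> (\<alpha> + \<beta>) = exp_eval \<sigma> \<alpha> * exp_eval \<sigma> \<beta>"
proof -
  have "exp_eval \<sigma> \<gamma> = (\<Prod>d\<in>keys \<alpha> \<union> keys \<beta>. \<sigma> d powi lookup \<gamma> d)" if "keys \<gamma> \<subseteq> keys \<alpha> \<union> keys \<beta>" for \<gamma>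
    using that by (intro exp_eval_superset) auto
  from this[of "\<alpha> + \<beta>"] this[of \<alpha>] this[of \<beta>] keys_add[of \<alpha> \<beta>] show ?thesis
    by (simp add: lookup_add power_int_add assms prod.distrib)
qed

lemma exp_eval_nonzero:
  assumes "\<And>d. \<sigma> d \<noteq> 0"
  shows "exp_eval \<sigma> \<alpha> \<noteq> 0"
  unfolding exp_eval_def using assms by simp

lemma exp_eval_mult: "exp_eval (\<lambda>d. \<sigma> d * \<rho> d) \<alpha> = exp_eval \<sigma> \<alpha> * exp_eval \<rho> \<alpha>"
  unfolding exp_eval_def by (simp add: power_int_mult_distrib prod.distrib)

lemma exp_eval_single: "exp_eval \<sigma> (single d 1) = \<sigma> d"
  unfolding exp_eval_def by simp

lemma exp_eval_cong: "(\<And>d. d \<in> keys \<alpha> \<Longrightarrow> \<sigma> d = \<rho> d) \<Longrightarrow> exp_eval \<sigma> \<alpha> = exp_eval \<rho> \<alpha>"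
  unfolding exp_eval_def by simp

lemma laurent_eval_hom:
  "unital_hom h \<Longrightarrow> (\<And>d. \<sigma> d \<noteq> 0) \<Longrightarrow> unital_hom (monoid_eval h (exp_eval \<sigma>))"
  by (rule monoid_eval_hom) (simp_all add: exp_eval_zero exp_eval_add)

lemma monoid_eval_cong:
  "(\<And>\<alpha>. \<alpha> \<in> keys f \<Longrightarrow> \<xi> \<alpha> = \<psi> \<alpha>) \<Longrightarrow> monoid_eval h \<xi> f = monoid_eval h \<psi> f"
  unfolding monoid_eval_def by simp

lemma lookup_map_hom: "h 0 = 0 \<Longrightarrow> lookup (Poly_Mapping.map h f) \<alpha> = h (lookup f \<alpha>)"
  by (simp add: map.rep_eq when_def)

lemma keys_map: "keys (Poly_Mapping.map h f) \<subseteq> keys f"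
  by (auto simp: in_keys_iff map.rep_eq)

lemma monoid_eval_map:
  assumes "h 0 = 0" "k 0 = 0"
  shows "monoid_eval k \<xi> (Poly_Mapping.map h f) = monoid_eval (k \<circ> h) \<xi> f"
  using monoid_eval_superset[of "keys f" "Poly_Mapping.map h f" k \<xi>] monoid_eval_superset[of "keys f" f "k \<circ> h" \<xi>]
    keys_map[of h f] assms by (simp add: lookup_map_hom)

text \<open>Changing the coefficients is evaluation at the tautological point
  \<open>single \<alpha> 1\<close>, so multiplicativity comes from
  \<open>monoid_eval_hom\<close>.\<close>

lemma map_hom:
  assumes "unital_hom h"
  shows "unital_hom (Poly_Mapping.map h :: ('m::comm_monoid_add \<Rightarrow>\<^sub>0 _) \<Rightarrow> _)"
proof -
  have "Poly_Mapping.map h f = monoid_eval (\<lambda>c. single 0 (h c)) (\<lambda>\<alpha>. single \<alpha> 1) f" for f :: "'m \<Rightarrow>\<^sub>0 _"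
  proof (rule poly_mapping_eqI)
    fix k
    show "lookup (Poly_Mapping.map h f) k = lookup (monoid_eval (\<lambda>c. single 0 (h c)) (\<lambda>\<alpha>. single \<alpha> 1) f) k"
      by (cases "k \<in> keys f")
        (simp_all add: monoid_eval_def lookup_sum mult_single lookup_single when_def
          lookup_map_hom unital_homD[OF assms] in_keys_iff)
  qed
  then have "Poly_Mapping.map h = monoid_eval (\<lambda>c. single 0 (h c)) (\<lambda>\<alpha>. single (\<alpha>::'m) 1)" by (rule ext)
  moreover have "unital_hom (monoid_eval (\<lambda>c. single 0 (h c)) (\<lambda>\<alpha>. single (\<alpha>::'m) 1))"
    by (rule monoid_eval_hom) (use assms in \<open>auto simp: unital_hom_def mult_single single_add\<close>)
  ultimately show ?thesis by simp
qed

section \<open>Monoid rings on a set of variables and their ideals\<close>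

lemma monoid_ring_simps [simp]:
  "mult (monoid_ring_on E) = (*)" "one (monoid_ring_on E) = 1"
  "zero (monoid_ring_on E) = 0" "add (monoid_ring_on E) = (+)"
  unfolding monoid_ring_on_def by simp_all

lemma mem_monoid_ring: "f \<in> carrier (monoid_ring_on E) \<longleftrightarrow> (\<forall>\<alpha>\<in>keys f. keys \<alpha> \<subseteq> E)"
  unfolding monoid_ring_on_def by simp

lemma monoid_ring_closed:
  "0 \<in> carrier (monoid_ring_on E)" "1 \<in> carrier (monoid_ring_on E)"
  "const c \<in> carrier (monoid_ring_on E)"
  "f \<in> carrier (monoid_ring_on E) \<Longrightarrow> g \<in> carrier (monoid_ring_on E) \<Longrightarrow> f + g \<in> carrier (monoid_ring_on E)"
  "f \<in> carrier (monoid_ring_on E) \<Longrightarrow> g \<in> carrier (monoid_ring_on E) \<Longrightarrow> f * g \<in> carrier (monoid_ring_on E)"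
  "keys \<alpha> \<subseteq> E \<Longrightarrow> single \<alpha> c \<in> carrier (monoid_ring_on E)"
proof -
  show "f + g \<in> carrier (monoid_ring_on E)" if "f \<in> carrier (monoid_ring_on E)" "g \<in> carrier (monoid_ring_on E)"
    using that keys_add[of f g] unfolding mem_monoid_ring by blast
  show "f * g \<in> carrier (monoid_ring_on E)" if "f \<in> carrier (monoid_ring_on E)" "g \<in> carrier (monoid_ring_on E)"
    unfolding mem_monoid_ring
  proof
    fix \<gamma> assume "\<gamma> \<in> keys (f * g)"
    then obtain \<alpha> \<beta> where "\<gamma> = \<alpha> + \<beta>" "\<alpha> \<in> keys f" "\<beta> \<in> keys g" using keys_mult by blast
    then show "keys \<gamma> \<subseteq> E" using that keys_add[of \<alpha> \<beta>] unfolding mem_monoid_ring by blast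
  qed
qed (simp_all add: mem_monoid_ring const_def)

lemma monoid_ring_uminus_closed:
  "f \<in> carrier (monoid_ring_on E) \<Longrightarrow> - f \<in> carrier (monoid_ring_on E)"
  by (auto simp: mem_monoid_ring in_keys_iff)

lemma monoid_ring_diff_closed:
  "f \<in> carrier (monoid_ring_on E) \<Longrightarrow> g \<in> carrier (monoid_ring_on E) \<Longrightarrow> f - g \<in> carrier (monoid_ring_on E)"
  using monoid_ring_closed(4)[of f E "- g"] monoid_ring_uminus_closed[of g E] by simp

lemma monoid_ring_sum_closed:
  "(\<And>x. x \<in> A \<Longrightarrow> g x \<in> carrier (monoid_ring_on E)) \<Longrightarrow> sum g A \<in> carrier (monoid_ring_on E)"
  by (induction A rule: infinite_finite_induct) (simp_all add: monoid_ring_closed)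

lemma monoid_ring_prod_closed:
  "(\<And>x. x \<in> A \<Longrightarrow> g x \<in> carrier (monoid_ring_on E)) \<Longrightarrow> prod g A \<in> carrier (monoid_ring_on E)"
  by (induction A rule: infinite_finite_induct) (simp_all add: monoid_ring_closed)

lemma monoid_ring_power_closed:
  "f \<in> carrier (monoid_ring_on E) \<Longrightarrow> f ^ n \<in> carrier (monoid_ring_on E)"
  by (induction n) (simp_all add: monoid_ring_closed)

lemmas mring_intros = monoid_ring_closed monoid_ring_uminus_closed monoid_ring_diff_closed
  monoid_ring_sum_closed monoid_ring_prod_closed monoid_ring_power_closed

lemma cring_monoid_ring: "cring (monoid_ring_on E :: (('x \<Rightarrow>\<^sub>0 'e::comm_monoid_add) \<Rightarrow>\<^sub>0 'a::comm_ring_1) ring)"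
proof (rule cringI)
  let ?R = "monoid_ring_on E :: (('x \<Rightarrow>\<^sub>0 'e) \<Rightarrow>\<^sub>0 'a) ring"
  show "abelian_group ?R"
  proof (rule abelian_groupI)
    fix f assume "f \<in> carrier ?R"
    then show "\<exists>g\<in>carrier ?R. g \<oplus>\<^bsub>?R\<^esub> f = \<zero>\<^bsub>?R\<^esub>" by (intro bexI[of _ "- f"]) (simp_all add: mring_intros)
  qed (simp_all add: mring_intros add_ac)
  show "comm_monoid ?R"
    by (rule comm_monoidI) (simp_all add: mring_intros mult_ac)
qed (simp add: distrib_right)

lemma monoid_ring_pow:
  fixes f :: "('x \<Rightarrow>\<^sub>0 'e::comm_monoid_add) \<Rightarrow>\<^sub>0 'a::comm_ring_1"
  shows "f [^]\<^bsub>monoid_ring_on E\<^esub> (m::nat) = f ^ m"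
proof -
  interpret cring "monoid_ring_on E :: (('x \<Rightarrow>\<^sub>0 'e) \<Rightarrow>\<^sub>0 'a) ring" by (rule cring_monoid_ring)
  show ?thesis by (induction m) (simp_all add: mult.commute)
qed

text \<open>Since \<open>- 1\<close> lies in the carrier, closure under negation follows from
  closure under multiples, and ideals can be handled entirely with the operations of the
  type.\<close>

lemma ideal_monoid_ring_iff:
  "ideal I (monoid_ring_on E) \<longleftrightarrow> I \<subseteq> carrier (monoid_ring_on E) \<and> 0 \<in> I \<and>
    (\<forall>a\<in>I. \<forall>b\<in>I. a + b \<in> I) \<and> (\<forall>a\<in>I. \<forall>r\<in>carrier (monoid_ring_on E). r * a \<in> I)"
  (is "_ \<longleftrightarrow> ?rhs") for I :: "(('x \<Rightarrow>\<^sub>0 'e::comm_monoid_add) \<Rightarrow>\<^sub>0 'a::comm_ring_1) set"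
proof
  let ?R = "monoid_ring_on E :: (('x \<Rightarrow>\<^sub>0 'e) \<Rightarrow>\<^sub>0 'a) ring"
  interpret R: cring ?R by (rule cring_monoid_ring)
  show ?rhs if "ideal I ?R"
  proof -
    interpret ideal I ?R by (rule that)
    show ?thesis using a_subset additive_subgroup.zero_closed[OF additive_subgroup_axioms]
        additive_subgroup.a_closed[OF additive_subgroup_axioms] I_l_closed by simp
  qed
  show "ideal I ?R" if r: ?rhs
  proof (rule idealI)
    show "ring ?R" by (rule R.ring_axioms)
    show "subgroup I (add_monoid ?R)"
    proof (rule R.add.subgroupI)
      fix a assume a: "a \<in> I"
      have "(- 1) * a \<in> I" using r a by (blast intro: mring_intros)
      then have "- a \<in> I" by simp
      moreover have "\<ominus>\<^bsub>?R\<^esub> a = - a"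
        by (rule R.minus_equality) (use r a in \<open>auto intro: monoid_ring_uminus_closed\<close>)
      ultimately show "\<ominus>\<^bsub>?R\<^esub> a \<in> I" by simp
    qed (use r in auto)
  qed (use r in \<open>auto simp: mult.commute\<close>)
qed

lemma monoid_ring_genideal:
  assumes "S \<subseteq> carrier (monoid_ring_on E)"
  shows "ideal (genideal (monoid_ring_on E) S) (monoid_ring_on E)" "S \<subseteq> genideal (monoid_ring_on E) S"
    "ideal I (monoid_ring_on E) \<Longrightarrow> S \<subseteq> I \<Longrightarrow> genideal (monoid_ring_on E) S \<subseteq> I"
proof -
  interpret R: cring "monoid_ring_on E" by (rule cring_monoid_ring)
  show "ideal (genideal (monoid_ring_on E) S) (monoid_ring_on E)" by (rule R.genideal_ideal[OF assms])
  show "S \<subseteq> genideal (monoid_ring_on E) S" by (rule R.genideal_self[OF assms])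
  show "ideal I (monoid_ring_on E) \<Longrightarrow> S \<subseteq> I \<Longrightarrow> genideal (monoid_ring_on E) S \<subseteq> I" by (rule R.genideal_minimal)
qed

section \<open>Laurent polynomials and valued fields\<close>

text \<open>The coordinates are treated one at a time: a vector with nonzero entry at the new
  coordinate forbids at most one value of the new weight, and a vector with zero entry there is
  covered by the induction hypothesis.\<close>

lemma separating_weight:
  fixes D :: "('x \<Rightarrow> int) set"
  assumes "finite E" "finite D" "\<forall>\<delta>\<in>D. \<exists>d\<in>E. \<delta> d \<noteq> 0"
  shows "\<exists>w. \<forall>\<delta>\<in>D. (\<Sum>d\<in>E. \<delta> d * w d) \<noteq> 0"
  using assms
proof (induction E arbitrary: D rule: finite_induct)
  case (insert a E)
  let ?D = "{\<delta>\<in>D. \<exists>d\<in>E. \<delta> d \<noteq> 0}"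
  have "finite ?D" "\<forall>\<delta>\<in>?D. \<exists>d\<in>E. \<delta> d \<noteq> 0" using insert.prems(1) by simp_all
  from insert.IH[OF this] obtain w where w: "\<forall>\<delta>\<in>?D. (\<Sum>d\<in>E. \<delta> d * w d) \<noteq> 0" by (elim exE)
  \<comment> \<open>A weight \<open>m\<close> fails for \<delta> only if it is the exact quotient
    listed here; values coming from an inexact quotient are excluded without harm.\<close>
  obtain m where m: "m \<notin> (\<lambda>\<delta>. - (\<Sum>d\<in>E. \<delta> d * w d) div \<delta> a) ` D"
    using ex_new_if_finite[OF infinite_UNIV_int] insert.prems by blast
  have "(\<Sum>d\<in>insert a E. \<delta> d * (w(a := m)) d) \<noteq> 0" if "\<delta> \<in> D" for \<delta>
  proof -
    have "(\<Sum>d\<in>E. \<delta> d * (w(a := m)) d) = (\<Sum>d\<in>E. \<delta> d * w d)"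
      using insert.hyps by (intro sum.cong) auto
    then have eq: "(\<Sum>d\<in>insert a E. \<delta> d * (w(a := m)) d) = \<delta> a * m + (\<Sum>d\<in>E. \<delta> d * w d)"
      using insert.hyps by simp
    show ?thesis
    proof (cases "\<delta> a = 0")
      case True
      then have "\<delta> \<in> ?D" using insert.prems(2) that by force
      then show ?thesis using eq w True by simp
    next
      case False
      show ?thesis
      proof
        assume "(\<Sum>d\<in>insert a E. \<delta> d * (w(a := m)) d) = 0"
        then have "- (\<Sum>d\<in>E. \<delta> d * w d) = \<delta> a * m" using eq by simp
        then have "m = - (\<Sum>d\<in>E. \<delta> d * w d) div \<delta> a" using False by simp
        then show False using m that by blast
      qed
    qed
  qed
  then show ?case by blast
qed simp

lemma powi_sum: "(s::'a::field) \<noteq> 0 \<Longrightarrow> s powi (\<Sum>d\<in>A. g d) = (\<Prod>d\<in>A. s powi g d)"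
  by (induction A rule: infinite_finite_induct) (simp_all add: power_int_add)

text \<open>On a generic one-parameter subgroup the finitely many exponents that occur stay distinct,
  which reduces the claim to univariate polynomials.\<close>

lemma laurent_nonvanishing:
  fixes Fs :: "(('x \<Rightarrow>\<^sub>0 int) \<Rightarrow>\<^sub>0 'r::field) set"
  assumes inf: "infinite (UNIV :: 'r set)" and E: "finite E" and Fs: "finite Fs"
    and nz: "\<And>f. f \<in> Fs \<Longrightarrow> f \<noteq> 0" and car: "Fs \<subseteq> carrier (laurent_ring E)"
  obtains \<sigma> where "\<forall>d. \<sigma> d \<noteq> 0" "\<forall>f\<in>Fs. monoid_eval id (exp_eval \<sigma>) f \<noteq> 0"
proof -
  let ?A = "\<Union>f\<in>Fs. keys f"
  let ?D = "{lookup (\<alpha> - \<beta>) | \<alpha> \<beta>. \<alpha> \<in> ?A \<and> \<beta> \<in> ?A \<and> \<alpha> \<noteq> \<beta>}"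
  have A: "finite ?A" using Fs by simp
  have kE: "keys \<alpha> \<subseteq> E" if "\<alpha> \<in> ?A" for \<alpha> using that car unfolding mem_monoid_ring[abs_def] by (auto simp: subset_iff mem_monoid_ring)
  have "?D \<subseteq> (\<lambda>(\<alpha>, \<beta>). lookup (\<alpha> - \<beta>)) ` (?A \<times> ?A)" by auto
  then have "finite ?D" by (rule finite_subset) (use A in simp)
  moreover have "\<forall>\<delta>\<in>?D. \<exists>d\<in>E. \<delta> d \<noteq> 0"
  proof
    fix \<delta> assume "\<delta> \<in> ?D"
    then obtain \<alpha> \<beta> where ab: "\<delta> = lookup (\<alpha> - \<beta>)" "\<alpha> \<in> ?A" "\<beta> \<in> ?A" "\<alpha> - \<beta> \<noteq> 0" by auto
    then obtain d where "d \<in> keys (\<alpha> - \<beta>)" using keys_eq_empty by blast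
    moreover have "keys (\<alpha> - \<beta>) \<subseteq> E" using keys_diff[of \<alpha> \<beta>] kE ab by blast
    ultimately show "\<exists>d\<in>E. \<delta> d \<noteq> 0" using ab by (auto simp: in_keys_iff)
  qed
  ultimately obtain w where w: "\<forall>\<delta>\<in>?D. (\<Sum>d\<in>E. \<delta> d * w d) \<noteq> 0" using separating_weight[OF E] by blast
  define p where "p \<alpha> = (\<Sum>d\<in>E. lookup \<alpha> d * w d)" for \<alpha>
  have inj: "inj_on p ?A"
  proof (rule inj_onI, rule ccontr)
    fix \<alpha> \<beta> assume a: "\<alpha> \<in> ?A" "\<beta> \<in> ?A" "p \<alpha> = p \<beta>" "\<alpha> \<noteq> \<beta>"
    then have "lookup (\<alpha> - \<beta>) \<in> ?D" by blast
    moreover have "(\<Sum>d\<in>E. lookup (\<alpha> - \<beta>) d * w d) = p \<alpha> - p \<beta>"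
      unfolding p_def by (simp add: lookup_minus left_diff_distrib sum_subtractf)
    ultimately show False using w a by fastforce
  qed
  \<comment> \<open>Shifting by \<open>N\<close> makes all exponents nonnegative, so that along the
    curve \<open>s powi w d\<close> each Laurent polynomial becomes, up to a power of
    \<open>s\<close>, the polynomial \<open>q f\<close>.\<close>
  obtain N where N: "\<And>\<alpha>. \<alpha> \<in> ?A \<Longrightarrow> 0 \<le> p \<alpha> + N"
  proof
    fix \<alpha> assume "\<alpha> \<in> ?A"
    then have "\<bar>p \<alpha>\<bar> \<le> (\<Sum>\<beta>\<in>?A. \<bar>p \<beta>\<bar>)" using A by (intro member_le_sum) auto
    then show "0 \<le> p \<alpha> + (\<Sum>\<beta>\<in>?A. \<bar>p \<beta>\<bar>)" by linarith
  qed
  define q where "q f = (\<Sum>\<alpha>\<in>keys f. monom (lookup f \<alpha>) (nat (p \<alpha> + N)))" for f :: "('x \<Rightarrow>\<^sub>0 int) \<Rightarrow>\<^sub>0 'r"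
  have qnz: "q f \<noteq> 0" if f: "f \<in> Fs" for f
  proof -
    obtain \<alpha> where \<alpha>: "\<alpha> \<in> keys f" using nz[OF f] keys_eq_empty by blast
    have "coeff (q f) (nat (p \<alpha> + N)) = (\<Sum>\<beta>\<in>keys f. if \<beta> = \<alpha> then lookup f \<alpha> else 0)"
      unfolding q_def coeff_sum
    proof (rule sum.cong[OF refl])
      fix \<beta> assume \<beta>: "\<beta> \<in> keys f"
      have "nat (p \<beta> + N) = nat (p \<alpha> + N) \<longleftrightarrow> \<beta> = \<alpha>"
      proof
        have in_A: "\<alpha> \<in> ?A" "\<beta> \<in> ?A" using f \<alpha> \<beta> by blast+
        assume "nat (p \<beta> + N) = nat (p \<alpha> + N)"
        then have "p \<beta> = p \<alpha>" using N[OF in_A(1)] N[OF in_A(2)] by linarith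
        then show "\<beta> = \<alpha>" using inj_onD[OF inj _ in_A(2,1)] by simp
      qed simp
      then show "coeff (monom (lookup f \<beta>) (nat (p \<beta> + N))) (nat (p \<alpha> + N)) = (if \<beta> = \<alpha> then lookup f \<alpha> else 0)"
        by auto
    qed
    also have "\<dots> = lookup f \<alpha>" using \<alpha> by simp
    finally show ?thesis using \<alpha> by (auto simp: in_keys_iff)
  qed
  \<comment> \<open>The value 0 is excluded together with the roots because negative powers of
    \<open>s\<close> occur.\<close>
  have "finite (insert 0 (\<Union>f\<in>Fs. {s. poly (q f) s = 0}))" using Fs poly_roots_finite qnz by auto
  from ex_new_if_finite[OF inf this] obtain s where "s \<notin> insert 0 (\<Union>f\<in>Fs. {s. poly (q f) s = 0})" by (elim exE)
  then have s: "s \<noteq> 0" "\<And>f. f \<in> Fs \<Longrightarrow> poly (q f) s \<noteq> 0" by simp_all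
  show thesis
  proof (rule that[of "\<lambda>d. s powi w d"]; intro allI ballI)
    show "s powi w d \<noteq> 0" for d using s by simp
    fix f assume f: "f \<in> Fs"
    have "exp_eval (\<lambda>d. s powi w d) \<alpha> = s powi p \<alpha>" if "\<alpha> \<in> keys f" for \<alpha>
      unfolding p_def powi_sum[OF s(1)] using kE[of \<alpha>] that f E
      by (subst exp_eval_superset[of E]) (auto simp: power_int_mult mult.commute)
    then have "s powi N * monoid_eval id (exp_eval (\<lambda>d. s powi w d)) f = (\<Sum>\<alpha>\<in>keys f. lookup f \<alpha> * s powi (p \<alpha> + N))"
      unfolding monoid_eval_def sum_distrib_left using s(1)
      by (intro sum.cong) (simp_all add: power_int_add)
    also have "\<dots> = poly (q f) s"
      unfolding q_def poly_sum poly_monom using N f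
      by (intro sum.cong refl) (auto simp: power_int_def)
    finally show "monoid_eval id (exp_eval (\<lambda>d. s powi w d)) f \<noteq> 0" using s f by force
  qed
qed

section \<open>Valuation rings, lattices over them and residue fields\<close>

context
  fixes v :: "'l::field \<Rightarrow> real"
  assumes v: "valuation v"
begin

lemma val_mult: "x \<noteq> 0 \<Longrightarrow> y \<noteq> 0 \<Longrightarrow> v (x * y) = v x + v y"
  using v unfolding valuation_def by blast

lemma val_one: "v 1 = 0"
  using val_mult[of 1 1] by simp

lemma val_uminus: "x \<noteq> 0 \<Longrightarrow> v (- x) = v x"
  using val_mult[of "-1" "-1"] val_mult[of "-1" x] val_one by simp

lemma val_inverse: "x \<noteq> 0 \<Longrightarrow> v (inverse x) = - v x"
  using val_mult[of x "inverse x"] val_one by simp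

lemma val_divide: "x \<noteq> 0 \<Longrightarrow> y \<noteq> 0 \<Longrightarrow> v (x / y) = v x - v y"
  using val_mult[of x "inverse y"] val_inverse[of y] by (simp add: field_simps)

lemma val_prod: "(\<And>x. x \<in> A \<Longrightarrow> g x \<noteq> 0) \<Longrightarrow> v (prod g A) = (\<Sum>x\<in>A. v (g x))"
  by (induction A rule: infinite_finite_induct) (simp_all add: val_one val_mult)

lemma val_powi:
  assumes x: "x \<noteq> 0"
  shows "v (x powi k) = of_int k * v x"
proof -
  have p: "v (x ^ n) = of_nat n * v x" for n
    by (induction n) (simp_all add: x val_one val_mult algebra_simps)
  show ?thesis
    using p[of "nat k"] p[of "nat (- k)"] val_inverse[of "x ^ nat (- k)"] x
    by (auto simp: power_int_def power_inverse)
qed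

lemma val_exp_eval: "(\<And>d. \<sigma> d \<noteq> 0) \<Longrightarrow> v (exp_eval \<sigma> \<alpha>) = (\<Sum>d\<in>keys \<alpha>. of_int (lookup \<alpha> d) * v (\<sigma> d))"
  unfolding exp_eval_def by (simp add: val_prod val_powi)

lemma valuation_ring_closed:
  "0 \<in> valuation_ring v" "1 \<in> valuation_ring v"
  "x \<in> valuation_ring v \<Longrightarrow> y \<in> valuation_ring v \<Longrightarrow> x + y \<in> valuation_ring v"
  "x \<in> valuation_ring v \<Longrightarrow> y \<in> valuation_ring v \<Longrightarrow> x * y \<in> valuation_ring v"
  "x \<in> valuation_ring v \<Longrightarrow> - x \<in> valuation_ring v"
proof -
  show "x + y \<in> valuation_ring v" if "x \<in> valuation_ring v" "y \<in> valuation_ring v"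
  proof (cases "x = 0 \<or> y = 0 \<or> x + y = 0")
    case False
    then have "min (v x) (v y) \<le> v (x + y)" using v unfolding valuation_def by blast
    then show ?thesis using that False unfolding valuation_ring_def by auto
  qed (use that in \<open>auto simp: valuation_ring_def\<close>)
  show "x * y \<in> valuation_ring v" if "x \<in> valuation_ring v" "y \<in> valuation_ring v"
    using that by (cases "x = 0 \<or> y = 0") (auto simp: valuation_ring_def val_mult)
  show "- x \<in> valuation_ring v" if "x \<in> valuation_ring v"
    using that by (cases "x = 0") (auto simp: valuation_ring_def val_uminus)
qed (simp_all add: valuation_ring_def val_one)

lemma valuation_ring_diff: "x \<in> valuation_ring v \<Longrightarrow> y \<in> valuation_ring v \<Longrightarrow> x - y \<in> valuation_ring v"
  using valuation_ring_closed(3)[of x "- y"] valuation_ring_closed(5)[of y] by simp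

lemma valuation_ring_sum: "(\<And>x. x \<in> A \<Longrightarrow> g x \<in> valuation_ring v) \<Longrightarrow> sum g A \<in> valuation_ring v"
  by (induction A rule: infinite_finite_induct) (simp_all add: valuation_ring_closed)

lemma valuation_ring_prod: "(\<And>x. x \<in> A \<Longrightarrow> g x \<in> valuation_ring v) \<Longrightarrow> prod g A \<in> valuation_ring v"
  by (induction A rule: infinite_finite_induct) (simp_all add: valuation_ring_closed)

text \<open>A smallest generating subfamily of the lattice spanned modulo \<open>I\<close> is independent: a relation,
  divided by a coefficient of least valuation, expresses one generator through the others.\<close>

lemma lattice_basis:
  fixes n :: "'e \<Rightarrow> 'v::comm_ring_1"
  assumes k: "unital_hom k" and S: "finite S"
    and I: "0 \<in> I" "\<And>a b. a \<in> I \<Longrightarrow> b \<in> I \<Longrightarrow> a + b \<in> I" "\<And>c a. a \<in> I \<Longrightarrow> k c * a \<in> I"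
  obtains B c where "B \<subseteq> S" "\<forall>e\<in>S. \<forall>b\<in>B. c e b \<in> valuation_ring v"
    "\<forall>e\<in>S. n e - (\<Sum>b\<in>B. k (c e b) * n b) \<in> I"
    "\<forall>d. (\<Sum>b\<in>B. k (d b) * n b) \<in> I \<longrightarrow> (\<forall>b\<in>B. d b = 0)"
proof -
  note k = unital_homD[OF k]
  define P where "P B \<longleftrightarrow> B \<subseteq> S \<and> (\<exists>c. \<forall>e\<in>S. (\<forall>b\<in>B. c e b \<in> valuation_ring v) \<and>
    n e - (\<Sum>b\<in>B. k (c e b) * n b) \<in> I)" for B
  have "P S"
  proof -
    have "n e - (\<Sum>b\<in>S. k (if b = e then 1 else 0) * n b) \<in> I" if "e \<in> S" for e
    proof -
      have "(\<Sum>b\<in>S. k (if b = e then 1 else 0) * n b) = (\<Sum>b\<in>S. if b = e then n b else 0)"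
        by (intro sum.cong) (simp_all add: k)
      then show ?thesis using that S I by simp
    qed
    then show ?thesis unfolding P_def
      by (intro conjI exI[of _ "\<lambda>e b. if b = e then 1 else 0"]) (simp_all add: valuation_ring_closed)
  qed
  then obtain B where B: "P B" and min: "\<And>B'. P B' \<Longrightarrow> card B \<le> card B'"
    using arg_min_natI[of P _ card] arg_min_nat_le[of P _ card] by metis
  then obtain c where c: "\<And>e b. e \<in> S \<Longrightarrow> b \<in> B \<Longrightarrow> c e b \<in> valuation_ring v"
    "\<And>e. e \<in> S \<Longrightarrow> n e - (\<Sum>b\<in>B. k (c e b) * n b) \<in> I" and BS: "B \<subseteq> S" unfolding P_def by metis
  have fB: "finite B" using BS S finite_subset by blast
  have indep: "\<forall>b\<in>B. d b = 0" if d: "(\<Sum>b\<in>B. k (d b) * n b) \<in> I" for d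
  proof (rule ccontr)
    assume "\<not> (\<forall>b\<in>B. d b = 0)"
    then have ne: "{b\<in>B. d b \<noteq> 0} \<noteq> {}" by blast
    then obtain b0 where b0: "b0 \<in> B" "d b0 \<noteq> 0" and least: "\<And>b. b \<in> B \<Longrightarrow> d b \<noteq> 0 \<Longrightarrow> v (d b0) \<le> v (d b)"
      using ex_is_arg_min_if_finite[OF _ ne, of "\<lambda>b. v (d b)"] fB
      unfolding is_arg_min_linorder by auto
    have q: "d b / d b0 \<in> valuation_ring v" if "b \<in> B" for b
      using least[OF that] b0 by (cases "d b = 0") (auto simp: valuation_ring_def val_divide)
    have rel: "n b0 + (\<Sum>b\<in>B - {b0}. k (d b / d b0) * n b) \<in> I"
    proof -
      have "k (inverse (d b0)) * (\<Sum>b\<in>B. k (d b) * n b) \<in> I" by (rule I(3)[OF d])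
      also have "k (inverse (d b0)) * (\<Sum>b\<in>B. k (d b) * n b) = (\<Sum>b\<in>B. k (d b / d b0) * n b)"
      proof -
        have "k (d b / d b0) = k (inverse (d b0)) * k (d b)" for b
          by (simp add: k(3)[symmetric] divide_inverse mult.commute)
        then show ?thesis by (simp only: sum_distrib_left mult.assoc)
      qed
      also have "\<dots> = n b0 + (\<Sum>b\<in>B - {b0}. k (d b / d b0) * n b)"
        using fB b0 by (subst sum.remove[of B b0]) (simp_all add: k)
      finally show ?thesis .
    qed
    have "P (B - {b0})" unfolding P_def
    proof (intro conjI exI ballI)
      fix e assume e: "e \<in> S"
      let ?c = "\<lambda>e b. c e b - c e b0 * (d b / d b0)"
      show "?c e b \<in> valuation_ring v" if "b \<in> B - {b0}" for b
        using that b0 c(1)[OF e] q by (simp add: valuation_ring_diff valuation_ring_closed del: times_divide_eq_right)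
      have eq: "n e - (\<Sum>b\<in>B - {b0}. k (?c e b) * n b) =
        (n e - (\<Sum>b\<in>B. k (c e b) * n b)) + k (c e b0) * (n b0 + (\<Sum>b\<in>B - {b0}. k (d b / d b0) * n b))"
        using fB b0 by (simp add: sum.remove[of B b0] k left_diff_distrib sum_subtractf distrib_left
            sum_distrib_left mult.assoc del: times_divide_eq_right)
      show "n e - (\<Sum>b\<in>B - {b0}. k (?c e b) * n b) \<in> I"
        unfolding eq by (rule I(2)[OF c(2)[OF e] I(3)[OF rel]])
    qed (use BS in auto)
    then have "card B \<le> card (B - {b0})" by (rule min)
    then show False using fB b0 by (metis card_Diff1_less not_le)
  qed
  show thesis
  proof (rule that[of B c, OF BS]; intro ballI allI impI)
    show "c e b \<in> valuation_ring v" if "e \<in> S" "b \<in> B" for e b by (rule c(1)[OF that])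
    show "n e - (\<Sum>b\<in>B. k (c e b) * n b) \<in> I" if "e \<in> S" for e by (rule c(2)[OF that])
    show "d b = 0" if "(\<Sum>b\<in>B. k (d b) * n b) \<in> I" "b \<in> B" for d b
      by (rule bspec[OF indep[OF that(1)] that(2)])
  qed
qed

end

text \<open>If the residue field were finite, the product of all \<open>X - l r\<close> over lifts
  \<open>l r\<close> of its elements, increased by 1, would have a root \<open>z\<close>. A
  nonintegral \<open>z\<close> would make every factor, hence the product, of negative valuation,
  although the product is -1. So \<open>z\<close> is integral, and reduction gives a product equal
  to -1 with the zero factor \<open>res z - res z\<close>.\<close>

lemma residue_field_infinite:
  fixes v :: "'l::alg_closed_field \<Rightarrow> real" and res :: "'l \<Rightarrow> 'r::field"
  assumes v: "valuation v" and res: "residue_map v res"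
  shows "infinite (UNIV :: 'r set)"
proof
  assume fin: "finite (UNIV :: 'r set)"
  note O = valuation_ring_closed[OF v]
  have ra: "res (a + b) = res a + res b" and rm: "res (a * b) = res a * res b"
    if "a \<in> valuation_ring v" "b \<in> valuation_ring v" for a b
    using res that unfolding residue_map_def by auto
  have r1: "res 1 = 1" using res unfolding residue_map_def by auto
  have r0: "res 0 = 0" using ra[OF O(1) O(1)] by (metis add.right_neutral add_left_cancel)
  have rneg: "res (- a) = - res a" if "a \<in> valuation_ring v" for a
    using ra[of "- a" a] that O r0 by (simp add: eq_neg_iff_add_eq_0)
  have "\<exists>a. a \<in> valuation_ring v \<and> res a = r" for r
    using res unfolding residue_map_def by (metis UNIV_I imageE)
  then obtain l where l: "\<And>r. l r \<in> valuation_ring v" "\<And>r. res (l r) = r" by metis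
  let ?p = "(\<Prod>r\<in>UNIV. [:- l r, 1:]) + 1"
  have "degree (\<Prod>r\<in>(UNIV::'r set). [:- l r, 1:]) = card (UNIV :: 'r set)"
    by (subst degree_prod_eq_sum_degree) auto
  then have "degree (\<Prod>r\<in>(UNIV::'r set). [:- l r, 1:]) > 0" using fin by (simp add: finite_UNIV_card_ge_0)
  then have "degree ?p > 0" by (subst degree_add_eq_left) auto
  then obtain z where "poly ?p z = 0" using alg_closed_imp_poly_has_root by blast
  then have z: "(\<Prod>r\<in>UNIV. z - l r) = - 1" by (simp add: poly_prod eq_neg_iff_add_eq_0)
  have zO: "z \<in> valuation_ring v"
  proof (rule ccontr)
    assume n: "z \<notin> valuation_ring v"
    have nz: "z - l r \<noteq> 0" for r using n l(1)[of r] by auto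
    have neg: "v (z - l r) < 0" for r
    proof (rule ccontr)
      assume "\<not> v (z - l r) < 0"
      then have "z - l r \<in> valuation_ring v" unfolding valuation_ring_def by simp
      then have "(z - l r) + l r \<in> valuation_ring v" by (rule O(3)[OF _ l(1)])
      then show False using n by simp
    qed
    have "v (\<Prod>r\<in>UNIV. z - l r) = (\<Sum>r\<in>UNIV. v (z - l r))" by (rule val_prod[OF v]) (rule nz)
    also have "\<dots> < 0" using sum_strict_mono[of UNIV "\<lambda>r. v (z - l r)" "\<lambda>_. 0"] neg fin by simp
    finally show False using z val_uminus[OF v, of 1] val_one[OF v] by simp
  qed
  have "res (\<Prod>r\<in>A. z - l r) = (\<Prod>r\<in>A. res z - r)" for A
  proof (induction A rule: infinite_finite_induct)
    case (insert r A)
    have "z - l r \<in> valuation_ring v" for r by (rule valuation_ring_diff[OF v zO l(1)])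
    moreover have "res (z - l r) = res z - r" for r using ra[of z "- l r"] zO l rneg O by simp
    ultimately show ?case using insert rm valuation_ring_prod[OF v, of A "\<lambda>r. z - l r"] by simp
  qed (simp_all add: r1)
  then have "(\<Prod>r\<in>UNIV. res z - r) = - 1" using z rneg[of 1] O r1 by metis
  moreover have "(\<Prod>r\<in>UNIV. res z - r) = 0" using fin by (simp add: prod_zero_iff)
  ultimately show False by simp
qed

section \<open>Spectra of domains\<close>

text \<open>The operations of \<open>localization\<close> are unions over all representatives; once
  the resulting class is independent of the representatives, the union collapses to it.\<close>

lemma UN_pairs_const:
  assumes "\<And>x y z w. (x, y) \<in> X \<Longrightarrow> (z, w) \<in> Y \<Longrightarrow> h x y z w = C" "(a, f) \<in> X" "(b, g) \<in> Y"
  shows "(\<Union>(x, y)\<in>X. \<Union>(z, w)\<in>Y. h x y z w) = C"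
proof
  show "(\<Union>(x, y)\<in>X. \<Union>(z, w)\<in>Y. h x y z w) \<subseteq> C" using assms(1) by blast
  have "C = h a f b g" using assms by blast
  then show "C \<subseteq> (\<Union>(x, y)\<in>X. \<Union>(z, w)\<in>Y. h x y z w)" using assms(2,3) by blast
qed

context domain
begin

text \<open>The auxiliary factor \<open>h\<close> avoids a prime ideal, hence is nonzero and cancels
  in a domain: equality of fractions is plain cross multiplication.\<close>

lemma fraction_eq:
  assumes p: "primeideal p R" and a: "a \<in> carrier R" and f: "f \<in> carrier R - p"
  shows "fraction R p a f = {(b, g). b \<in> carrier R \<and> g \<in> carrier R - p \<and> g \<otimes> a = f \<otimes> b}"
proof -
  interpret p: primeideal p R by (rule p)
  have "(\<exists>h\<in>carrier R - p. h \<otimes> (g \<otimes> a \<ominus> f \<otimes> b) = \<zero>) \<longleftrightarrow> g \<otimes> a = f \<otimes> b"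
    if "b \<in> carrier R" "g \<in> carrier R - p" for b g
  proof
    assume "\<exists>h\<in>carrier R - p. h \<otimes> (g \<otimes> a \<ominus> f \<otimes> b) = \<zero>"
    then obtain h where h: "h \<in> carrier R - p" "h \<otimes> (g \<otimes> a \<ominus> f \<otimes> b) = \<zero>" by blast
    moreover have "h \<noteq> \<zero>" using h p.zero_closed by auto
    ultimately have "g \<otimes> a \<ominus> f \<otimes> b = \<zero>" using integral a f that by auto
    then show "g \<otimes> a = f \<otimes> b" using a f that by (metis DiffD1 a_inv_closed m_closed minus_eq minus_equality minus_minus)
  next
    assume "g \<otimes> a = f \<otimes> b"
    then have "f \<otimes> (g \<otimes> a \<ominus> f \<otimes> b) = \<zero>" using a f that by (simp add: minus_eq r_neg)
    then show "\<exists>h\<in>carrier R - p. h \<otimes> (g \<otimes> a \<ominus> f \<otimes> b) = \<zero>" using f by blast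
  qed
  then show ?thesis unfolding fraction_def by auto
qed

lemma frac_trans:
  assumes "a \<in> carrier R" "b \<in> carrier R" "c \<in> carrier R" "f \<in> carrier R" "g \<in> carrier R"
    "h \<in> carrier R" "f \<noteq> \<zero>" "f \<otimes> b = g \<otimes> a" "f \<otimes> c = h \<otimes> a"
  shows "g \<otimes> c = h \<otimes> b"
proof -
  have "f \<otimes> (g \<otimes> c) = g \<otimes> (f \<otimes> c)" using assms(1-6) by (simp add: m_lcomm)
  also have "\<dots> = h \<otimes> (g \<otimes> a)" using assms by (simp add: m_lcomm)
  also have "\<dots> = f \<otimes> (h \<otimes> b)" using assms(1-6) assms(8)[symmetric] by (simp add: m_lcomm)
  finally show ?thesis using assms by (simp add: m_lcancel)
qed

lemma fraction_eq_iff: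
  assumes p: "primeideal p R" and "a \<in> carrier R" "f \<in> carrier R - p" "b \<in> carrier R" "g \<in> carrier R - p"
  shows "fraction R p a f = fraction R p b g \<longleftrightarrow> g \<otimes> a = f \<otimes> b"
proof -
  interpret p: primeideal p R by (rule p)
  have nz: "x \<noteq> \<zero>" if "x \<in> carrier R - p" for x using that p.zero_closed by auto
  show ?thesis
  proof
    assume "fraction R p a f = fraction R p b g"
    moreover have "(a, f) \<in> fraction R p a f" using assms by (simp add: fraction_eq)
    ultimately show "g \<otimes> a = f \<otimes> b" using assms by (auto simp: fraction_eq)
  next
    assume e: "g \<otimes> a = f \<otimes> b"
    have "h \<otimes> a = f \<otimes> c \<longleftrightarrow> h \<otimes> b = g \<otimes> c" if "c \<in> carrier R" "h \<in> carrier R - p" for c h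
      using frac_trans[of a b c f g h] frac_trans[of b a c g f h] that assms e nz[OF assms(3)] nz[OF assms(5)]
      by (metis DiffD1)
    then show "fraction R p a f = fraction R p b g" using assms by (auto simp: fraction_eq)
  qed
qed

lemma fraction_self: "primeideal p R \<Longrightarrow> a \<in> carrier R \<Longrightarrow> f \<in> carrier R - p \<Longrightarrow> (a, f) \<in> fraction R p a f"
  by (simp add: fraction_eq)

lemma prime_mult_closed:
  assumes "primeideal p R" "f \<in> carrier R - p" "g \<in> carrier R - p"
  shows "f \<otimes> g \<in> carrier R - p"
  using primeideal.I_prime[OF assms(1)] assms(2,3) by auto

lemma prime_one: "primeideal p R \<Longrightarrow> \<one> \<in> carrier R - p"
  using ideal.one_imp_carrier primeideal.I_notcarr primeideal.axioms(1) by fastforce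

lemma fraction_mult:
  assumes p: "primeideal p R" and "a \<in> carrier R" "f \<in> carrier R - p" "b \<in> carrier R" "g \<in> carrier R - p"
  shows "fraction R p a f \<otimes>\<^bsub>localization R p\<^esub> fraction R p b g = fraction R p (a \<otimes> b) (f \<otimes> g)"
proof -
  have "fraction R p (a' \<otimes> b') (f' \<otimes> g') = fraction R p (a \<otimes> b) (f \<otimes> g)"
    if "(a', f') \<in> fraction R p a f" "(b', g') \<in> fraction R p b g" for a' b' f' g'
  proof -
    have c: "a' \<in> carrier R" "f' \<in> carrier R - p" "f' \<otimes> a = f \<otimes> a'"
      "b' \<in> carrier R" "g' \<in> carrier R - p" "g' \<otimes> b = g \<otimes> b'"
      using that assms by (auto simp: fraction_eq)
    have "(f \<otimes> g) \<otimes> (a' \<otimes> b') = (f \<otimes> a') \<otimes> (g \<otimes> b')" using assms c(1,2,4,5) by (simp add: m_ac)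
    also have "\<dots> = (f' \<otimes> a) \<otimes> (g' \<otimes> b)" using c by simp
    also have "\<dots> = (f' \<otimes> g') \<otimes> (a \<otimes> b)" using assms c(1,2,4,5) by (simp add: m_ac)
    finally show ?thesis
      using assms c prime_mult_closed[OF p, of f g] prime_mult_closed[OF p, of f' g']
      by (subst fraction_eq_iff) auto
  qed
  note * = UN_pairs_const[OF this fraction_self[OF assms(1-3)] fraction_self[OF assms(1,4,5)]]
  show ?thesis unfolding localization_def by (simp add: *)
qed

lemma fraction_add:
  assumes p: "primeideal p R" and "a \<in> carrier R" "f \<in> carrier R - p" "b \<in> carrier R" "g \<in> carrier R - p"
  shows "fraction R p a f \<oplus>\<^bsub>localization R p\<^esub> fraction R p b g = fraction R p (a \<otimes> g \<oplus> b \<otimes> f) (f \<otimes> g)"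
proof -
  have "fraction R p (a' \<otimes> g' \<oplus> b' \<otimes> f') (f' \<otimes> g') = fraction R p (a \<otimes> g \<oplus> b \<otimes> f) (f \<otimes> g)"
    if "(a', f') \<in> fraction R p a f" "(b', g') \<in> fraction R p b g" for a' b' f' g'
  proof -
    have c: "a' \<in> carrier R" "f' \<in> carrier R - p" "f' \<otimes> a = f \<otimes> a'"
      "b' \<in> carrier R" "g' \<in> carrier R - p" "g' \<otimes> b = g \<otimes> b'"
      using that assms by (auto simp: fraction_eq)
    have "(f \<otimes> g) \<otimes> (a' \<otimes> g' \<oplus> b' \<otimes> f') = (f \<otimes> a') \<otimes> (g \<otimes> g') \<oplus> (g \<otimes> b') \<otimes> (f \<otimes> f')"
      using assms c(1,2,4,5) by (simp add: r_distr m_ac)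
    also have "\<dots> = (f' \<otimes> a) \<otimes> (g \<otimes> g') \<oplus> (g' \<otimes> b) \<otimes> (f \<otimes> f')" using c by simp
    also have "\<dots> = (f' \<otimes> g') \<otimes> (a \<otimes> g \<oplus> b \<otimes> f)" using assms c(1,2,4,5) by (simp add: r_distr m_ac)
    finally show ?thesis
      using assms c prime_mult_closed[OF p, of f g] prime_mult_closed[OF p, of f' g']
      by (subst fraction_eq_iff) auto
  qed
  note * = UN_pairs_const[OF this fraction_self[OF assms(1-3)] fraction_self[OF assms(1,4,5)]]
  show ?thesis unfolding localization_def by (simp add: *)
qed

lemma localization_carrier: "X \<in> carrier (localization R p) \<longleftrightarrow>
  (\<exists>a f. a \<in> carrier R \<and> f \<in> carrier R - p \<and> X = fraction R p a f)"
  unfolding localization_def by auto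

lemma localization_zero: "\<zero>\<^bsub>localization R p\<^esub> = fraction R p \<zero> \<one>"
  and localization_one: "\<one>\<^bsub>localization R p\<^esub> = fraction R p \<one> \<one>"
  unfolding localization_def by auto

lemma fraction_eqI:
  assumes "primeideal p R" "a \<in> carrier R" "f \<in> carrier R - p" "b \<in> carrier R" "g \<in> carrier R - p"
    "g \<otimes> a = f \<otimes> b"
  shows "fraction R p a f = fraction R p b g"
  using assms fraction_eq_iff by blast

lemma localization_domain:
  assumes p: "primeideal p R"
  shows "domain (localization R p)"
proof -
  let ?L = "localization R p"
  note [simp del] = Diff_iff
  have car [simp]: "f \<in> carrier R - p \<Longrightarrow> f \<in> carrier R" for f by (simp add: Diff_iff)
  have one [simp]: "\<one> \<in> carrier R - p" and mc [simp]: "\<And>f g. f \<in> carrier R - p \<Longrightarrow> g \<in> carrier R - p \<Longrightarrow> f \<otimes> g \<in> carrier R - p"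
    using prime_one prime_mult_closed p by auto
  have fc [simp]: "a \<in> carrier R \<Longrightarrow> f \<in> carrier R - p \<Longrightarrow> fraction R p a f \<in> carrier ?L" for a f
    using localization_carrier by blast
  note ls [simp] = fraction_mult[OF p] fraction_add[OF p] localization_zero localization_one
  have "abelian_group ?L"
  proof (rule abelian_groupI)
    fix X Y Z assume "X \<in> carrier ?L" "Y \<in> carrier ?L" "Z \<in> carrier ?L"
    then obtain a f b g c h where "a \<in> carrier R" "f \<in> carrier R - p" "X = fraction R p a f"
      "b \<in> carrier R" "g \<in> carrier R - p" "Y = fraction R p b g"
      "c \<in> carrier R" "h \<in> carrier R - p" "Z = fraction R p c h" by (unfold localization_carrier) blast
    then show "X \<oplus>\<^bsub>?L\<^esub> Y \<oplus>\<^bsub>?L\<^esub> Z = X \<oplus>\<^bsub>?L\<^esub> (Y \<oplus>\<^bsub>?L\<^esub> Z)"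
      by (simp add: l_distr r_distr m_ac a_ac)
  next
    fix X Y assume "X \<in> carrier ?L" "Y \<in> carrier ?L"
    then obtain a f b g where c: "a \<in> carrier R" "f \<in> carrier R - p" "X = fraction R p a f"
      "b \<in> carrier R" "g \<in> carrier R - p" "Y = fraction R p b g" by (unfold localization_carrier) blast
    then show "X \<oplus>\<^bsub>?L\<^esub> Y = Y \<oplus>\<^bsub>?L\<^esub> X" by (simp add: m_ac a_ac)
    show "X \<oplus>\<^bsub>?L\<^esub> Y \<in> carrier ?L" using c by simp
  next
    fix X assume "X \<in> carrier ?L"
    then obtain a f where c: "a \<in> carrier R" "f \<in> carrier R - p" "X = fraction R p a f"
      by (unfold localization_carrier) blast
    then show "\<zero>\<^bsub>?L\<^esub> \<oplus>\<^bsub>?L\<^esub> X = X" by simp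
    have "fraction R p (\<ominus> a) f \<oplus>\<^bsub>?L\<^esub> X = \<zero>\<^bsub>?L\<^esub>"
    proof -
      have "(\<ominus> a \<otimes> f \<oplus> a \<otimes> f) = \<zero>" using c(1,2) by (metis car l_minus l_neg m_closed)
      then have "fraction R p (\<ominus> a) f \<oplus>\<^bsub>?L\<^esub> X = fraction R p \<zero> (f \<otimes> f)" using c by simp
      also have "\<dots> = fraction R p \<zero> \<one>" using c by (intro fraction_eqI[OF p]) auto
      finally show ?thesis by simp
    qed
    then show "\<exists>Y\<in>carrier ?L. Y \<oplus>\<^bsub>?L\<^esub> X = \<zero>\<^bsub>?L\<^esub>" using c fc[of "\<ominus> a" f] by blast
  qed simp
  moreover have "comm_monoid ?L"
  proof (rule comm_monoidI)
    fix X Y Z assume "X \<in> carrier ?L" "Y \<in> carrier ?L" "Z \<in> carrier ?L"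
    then obtain a f b g c h where "a \<in> carrier R" "f \<in> carrier R - p" "X = fraction R p a f"
      "b \<in> carrier R" "g \<in> carrier R - p" "Y = fraction R p b g"
      "c \<in> carrier R" "h \<in> carrier R - p" "Z = fraction R p c h" by (unfold localization_carrier) blast
    then show "X \<otimes>\<^bsub>?L\<^esub> Y \<otimes>\<^bsub>?L\<^esub> Z = X \<otimes>\<^bsub>?L\<^esub> (Y \<otimes>\<^bsub>?L\<^esub> Z)"
      by (simp add: m_ac)
  next
    fix X Y assume "X \<in> carrier ?L" "Y \<in> carrier ?L"
    then obtain a f b g where c: "a \<in> carrier R" "f \<in> carrier R - p" "X = fraction R p a f"
      "b \<in> carrier R" "g \<in> carrier R - p" "Y = fraction R p b g" by (unfold localization_carrier) blast
    then show "X \<otimes>\<^bsub>?L\<^esub> Y = Y \<otimes>\<^bsub>?L\<^esub> X" by (simp add: m_ac)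
    show "X \<otimes>\<^bsub>?L\<^esub> Y \<in> carrier ?L" using c by simp
  next
    fix X assume "X \<in> carrier ?L"
    then obtain a f where c: "a \<in> carrier R" "f \<in> carrier R - p" "X = fraction R p a f"
      by (unfold localization_carrier) blast
    then show "\<one>\<^bsub>?L\<^esub> \<otimes>\<^bsub>?L\<^esub> X = X" by simp
  qed simp
  moreover have "(X \<oplus>\<^bsub>?L\<^esub> Y) \<otimes>\<^bsub>?L\<^esub> Z = X \<otimes>\<^bsub>?L\<^esub> Z \<oplus>\<^bsub>?L\<^esub> Y \<otimes>\<^bsub>?L\<^esub> Z"
    if XYZ: "X \<in> carrier ?L" "Y \<in> carrier ?L" "Z \<in> carrier ?L" for X Y Z
  proof -
    obtain a f b g c h where c: "a \<in> carrier R" "f \<in> carrier R - p" "X = fraction R p a f"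
      "b \<in> carrier R" "g \<in> carrier R - p" "Y = fraction R p b g"
      "c \<in> carrier R" "h \<in> carrier R - p" "Z = fraction R p c h" using XYZ unfolding localization_carrier by blast
    then show ?thesis
      by simp (rule fraction_eqI[OF p]; simp add: l_distr r_distr m_ac)
  qed
  ultimately interpret L: cring ?L by (rule cringI)
  show ?thesis
  proof (intro domain.intro L.is_cring domain_axioms.intro)
    show "\<one>\<^bsub>?L\<^esub> \<noteq> \<zero>\<^bsub>?L\<^esub>" using fraction_eq_iff[OF p, of \<one> \<one> \<zero> \<one>] by simp
    fix X Y assume XY: "X \<otimes>\<^bsub>?L\<^esub> Y = \<zero>\<^bsub>?L\<^esub>" "X \<in> carrier ?L" "Y \<in> carrier ?L"
    then obtain a f b g where c: "a \<in> carrier R" "f \<in> carrier R - p" "X = fraction R p a f"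
      "b \<in> carrier R" "g \<in> carrier R - p" "Y = fraction R p b g" by (unfold localization_carrier) blast
    then have "a \<otimes> b = \<zero>" using XY fraction_eq_iff[OF p, of "a \<otimes> b" "f \<otimes> g" \<zero> \<one>] by simp
    then have "a = \<zero> \<or> b = \<zero>" using c integral by blast
    then show "X = \<zero>\<^bsub>?L\<^esub> \<or> Y = \<zero>\<^bsub>?L\<^esub>"
      using c fraction_eq_iff[OF p, of a f \<zero> \<one>] fraction_eq_iff[OF p, of b g \<zero> \<one>] by auto
  qed
qed

text \<open>The zero ideal is the generic point: it is prime and contained in every prime, so a set
  that is not inside some prime is not inside it either.\<close>

lemma zariski_openD:
  assumes "V \<in> zariski_opens R" "p \<in> V"
  shows "primeideal p R" "{\<zero>} \<in> V"
proof -
  obtain S where S: "V = {p. primeideal p R \<and> \<not> S \<subseteq> p}" using assms(1) unfolding zariski_opens_def by auto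
  show p: "primeideal p R" using S assms(2) by auto
  have "\<zero> \<in> p" using p by (simp add: additive_subgroup.zero_closed ideal.axioms(1) primeideal.axioms(1))
  then show "{\<zero>} \<in> V" using S assms(2) zeroprimeideal by auto
qed

text \<open>A prime ideal contains all products of elements of \<open>S\<close> and \<open>T\<close>
  exactly if it contains \<open>S\<close> or \<open>T\<close>.\<close>

lemma zariski_open_Int:
  assumes "V \<in> zariski_opens R" "W \<in> zariski_opens R"
  shows "V \<inter> W \<in> zariski_opens R"
proof -
  obtain S T where S: "S \<subseteq> carrier R" "V = {p. primeideal p R \<and> \<not> S \<subseteq> p}"
    and T: "T \<subseteq> carrier R" "W = {p. primeideal p R \<and> \<not> T \<subseteq> p}"
    using assms unfolding zariski_opens_def by auto
  let ?ST = "{a \<otimes> b | a b. a \<in> S \<and> b \<in> T}"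
  have "\<not> ?ST \<subseteq> p \<longleftrightarrow> \<not> S \<subseteq> p \<and> \<not> T \<subseteq> p" if p: "primeideal p R" for p
  proof -
    interpret p: primeideal p R by (rule p)
    show ?thesis
    proof
      assume "\<not> ?ST \<subseteq> p"
      then obtain a b where "a \<in> S" "b \<in> T" "a \<otimes> b \<notin> p" by auto
      then show "\<not> S \<subseteq> p \<and> \<not> T \<subseteq> p" using S T p.I_l_closed p.I_r_closed by blast
    next
      assume "\<not> S \<subseteq> p \<and> \<not> T \<subseteq> p"
      then obtain a b where "a \<in> S" "b \<in> T" "a \<notin> p" "b \<notin> p" by auto
      then show "\<not> ?ST \<subseteq> p" using S T p.I_prime by blast
    qed
  qed
  then have *: "q \<in> V \<inter> W \<longleftrightarrow> primeideal q R \<and> \<not> ?ST \<subseteq> q" for q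
    unfolding S(2) T(2) Int_iff mem_Collect_eq by (cases "primeideal q R") simp_all
  have "V \<inter> W = {p. primeideal p R \<and> \<not> ?ST \<subseteq> p}"
    unfolding set_eq_iff mem_Collect_eq by (rule allI) (rule *)
  moreover have "?ST \<subseteq> carrier R" using S T by auto
  ultimately show ?thesis unfolding zariski_opens_def mem_Collect_eq by (intro exI conjI)
qed

section \<open>Sections of the structure sheaf of a domain\<close>

definition local_fraction :: "'a set set \<Rightarrow> ('a set \<Rightarrow> ('a \<times> 'a) set) \<Rightarrow> 'a set \<Rightarrow> 'a set set \<Rightarrow> 'a \<Rightarrow> 'a \<Rightarrow> bool" where
  "local_fraction U s p V a f \<longleftrightarrow> V \<in> zariski_opens R \<and> p \<in> V \<and> V \<subseteq> U \<and> a \<in> carrier R \<and> f \<in> carrier R \<and>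
     (\<forall>q\<in>V. f \<in> carrier R - q \<and> s q = fraction R q a f)"

text \<open>A germ that is locally a fraction lies in the stalk automatically, so of the dependent
  product only extensionality has to be checked.\<close>

lemma section_iff:
  assumes "U \<in> zariski_opens R"
  shows "s \<in> carrier (structure_sheaf R U) \<longleftrightarrow>
    s \<in> extensional U \<and> (\<forall>p\<in>U. \<exists>V a f. local_fraction U s p V a f)"
proof -
  have loc: "(\<exists>V a f. local_fraction U s p V a f) \<longleftrightarrow> (\<exists>V\<in>zariski_opens R. p \<in> V \<and> V \<subseteq> U \<and>
      (\<exists>a\<in>carrier R. \<exists>f\<in>carrier R. \<forall>q\<in>V. f \<notin> q \<and> s q = fraction R q a f))" for p
  proof
    assume "\<exists>V a f. local_fraction U s p V a f"
    then obtain V a f where V: "local_fraction U s p V a f" by blast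
    show "\<exists>V\<in>zariski_opens R. p \<in> V \<and> V \<subseteq> U \<and>
      (\<exists>a\<in>carrier R. \<exists>f\<in>carrier R. \<forall>q\<in>V. f \<notin> q \<and> s q = fraction R q a f)"
      using V unfolding local_fraction_def
      by (intro bexI[of _ V] conjI bexI[of _ a] bexI[of _ f] ballI) simp_all
  next
    assume "\<exists>V\<in>zariski_opens R. p \<in> V \<and> V \<subseteq> U \<and>
      (\<exists>a\<in>carrier R. \<exists>f\<in>carrier R. \<forall>q\<in>V. f \<notin> q \<and> s q = fraction R q a f)"
    then obtain V a f where "V \<in> zariski_opens R" "p \<in> V" "V \<subseteq> U" "a \<in> carrier R" "f \<in> carrier R"
      "\<forall>q\<in>V. f \<notin> q \<and> s q = fraction R q a f" by blast
    then have "local_fraction U s p V a f" unfolding local_fraction_def by simp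
    then show "\<exists>V a f. local_fraction U s p V a f" by blast
  qed
  have "s p \<in> carrier (localization R p)" if "local_fraction U s p V a f" for p V a f
  proof -
    have "a \<in> carrier R" "f \<in> carrier R - p" "s p = fraction R p a f"
      using that unfolding local_fraction_def by auto
    then show ?thesis using localization_carrier by blast
  qed
  then have car: "s p \<in> carrier (localization R p)" if "\<exists>V a f. local_fraction U s p V a f" for p
    using that by blast
  have "s \<in> carrier (structure_sheaf R U) \<longleftrightarrow>
    s \<in> (\<Pi>\<^sub>E p\<in>U. carrier (localization R p)) \<and> (\<forall>p\<in>U. \<exists>V a f. local_fraction U s p V a f)"
    unfolding structure_sheaf_def loc by simp
  then show ?thesis using car by (auto simp only: PiE_iff)
qed

lemma local_fractionD:
  assumes "local_fraction U s p V a f"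
  shows "V \<in> zariski_opens R" "p \<in> V" "V \<subseteq> U" "a \<in> carrier R" "f \<in> carrier R"
    "q \<in> V \<Longrightarrow> f \<in> carrier R - q" "q \<in> V \<Longrightarrow> s q = fraction R q a f"
  using assms unfolding local_fraction_def by simp_all

lemma sectionI:
  assumes "U \<in> zariski_opens R" "s \<in> extensional U" "\<And>p. p \<in> U \<Longrightarrow> \<exists>V a f. local_fraction U s p V a f"
  shows "s \<in> carrier (structure_sheaf R U)"
  unfolding section_iff[OF assms(1)] using assms(2,3) by simp

lemma sectionD:
  assumes "U \<in> zariski_opens R" "s \<in> carrier (structure_sheaf R U)"
  shows "s \<in> extensional U" "p \<in> U \<Longrightarrow> \<exists>V a f. local_fraction U s p V a f"
  using assms(2) unfolding section_iff[OF assms(1)] by simp_all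

text \<open>Sums and products of \<open>a/f\<close> and \<open>b/g\<close> both have denominator
  \<open>f \<otimes> g\<close>, so one argument on the intersection of the two neighbourhoods closes
  the sections under either operation; \<open>k\<close> stands for the numerator.\<close>

lemma section_binop:
  assumes U: "U \<in> zariski_opens R"
    and s: "s \<in> carrier (structure_sheaf R U)" and t: "t \<in> carrier (structure_sheaf R U)"
    and h: "\<And>p a f b g. primeideal p R \<Longrightarrow> a \<in> carrier R \<Longrightarrow> f \<in> carrier R - p \<Longrightarrow>
        b \<in> carrier R \<Longrightarrow> g \<in> carrier R - p \<Longrightarrow> h p (fraction R p a f) (fraction R p b g) = fraction R p (k a f b g) (f \<otimes> g)"
    and k: "\<And>a f b g. a \<in> carrier R \<Longrightarrow> f \<in> carrier R \<Longrightarrow> b \<in> carrier R \<Longrightarrow> g \<in> carrier R \<Longrightarrow> k a f b g \<in> carrier R"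
  shows "(\<lambda>p\<in>U. h p (s p) (t p)) \<in> carrier (structure_sheaf R U)"
proof -
  have "\<exists>V a f. local_fraction U (\<lambda>p\<in>U. h p (s p) (t p)) p V a f" if p: "p \<in> U" for p
  proof -
    have "\<exists>V a f. local_fraction U s p V a f" "\<exists>V a f. local_fraction U t p V a f"
      using sectionD(2)[OF U s p] sectionD(2)[OF U t p] .
    then obtain V a f W b g where V: "local_fraction U s p V a f" and W: "local_fraction U t p W b g"
      by (elim exE)
    note V' = local_fractionD[OF V] and W' = local_fractionD[OF W]
    have "local_fraction U (\<lambda>p\<in>U. h p (s p) (t p)) p (V \<inter> W) (k a f b g) (f \<otimes> g)"
      unfolding local_fraction_def
    proof (intro conjI ballI)
      fix q assume q: "q \<in> V \<inter> W"
      then have "q \<in> U" "q \<in> V" "q \<in> W" using V'(3) by auto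
      have pq: "primeideal q R" using zariski_openD(1)[OF U \<open>q \<in> U\<close>] .
      have fg: "f \<in> carrier R - q" "g \<in> carrier R - q" using V'(6)[OF \<open>q \<in> V\<close>] W'(6)[OF \<open>q \<in> W\<close>] .
      show "f \<otimes> g \<in> carrier R - q" by (rule prime_mult_closed[OF pq fg])
      show "(\<lambda>p\<in>U. h p (s p) (t p)) q = fraction R q (k a f b g) (f \<otimes> g)"
        using h[OF pq V'(4) fg(1) W'(4) fg(2)] V'(7)[OF \<open>q \<in> V\<close>] W'(7)[OF \<open>q \<in> W\<close>] \<open>q \<in> U\<close> by simp
    next
      show "V \<inter> W \<subseteq> U" using V'(3) by blast
    qed (simp_all add: V' W' k zariski_open_Int)
    then show ?thesis by blast
  qed
  then show ?thesis by (rule sectionI[OF U restrict_extensional])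
qed

text \<open>Every nonempty open set contains the generic point, and a section is determined by its
  germ there. Hence a vanishing product has a factor that vanishes at the generic point and
  therefore everywhere.\<close>

lemma structure_sheaf_domain:
  assumes U: "U \<in> zariski_opens R" and ne: "U \<noteq> {}"
  shows "domain (structure_sheaf R U)"
proof -
  let ?F = "structure_sheaf R U" and ?L = "localization R"
  have pU: "primeideal p R" if "p \<in> U" for p using zariski_openD(1)[OF U that] .
  have dom: "domain (?L p)" if "p \<in> U" for p using localization_domain[OF pU[OF that]] .
  have gen: "{\<zero>} \<in> U" using zariski_openD(2)[OF U] ne by blast
  have ops: "s \<oplus>\<^bsub>?F\<^esub> t = (\<lambda>p\<in>U. s p \<oplus>\<^bsub>?L p\<^esub> t p)" "s \<otimes>\<^bsub>?F\<^esub> t = (\<lambda>p\<in>U. s p \<otimes>\<^bsub>?L p\<^esub> t p)"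
    "\<zero>\<^bsub>?F\<^esub> = (\<lambda>p\<in>U. \<zero>\<^bsub>?L p\<^esub>)" "\<one>\<^bsub>?F\<^esub> = (\<lambda>p\<in>U. \<one>\<^bsub>?L p\<^esub>)" for s t
    unfolding structure_sheaf_def by simp_all
  have ext: "s \<in> extensional U" and loc: "\<And>p. p \<in> U \<Longrightarrow> \<exists>V a f. local_fraction U s p V a f"
    if "s \<in> carrier ?F" for s using sectionD[OF U that] by simp_all
  have inL: "s p \<in> carrier (?L p)" if "s \<in> carrier ?F" "p \<in> U" for s p
    using that unfolding structure_sheaf_def by (simp add: PiE_iff)
  have eqI: "s = t" if "s \<in> extensional U" "t \<in> extensional U" "\<And>p. p \<in> U \<Longrightarrow> s p = t p" for s t :: "'a set \<Rightarrow> ('a \<times> 'a) set"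
    using that by (rule extensionalityI)
  note closed2 = section_binop[OF U]
  have closed0: "(\<lambda>p\<in>U. fraction R p a \<one>) \<in> carrier ?F" if a: "a \<in> carrier R" for a
  proof -
    have "\<exists>V b f. local_fraction U (\<lambda>p\<in>U. fraction R p a \<one>) p V b f" if p: "p \<in> U" for p
      unfolding local_fraction_def using U p a prime_one[OF pU]
      by (intro exI[of _ U] exI[of _ a] exI[of _ \<one>]) (simp del: Diff_iff)
    then show ?thesis by (rule sectionI[OF U restrict_extensional])
  qed
  have add: "s \<oplus>\<^bsub>?F\<^esub> t \<in> carrier ?F" if "s \<in> carrier ?F" "t \<in> carrier ?F" for s t
    unfolding ops by (rule closed2[OF that fraction_add]) auto
  have mult: "s \<otimes>\<^bsub>?F\<^esub> t \<in> carrier ?F" if "s \<in> carrier ?F" "t \<in> carrier ?F" for s t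
    unfolding ops by (rule closed2[OF that fraction_mult]) auto
  have zero: "\<zero>\<^bsub>?F\<^esub> \<in> carrier ?F" and one: "\<one>\<^bsub>?F\<^esub> \<in> carrier ?F"
    unfolding ops localization_zero localization_one by (rule closed0; simp)+
  have "abelian_group ?F"
  proof (rule abelian_groupI)
    fix s t u assume *: "s \<in> carrier ?F" "t \<in> carrier ?F" "u \<in> carrier ?F"
    show "s \<oplus>\<^bsub>?F\<^esub> t \<oplus>\<^bsub>?F\<^esub> u = s \<oplus>\<^bsub>?F\<^esub> (t \<oplus>\<^bsub>?F\<^esub> u)"
    proof (rule eqI)
      fix p assume p: "p \<in> U"
      interpret L: domain "?L p" by (rule dom[OF p])
      show "(s \<oplus>\<^bsub>?F\<^esub> t \<oplus>\<^bsub>?F\<^esub> u) p = (s \<oplus>\<^bsub>?F\<^esub> (t \<oplus>\<^bsub>?F\<^esub> u)) p"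
        using p inL * by (simp add: ops L.a_assoc)
    qed (use * add ext in auto)
  next
    fix s t assume *: "s \<in> carrier ?F" "t \<in> carrier ?F"
    show "s \<oplus>\<^bsub>?F\<^esub> t = t \<oplus>\<^bsub>?F\<^esub> s"
    proof (rule eqI)
      fix p assume p: "p \<in> U"
      interpret L: domain "?L p" by (rule dom[OF p])
      show "(s \<oplus>\<^bsub>?F\<^esub> t) p = (t \<oplus>\<^bsub>?F\<^esub> s) p"
        using p inL * by (simp add: ops L.a_comm)
    qed (use * add ext in auto)
  next
    fix s assume s: "s \<in> carrier ?F"
    show "\<zero>\<^bsub>?F\<^esub> \<oplus>\<^bsub>?F\<^esub> s = s"
    proof (rule eqI)
      fix p assume p: "p \<in> U"
      interpret L: domain "?L p" by (rule dom[OF p])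
      show "(\<zero>\<^bsub>?F\<^esub> \<oplus>\<^bsub>?F\<^esub> s) p = s p"
        using p inL s by (simp add: ops)
    qed (use s zero add ext in auto)
    \<comment> \<open>The negative is the product with the constant section -1, so that its being a
      section follows from closure under multiplication.\<close>
    let ?t = "\<lambda>p\<in>U. fraction R p (\<ominus> \<one>) \<one> \<otimes>\<^bsub>?L p\<^esub> s p"
    have c: "(\<lambda>p\<in>U. fraction R p (\<ominus> \<one>) \<one>) \<in> carrier ?F" by (rule closed0) simp
    have "?t = (\<lambda>p\<in>U. fraction R p (\<ominus> \<one>) \<one>) \<otimes>\<^bsub>?F\<^esub> s" unfolding ops by (intro eqI) auto
    then have "?t \<in> carrier ?F" using mult[OF c s] by simp
    moreover have "?t \<oplus>\<^bsub>?F\<^esub> s = \<zero>\<^bsub>?F\<^esub>"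
    proof (rule eqI)
      fix p assume p: "p \<in> U"
      interpret L: domain "?L p" by (rule dom[OF p])
      have 1: "fraction R p (\<ominus> \<one>) \<one> \<in> carrier (?L p)" using inL[OF c p] p by simp
      have "fraction R p (\<ominus> \<one>) \<one> \<oplus>\<^bsub>?L p\<^esub> \<one>\<^bsub>?L p\<^esub> = \<zero>\<^bsub>?L p\<^esub>"
        using fraction_add[OF pU[OF p], of "\<ominus> \<one>" \<one> \<one> \<one>] prime_one[OF pU[OF p]]
        by (simp add: localization_zero localization_one l_neg)
      then have "fraction R p (\<ominus> \<one>) \<one> \<otimes>\<^bsub>?L p\<^esub> s p \<oplus>\<^bsub>?L p\<^esub> s p = \<zero>\<^bsub>?L p\<^esub>"
        using L.l_distr[OF 1 L.one_closed inL[OF s p]] inL[OF s p] by simp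
      then show "(?t \<oplus>\<^bsub>?F\<^esub> s) p = \<zero>\<^bsub>?F\<^esub> p" using p by (simp add: ops)
    qed (auto simp: ops)
    ultimately show "\<exists>t\<in>carrier ?F. t \<oplus>\<^bsub>?F\<^esub> s = \<zero>\<^bsub>?F\<^esub>" by blast
  qed (use add zero in auto)
  moreover have "comm_monoid ?F"
  proof (rule comm_monoidI)
    fix s t u assume *: "s \<in> carrier ?F" "t \<in> carrier ?F" "u \<in> carrier ?F"
    show "s \<otimes>\<^bsub>?F\<^esub> t \<otimes>\<^bsub>?F\<^esub> u = s \<otimes>\<^bsub>?F\<^esub> (t \<otimes>\<^bsub>?F\<^esub> u)"
    proof (rule eqI)
      fix p assume p: "p \<in> U"
      interpret L: domain "?L p" by (rule dom[OF p])
      show "(s \<otimes>\<^bsub>?F\<^esub> t \<otimes>\<^bsub>?F\<^esub> u) p = (s \<otimes>\<^bsub>?F\<^esub> (t \<otimes>\<^bsub>?F\<^esub> u)) p"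
        using p inL * by (simp add: ops L.m_assoc)
    qed (use * mult ext in auto)
  next
    fix s t assume *: "s \<in> carrier ?F" "t \<in> carrier ?F"
    show "s \<otimes>\<^bsub>?F\<^esub> t = t \<otimes>\<^bsub>?F\<^esub> s"
    proof (rule eqI)
      fix p assume p: "p \<in> U"
      interpret L: domain "?L p" by (rule dom[OF p])
      show "(s \<otimes>\<^bsub>?F\<^esub> t) p = (t \<otimes>\<^bsub>?F\<^esub> s) p"
        using p inL * by (simp add: ops L.m_comm)
    qed (use * mult ext in auto)
  next
    fix s assume s: "s \<in> carrier ?F"
    show "\<one>\<^bsub>?F\<^esub> \<otimes>\<^bsub>?F\<^esub> s = s"
    proof (rule eqI)
      fix p assume p: "p \<in> U"
      interpret L: domain "?L p" by (rule dom[OF p])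
      show "(\<one>\<^bsub>?F\<^esub> \<otimes>\<^bsub>?F\<^esub> s) p = s p"
        using p inL s by (simp add: ops)
    qed (use s one mult ext in auto)
  qed (use mult one in auto)
  moreover have "(s \<oplus>\<^bsub>?F\<^esub> t) \<otimes>\<^bsub>?F\<^esub> u = s \<otimes>\<^bsub>?F\<^esub> u \<oplus>\<^bsub>?F\<^esub> t \<otimes>\<^bsub>?F\<^esub> u"
    if *: "s \<in> carrier ?F" "t \<in> carrier ?F" "u \<in> carrier ?F" for s t u
  proof (rule eqI)
    fix p assume p: "p \<in> U"
    interpret L: domain "?L p" by (rule dom[OF p])
    show "((s \<oplus>\<^bsub>?F\<^esub> t) \<otimes>\<^bsub>?F\<^esub> u) p = (s \<otimes>\<^bsub>?F\<^esub> u \<oplus>\<^bsub>?F\<^esub> t \<otimes>\<^bsub>?F\<^esub> u) p"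
      using p inL * by (simp add: ops L.l_distr)
  qed (use * add mult ext in auto)
  ultimately interpret F: cring ?F by (rule cringI)
  \<comment> \<open>Any neighbourhood on which \<open>s\<close> is a single fraction
    \<open>a/f\<close> contains the generic point, where the vanishing of \<open>a/f\<close> means
    \<open>a = \<zero>\<close>.\<close>
  have determined: "s = \<zero>\<^bsub>?F\<^esub>" if s: "s \<in> carrier ?F" "s {\<zero>} = \<zero>\<^bsub>?L {\<zero>}\<^esub>" for s
  proof (rule eqI)
    fix p assume p: "p \<in> U"
    obtain V a f where V: "local_fraction U s p V a f" using loc s p by blast
    then have "{\<zero>} \<in> V" using zariski_openD unfolding local_fraction_def by blast
    then have "fraction R {\<zero>} a f = fraction R {\<zero>} \<zero> \<one>" "f \<in> carrier R - {\<zero>}"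
      using V s unfolding local_fraction_def localization_zero by auto
    then have "a = \<zero>" using fraction_eq_iff[OF zeroprimeideal, of a f \<zero> \<one>] V unfolding local_fraction_def by simp
    moreover have "f \<in> carrier R - p" using V unfolding local_fraction_def by auto
    ultimately have "s p = fraction R p \<zero> \<one>"
      using V fraction_eqI[OF pU[OF p], of \<zero> f \<zero> \<one>] prime_one[OF pU[OF p]] unfolding local_fraction_def by simp
    then show "s p = \<zero>\<^bsub>?F\<^esub> p" using p by (simp add: ops localization_zero)
  qed (use s zero ext in auto)
  interpret G: domain "?L {\<zero>}" by (rule dom[OF gen])
  show ?thesis
  proof (intro domain.intro F.is_cring domain_axioms.intro)
    show "\<one>\<^bsub>?F\<^esub> \<noteq> \<zero>\<^bsub>?F\<^esub>"
    proof
      assume "\<one>\<^bsub>?F\<^esub> = \<zero>\<^bsub>?F\<^esub>"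
      then have "\<one>\<^bsub>?F\<^esub> {\<zero>} = \<zero>\<^bsub>?F\<^esub> {\<zero>}" by simp
      then show False using gen by (simp add: ops)
    qed
    fix s t assume st: "s \<otimes>\<^bsub>?F\<^esub> t = \<zero>\<^bsub>?F\<^esub>" "s \<in> carrier ?F" "t \<in> carrier ?F"
    then have "(s \<otimes>\<^bsub>?F\<^esub> t) {\<zero>} = \<zero>\<^bsub>?F\<^esub> {\<zero>}" by simp
    then have "s {\<zero>} = \<zero>\<^bsub>?L {\<zero>}\<^esub> \<or> t {\<zero>} = \<zero>\<^bsub>?L {\<zero>}\<^esub>"
      using gen inL[OF st(2) gen] inL[OF st(3) gen] G.integral by (simp add: ops)
    then show "s = \<zero>\<^bsub>?F\<^esub> \<or> t = \<zero>\<^bsub>?F\<^esub>" using determined st by blast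
  qed
qed

lemma integral_scheme_Spec: "integral_scheme (Spec R)"
  unfolding integral_scheme_def Spec_def fst_conv snd_conv by (intro ballI impI structure_sheaf_domain)

end

text \<open>For an improper ideal the quotient is the zero ring, which has no prime ideals; the only
  open set is then empty and there is nothing to show.\<close>

lemma integral_scheme_Spec_Quot:
  assumes R: "cring R" and I: "ideal I R"
    and prime: "\<And>a b. a \<in> carrier R \<Longrightarrow> b \<in> carrier R \<Longrightarrow> a \<otimes>\<^bsub>R\<^esub> b \<in> I \<Longrightarrow> I \<noteq> carrier R \<Longrightarrow> a \<in> I \<or> b \<in> I"
  shows "integral_scheme (Spec (R Quot I))"
proof (cases "I = carrier R")
  case False
  have "primeideal I R" by (rule primeidealI[OF I R]) (use False prime in simp_all)
  then show ?thesis by (rule domain.integral_scheme_Spec[OF primeideal.quotient_is_domain])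
next
  case True
  interpret R: cring R by (rule R)
  interpret I: ideal I R by (rule I)
  have "I +>\<^bsub>R\<^esub> x = I" if "x \<in> carrier R" for x using that True I.a_rcos_const[of x] by simp
  then have c: "carrier (R Quot I) \<subseteq> {I}"
    unfolding FactRing_def A_RCOSETS_def' by simp
  have "\<not> primeideal p (R Quot I)" for p
  proof
    assume p: "primeideal p (R Quot I)"
    interpret p: primeideal p "R Quot I" by (rule p)
    have "\<zero>\<^bsub>R Quot I\<^esub> = I" unfolding FactRing_def by simp
    then have I: "I \<in> p" using additive_subgroup.zero_closed[OF p.additive_subgroup_axioms] by simp
    have "carrier (R Quot I) \<subseteq> p"
    proof
      fix x assume "x \<in> carrier (R Quot I)"
      then have "x = I" using c by (auto dest: subsetD)
      then show "x \<in> p" using I by simp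
    qed
    then have "carrier (R Quot I) = p" using p.a_subset by (rule subset_antisym)
    then show False using p.I_notcarr by simp
  qed
  then have "zariski_opens (R Quot I) \<subseteq> {{}}" unfolding zariski_opens_def by auto
  then show ?thesis unfolding integral_scheme_def Spec_def by auto
qed

section \<open>Reduction modulo the maximal ideal\<close>

lemma lookup_single_times:
  fixes f :: "'e::ab_group_add \<Rightarrow>\<^sub>0 'a::comm_ring_1"
  shows "lookup (single \<alpha> c * f) \<beta> = c * lookup f (\<beta> - \<alpha>)"
proof (induction f rule: poly_mapping_add_induct)
  case (single \<gamma> d)
  have "\<alpha> + \<gamma> = \<beta> \<longleftrightarrow> \<gamma> = \<beta> - \<alpha>" by (auto simp: algebra_simps)
  then show ?case by (simp add: mult_single lookup_single when_def)
qed (simp_all add: distrib_left lookup_add)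

locale torus_reduction =
  fixes v :: "'l::field \<Rightarrow> real" and res :: "'l \<Rightarrow> 'r::field" and \<tau> :: "'x \<Rightarrow> 'l"
  assumes val: "valuation v" and res: "residue_map v res" and \<tau>: "\<And>d. \<tau> d \<noteq> 0"
begin

lemmas O_closed = valuation_ring_closed[OF val]

lemma res_add: "a \<in> valuation_ring v \<Longrightarrow> b \<in> valuation_ring v \<Longrightarrow> res (a + b) = res a + res b"
  and res_mult: "a \<in> valuation_ring v \<Longrightarrow> b \<in> valuation_ring v \<Longrightarrow> res (a * b) = res a * res b"
  and res_one: "res 1 = 1"
  and res_eq_0: "a \<in> valuation_ring v \<Longrightarrow> res a = 0 \<longleftrightarrow> a = 0 \<or> v a > 0"
  using res unfolding residue_map_def by auto

lemma res_0: "res 0 = 0"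
  using res_eq_0[OF O_closed(1)] by simp

lemma res_uminus: "a \<in> valuation_ring v \<Longrightarrow> res (- a) = - res a"
  using res_add[of "- a" a] O_closed(5)[of a] res_0 by (simp add: eq_neg_iff_add_eq_0)

lemma res_sum: "(\<And>x. x \<in> A \<Longrightarrow> g x \<in> valuation_ring v) \<Longrightarrow> res (sum g A) = (\<Sum>x\<in>A. res (g x))"
proof (induction A rule: infinite_finite_induct)
  case (insert x A)
  then show ?case using res_add[of "g x" "sum g A"] valuation_ring_sum[OF val, of A g] by simp
qed (simp_all add: res_0)

lemma res_lift: "\<exists>l. (\<forall>r. l r \<in> valuation_ring v) \<and> (\<forall>r. res (l r) = r)"
proof -
  have "\<exists>a. a \<in> valuation_ring v \<and> res a = r" for r
    using res unfolding residue_map_def by (metis UNIV_I imageE)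
  then show ?thesis by metis
qed

lemma exp_eval_\<tau>: "exp_eval \<tau> \<alpha> \<noteq> 0"
  by (rule exp_eval_nonzero) (rule \<tau>)

lemma unitI: "a \<in> valuation_ring v \<Longrightarrow> res a \<noteq> 0 \<Longrightarrow> a \<noteq> 0 \<and> v a = 0"
  using res_eq_0[of a] res_0 by (auto simp: valuation_ring_def)

lemma unit_in_O: "v a = 0 \<Longrightarrow> a \<in> valuation_ring v"
  by (simp add: valuation_ring_def)

lemma res_unit: "a \<noteq> 0 \<Longrightarrow> v a = 0 \<Longrightarrow> res a \<noteq> 0"
  using res_eq_0[of a] unit_in_O by auto

lemma res_inverse:
  assumes "a \<noteq> 0" "v a = 0"
  shows "res (inverse a) = inverse (res a)"
proof -
  have "v (inverse a) = 0" using val_inverse[OF val] assms by simp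
  then have "res a * res (inverse a) = 1"
    using res_mult[of a "inverse a"] unit_in_O assms res_one by simp
  then show ?thesis by (metis inverse_unique)
qed

lemma res_exp_eval:
  assumes "\<And>d. P d \<noteq> 0" "\<And>d. v (P d) = 0"
  shows "v (exp_eval P \<alpha>) = 0" "res (exp_eval P \<alpha>) = exp_eval (\<lambda>d. res (P d)) \<alpha>"
proof -
  show "v (exp_eval P \<alpha>) = 0" using val_exp_eval[OF val, of P] assms by simp
  have pow: "res (a ^ n) = res a ^ n \<and> a ^ n \<in> valuation_ring v" if "a \<in> valuation_ring v" for a and n :: nat
    using that by (induction n) (simp_all add: res_one res_mult O_closed)
  have powi: "res (a powi k) = res a powi k" "a powi k \<noteq> 0" "v (a powi k) = 0" if "a \<noteq> 0" "v a = 0" for a k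
    using that pow[of a "nat k"] pow[of "inverse a" "nat (- k)"] val_inverse[OF val, of a] res_inverse[of a] unit_in_O
      val_powi[OF val, of a k]
    by (auto simp: power_int_def)
  have "res (\<Prod>d\<in>A. P d powi lookup \<alpha> d) = (\<Prod>d\<in>A. res (P d) powi lookup \<alpha> d)" for A
  proof (induction A rule: infinite_finite_induct)
    case (insert d A)
    have "(\<Prod>d\<in>A. P d powi lookup \<alpha> d) \<in> valuation_ring v"
      using powi assms unit_in_O by (intro valuation_ring_prod[OF val]) auto
    then show ?case using insert powi assms unit_in_O by (simp add: res_mult)
  qed (simp_all add: res_one)
  then show "res (exp_eval P \<alpha>) = exp_eval (\<lambda>d. res (P d)) \<alpha>"
    unfolding exp_eval_def .
qed

definition integral_form :: "(('x \<Rightarrow>\<^sub>0 int) \<Rightarrow>\<^sub>0 'l) \<Rightarrow> bool" where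
  "integral_form f \<longleftrightarrow> (\<forall>\<alpha>. lookup f \<alpha> * exp_eval \<tau> \<alpha> \<in> valuation_ring v)"

text \<open>With the scalar fixed to 1 this is the coefficientwise residue of
  \<open>f(\<tau> u)\<close>. Unlike an initial form it may be zero, but on integral forms it is
  additive.\<close>

abbreviation red :: "(('x \<Rightarrow>\<^sub>0 int) \<Rightarrow>\<^sub>0 'l) \<Rightarrow> (('x \<Rightarrow>\<^sub>0 int) \<Rightarrow>\<^sub>0 'r)" where
  "red \<equiv> initial_form res \<tau> 1"

lemma lookup_red: "lookup (red f) \<alpha> = res (lookup f \<alpha> * exp_eval \<tau> \<alpha>)"
  unfolding initial_form_def by (cases "\<alpha> \<in> keys f") (simp_all add: lookup_mapp in_keys_iff res_0)

lemma keys_red: "keys (red f) \<subseteq> keys f"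
  unfolding initial_form_def by (rule keys_mapp_subset)

lemma red_carrier: "f \<in> carrier (laurent_ring E) \<Longrightarrow> red f \<in> carrier (laurent_ring E)"
  unfolding mem_monoid_ring using keys_red[of f] by auto

lemma integral_0: "integral_form 0"
  and integral_add: "integral_form f \<Longrightarrow> integral_form g \<Longrightarrow> integral_form (f + g)"
  and integral_single: "c * exp_eval \<tau> \<alpha> \<in> valuation_ring v \<Longrightarrow> integral_form (single \<alpha> c)"
  and integral_const_mult: "c \<in> valuation_ring v \<Longrightarrow> integral_form f \<Longrightarrow> integral_form (const c * f)"
  and integral_uminus: "integral_form f \<Longrightarrow> integral_form (- f)"
  unfolding integral_form_def const_def
  by (auto simp: O_closed lookup_add lookup_single when_def distrib_right lookup_single_times mult.assoc)

lemma integral_diff: "integral_form f \<Longrightarrow> integral_form g \<Longrightarrow> integral_form (f - g)"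
  using integral_add[of f "- g"] integral_uminus[of g] by simp

lemma integral_sum: "(\<And>x. x \<in> A \<Longrightarrow> integral_form (g x)) \<Longrightarrow> integral_form (sum g A)"
  by (induction A rule: infinite_finite_induct) (simp_all add: integral_0 integral_add)

lemma red_0: "red 0 = 0"
  and red_add: "integral_form f \<Longrightarrow> integral_form g \<Longrightarrow> red (f + g) = red f + red g"
  and red_uminus: "integral_form f \<Longrightarrow> red (- f) = - red f"
  and red_const_mult: "c \<in> valuation_ring v \<Longrightarrow> integral_form f \<Longrightarrow> red (const c * f) = const (res c) * red f"
  unfolding const_def
  by (rule poly_mapping_eqI;
      simp add: integral_form_def lookup_red lookup_add distrib_right res_0 res_add res_mult res_uminus
        lookup_single_times mult.assoc O_closed)+

lemma red_single: "red (single \<alpha> c) = single \<alpha> (res (c * exp_eval \<tau> \<alpha>))"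
  by (rule poly_mapping_eqI) (simp add: lookup_red lookup_single when_def res_0)

lemma red_diff: "integral_form f \<Longrightarrow> integral_form g \<Longrightarrow> red (f - g) = red f - red g"
  using red_add[of f "- g"] integral_uminus[of g] red_uminus[of g] by simp

lemma red_sum: "(\<And>x. x \<in> A \<Longrightarrow> integral_form (g x)) \<Longrightarrow> red (sum g A) = (\<Sum>x\<in>A. red (g x))"
  by (induction A rule: infinite_finite_induct) (simp_all add: red_0 red_add integral_sum)

text \<open>Multiplication by a monomial shifts exponents, and \<open>exp_eval \<tau>\<close> turns
  the shift into a factor. Monomials suffice for closure under multiples, as any multiplier is a sum
  of them.\<close>

lemma monomial_mult:
  assumes c: "c * exp_eval \<tau> \<alpha> \<in> valuation_ring v" and f: "integral_form f"
  shows "integral_form (single \<alpha> c * f)" "red (single \<alpha> c * f) = single \<alpha> (res (c * exp_eval \<tau> \<alpha>)) * red f"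
proof -
  have eq: "lookup (single \<alpha> c * f) \<beta> * exp_eval \<tau> \<beta> =
    (c * exp_eval \<tau> \<alpha>) * (lookup f (\<beta> - \<alpha>) * exp_eval \<tau> (\<beta> - \<alpha>))" for \<beta>
    using exp_eval_add[of \<tau> \<alpha> "\<beta> - \<alpha>", OF \<tau>] by (simp add: lookup_single_times)
  show "integral_form (single \<alpha> c * f)"
    using c f unfolding integral_form_def eq by (simp add: O_closed)
  show "red (single \<alpha> c * f) = single \<alpha> (res (c * exp_eval \<tau> \<alpha>)) * red f"
    using c f unfolding integral_form_def
    by (intro poly_mapping_eqI) (simp add: lookup_red[of "single \<alpha> c * f"] eq res_mult, simp add: lookup_single_times lookup_red)
qed

text \<open>The powers of \<tau> built into \<open>red\<close> belong to the point
  \<open>\<tau> P\<close>, and the remaining coordinates \<open>P\<close> are units, so every term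
  is integral and residues can be taken termwise.\<close>

lemma red_eval:
  assumes f: "integral_form f" and P: "\<And>d. P d \<noteq> 0" "\<And>d. v (P d) = 0"
  shows "monoid_eval id (exp_eval (\<lambda>d. res (P d))) (red f) = res (monoid_eval id (exp_eval (\<lambda>d. \<tau> d * P d)) f)"
proof -
  have unit: "exp_eval P \<alpha> \<in> valuation_ring v" for \<alpha> by (rule unit_in_O[OF res_exp_eval(1)]) (rule P)+
  have "monoid_eval id (exp_eval (\<lambda>d. res (P d))) (red f) =
    (\<Sum>\<alpha>\<in>keys f. res (lookup f \<alpha> * exp_eval \<tau> \<alpha>) * res (exp_eval P \<alpha>))"
    by (subst monoid_eval_superset[of "keys f"]) (simp_all add: keys_red lookup_red res_exp_eval(2)[of P, OF P])
  also have "\<dots> = (\<Sum>\<alpha>\<in>keys f. res (lookup f \<alpha> * exp_eval \<tau> \<alpha> * exp_eval P \<alpha>))"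
    using f unit unfolding integral_form_def
    by (intro sum.cong refl) (simp add: res_mult)
  also have "\<dots> = res (\<Sum>\<alpha>\<in>keys f. lookup f \<alpha> * exp_eval \<tau> \<alpha> * exp_eval P \<alpha>)"
    using f unit unfolding integral_form_def
    by (intro res_sum[symmetric]) (simp add: O_closed(4))
  also have "(\<Sum>\<alpha>\<in>keys f. lookup f \<alpha> * exp_eval \<tau> \<alpha> * exp_eval P \<alpha>) = monoid_eval id (exp_eval (\<lambda>d. \<tau> d * P d)) f"
    unfolding monoid_eval_def by (intro sum.cong refl) (simp add: exp_eval_mult mult.assoc)
  finally show ?thesis .
qed

text \<open>No further generation is needed: sums lift because \<open>red\<close> is additive on
  integral forms, and multiples by monomials lift because the residue map is onto.\<close>

lemma red_ideal:
  assumes I: "ideal I (laurent_ring E)"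
  shows "ideal {red f | f. f \<in> I \<and> integral_form f} (laurent_ring E)" (is "ideal ?J _")
proof -
  note I = I[unfolded ideal_monoid_ring_iff]
  obtain l where l: "\<And>r. l r \<in> valuation_ring v" "\<And>r. res (l r) = r" using res_lift by (elim exE conjE) blast
  have add: "a + b \<in> ?J" if ab: "a \<in> ?J" "b \<in> ?J" for a b
  proof -
    obtain f g where "a = red f" "f \<in> I" "integral_form f" "b = red g" "g \<in> I" "integral_form g"
      using ab by blast
    then have "a + b = red (f + g)" "f + g \<in> I" "integral_form (f + g)" using I by (auto simp: red_add integral_add)
    then show ?thesis by blast
  qed
  have zero: "0 \<in> ?J" using I red_0 integral_0 by (intro CollectI exI[of _ 0]) auto
  have mult: "r * a \<in> ?J" if a: "a \<in> ?J" and r: "\<forall>\<alpha>\<in>keys r. keys \<alpha> \<subseteq> E" for a r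
  proof (rule poly_mapping_add_induct[of "\<lambda>r. r * a \<in> ?J" r])
    show "0 * a \<in> ?J" using zero by simp
    show "(g + h) * a \<in> ?J" if "g * a \<in> ?J" "h * a \<in> ?J" for g h
      using add[OF that] by (simp add: distrib_right)
    fix \<alpha> c assume \<alpha>: "\<alpha> \<in> keys r"
    obtain f where f: "a = red f" "f \<in> I" "integral_form f" using a by blast
    \<comment> \<open>A lift of the coefficient, corrected so that rescaling by \<tau> gives exactly
      \<open>l c\<close>.\<close>
    let ?c = "l c * inverse (exp_eval \<tau> \<alpha>)"
    have c: "?c * exp_eval \<tau> \<alpha> = l c" using exp_eval_\<tau> by (simp add: mult.assoc)
    have "single \<alpha> c * a = red (single \<alpha> ?c * f)" "integral_form (single \<alpha> ?c * f)"
      using monomial_mult[of ?c \<alpha> f] f c l by simp_all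
    moreover have "single \<alpha> ?c \<in> carrier (laurent_ring E)" using \<alpha> r by (simp add: mring_intros)
    then have "single \<alpha> ?c * f \<in> I" using I f by blast
    ultimately show "single \<alpha> c * a \<in> ?J" by blast
  qed
  show ?thesis unfolding ideal_monoid_ring_iff
  proof (intro conjI ballI)
    show "?J \<subseteq> carrier (laurent_ring E)" using I red_carrier by blast
  qed (use zero add mult in \<open>simp_all only: mem_monoid_ring\<close>)
qed

text \<open>An admissible scalar makes \<open>f\<close> integral, so every generator is a reduction.
  Conversely a nonzero reduction of an integral \<open>f\<close> has a coefficient of valuation 0,
  which makes 1 an admissible scalar, and a zero reduction lies in every ideal. This replaces the
  generated ideal by the explicit set of all reductions.\<close>

lemma initial_ideal_eq:
  assumes I: "ideal I (laurent_ring E)" and E: "torus_point v E \<tau>0 y" and agree: "\<And>d. d \<in> E \<Longrightarrow> \<tau> d = \<tau>0 d"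
  shows "initial_ideal v res E \<tau>0 y I = {red f | f. f \<in> I \<and> integral_form f}"
proof
  note I' = I[unfolded ideal_monoid_ring_iff]
  let ?J = "{red f | f. f \<in> I \<and> integral_form f}"
  let ?S = "{initial_form res \<tau>0 \<mu> f | \<mu> f. f \<in> I \<and> f \<noteq> 0 \<and> initial_scalar v y f \<mu>}"
  have form: "initial_form res \<tau>0 \<mu> f = red (const \<mu> * f)" if "f \<in> I" for \<mu> f
  proof (rule poly_mapping_eqI)
    fix \<alpha>
    show "lookup (initial_form res \<tau>0 \<mu> f) \<alpha> = lookup (red (const \<mu> * f)) \<alpha>"
    proof (cases "\<alpha> \<in> keys f")
      case True
      then have "keys \<alpha> \<subseteq> E" using that I' by (auto simp: mem_monoid_ring subset_iff)
      then have "exp_eval \<tau>0 \<alpha> = exp_eval \<tau> \<alpha>" using agree by (intro exp_eval_cong) auto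
      then show ?thesis using True unfolding lookup_red
        by (simp add: initial_form_def lookup_mapp const_def lookup_single_times)
    next
      case False
      then show ?thesis unfolding lookup_red
        by (simp add: initial_form_def lookup_mapp const_def lookup_single_times in_keys_iff res_0)
    qed
  qed
  \<comment> \<open>Here \<open>y d = - v (\<tau> d)\<close>, so the pairing is minus the valuation
    of the monomial at \<tau>.\<close>
  have pairing: "exp_pairing \<alpha> y = - v (exp_eval \<tau> \<alpha>)" if "keys \<alpha> \<subseteq> E" for \<alpha>
  proof -
    have "y d = - v (\<tau> d)" if "d \<in> E" for d
      using E that agree \<tau> unfolding torus_point_def absval_def by auto
    then have "exp_pairing \<alpha> y = (\<Sum>d\<in>keys \<alpha>. - (of_int (lookup \<alpha> d) * v (\<tau> d)))"
      unfolding exp_pairing_def using that by (intro sum.cong) auto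
    then show ?thesis using val_exp_eval[OF val, of \<tau>] \<tau> by (simp add: sum_negf)
  qed
  have scalar: "initial_scalar v y f \<mu> \<longleftrightarrow> \<mu> \<noteq> 0 \<and>
    v \<mu> = Max ((\<lambda>\<alpha>. - v (lookup f \<alpha> * exp_eval \<tau> \<alpha>)) ` keys f)" if "f \<in> I" for f \<mu>
  proof -
    have "- v (lookup f \<alpha>) + exp_pairing \<alpha> y = - v (lookup f \<alpha> * exp_eval \<tau> \<alpha>)" if "\<alpha> \<in> keys f" for \<alpha>
    proof -
      have "keys \<alpha> \<subseteq> E" using that \<open>f \<in> I\<close> I' by (auto simp: mem_monoid_ring subset_iff)
      then show ?thesis using that pairing val_mult[OF val, of "lookup f \<alpha>"] exp_eval_\<tau>
        by (simp add: in_keys_iff)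
    qed
    then show ?thesis unfolding initial_scalar_def by simp
  qed
  have S: "?S \<subseteq> ?J"
  proof
    fix g assume "g \<in> ?S"
    then obtain \<mu> f where f: "g = initial_form res \<tau>0 \<mu> f" "f \<in> I" "f \<noteq> 0" "initial_scalar v y f \<mu>" by blast
    have "integral_form (const \<mu> * f)" unfolding integral_form_def
    proof
      fix \<alpha>
      show "lookup (const \<mu> * f) \<alpha> * exp_eval \<tau> \<alpha> \<in> valuation_ring v"
      proof (cases "\<alpha> \<in> keys f")
        case True
        then have nz: "lookup f \<alpha> * exp_eval \<tau> \<alpha> \<noteq> 0" using exp_eval_\<tau> by (simp add: in_keys_iff)
        have "- v (lookup f \<alpha> * exp_eval \<tau> \<alpha>) \<le> v \<mu>" "\<mu> \<noteq> 0" using f scalar[of f \<mu>] True by auto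
        then have "v (\<mu> * (lookup f \<alpha> * exp_eval \<tau> \<alpha>)) \<ge> 0" using val_mult[OF val _ nz] by simp
        then show ?thesis by (simp add: const_def lookup_single_times valuation_ring_def mult.assoc)
      qed (simp add: const_def lookup_single_times in_keys_iff O_closed)
    qed
    moreover have "const \<mu> * f \<in> I" using I' f mring_intros by blast
    ultimately show "g \<in> ?J" using form f by blast
  qed
  have J: "ideal ?J (laurent_ring E)" by (rule red_ideal[OF I])
  have car: "?S \<subseteq> carrier (laurent_ring E)" using S J unfolding ideal_monoid_ring_iff by blast
  show "initial_ideal v res E \<tau>0 y I \<subseteq> ?J"
    unfolding initial_ideal_def by (rule monoid_ring_genideal(3)[OF car J S])
  show "?J \<subseteq> initial_ideal v res E \<tau>0 y I"
  proof
    fix g assume "g \<in> ?J"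
    then obtain f where f: "g = red f" "f \<in> I" "integral_form f" by blast
    note gen = monoid_ring_genideal(1,2)[OF car]
    show "g \<in> initial_ideal v res E \<tau>0 y I"
    proof (cases "red f = 0")
      case True
      then show ?thesis using gen(1) f unfolding initial_ideal_def ideal_monoid_ring_iff by simp
    next
      case False
      then obtain \<alpha> where "res (lookup f \<alpha> * exp_eval \<tau> \<alpha>) \<noteq> 0"
        using lookup_red[of f] poly_mapping_eqI[of "red f" 0] by auto
      then have a: "lookup f \<alpha> \<noteq> 0" "v (lookup f \<alpha> * exp_eval \<tau> \<alpha>) = 0"
        using unitI[of "lookup f \<alpha> * exp_eval \<tau> \<alpha>"] f unfolding integral_form_def by auto
      \<comment> \<open>All rescaled coefficients are integral and the one at \<alpha> is a unit, so
        the maximum is the valuation of 1.\<close>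
      have "Max ((\<lambda>\<alpha>. - v (lookup f \<alpha> * exp_eval \<tau> \<alpha>)) ` keys f) = 0"
      proof (rule Max_eqI)
        show "0 \<in> (\<lambda>\<alpha>. - v (lookup f \<alpha> * exp_eval \<tau> \<alpha>)) ` keys f"
          using a by (intro image_eqI[of _ _ \<alpha>]) (auto simp: in_keys_iff)
        fix x assume "x \<in> (\<lambda>\<alpha>. - v (lookup f \<alpha> * exp_eval \<tau> \<alpha>)) ` keys f"
        then obtain \<beta> where b: "\<beta> \<in> keys f" "x = - v (lookup f \<beta> * exp_eval \<tau> \<beta>)" by blast
        have "lookup f \<beta> * exp_eval \<tau> \<beta> \<in> valuation_ring v" using f unfolding integral_form_def by blast
        moreover have "lookup f \<beta> * exp_eval \<tau> \<beta> \<noteq> 0" using b exp_eval_\<tau> by (simp add: in_keys_iff)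
        ultimately show "x \<le> 0" using b by (simp add: valuation_ring_def)
      qed simp
      then have "initial_scalar v y f 1" using scalar[OF f(2)] val_one[OF val] by simp
      moreover have "f \<noteq> 0" using a by auto
      moreover have "g = initial_form res \<tau>0 1 f" using form[OF f(2), of 1] f(1) by (simp add: const_def)
      ultimately have "g \<in> ?S" using f(2) by blast
      then show ?thesis using gen(2) unfolding initial_ideal_def by blast
    qed
  qed
qed

end

section \<open>The Plucker relations and the points of a stratum\<close>

definition signed :: "(nat set \<Rightarrow> 'b::comm_ring_1) \<Rightarrow> nat \<Rightarrow> nat \<Rightarrow> 'b" where
  "signed s k l = (if k < l then s {k, l} else if l < k then - s {k, l} else 0)"

lemma signed_swap: "signed s k l = - signed s l k"
  unfolding signed_def by (auto simp: insert_commute)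

lemma signed_refl: "signed s k k = 0"
  unfolding signed_def by simp

lemma signed_hom:
  assumes "unital_hom \<phi>"
  shows "\<phi> (signed s k l) = signed (\<phi> \<circ> s) k l"
  unfolding signed_def by (simp add: unital_homD[OF assms])

lemma pair_mem: "k \<noteq> l \<Longrightarrow> {k, l} \<in> pairs n \<longleftrightarrow> k \<in> {1..n} \<and> l \<in> {1..n}"
  unfolding nsets_def by auto

lemma pairsE:
  assumes "d \<in> pairs n"
  obtains k l where "k < l" "k \<in> {1..n}" "l \<in> {1..n}" "d = {k, l}"
proof -
  have "card d = 2" "d \<subseteq> {1..n}" using assms unfolding nsets_def by auto
  then obtain k l where "d = {k, l}" "k \<noteq> l" by (auto simp: card_2_iff)
  then show thesis using that[of k l] that[of l k] \<open>d \<subseteq> {1..n}\<close> by (cases "k < l") (auto simp: insert_commute)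
qed

definition matrix_minor :: "(nat \<times> nat \<Rightarrow> 'b::comm_ring_1) \<Rightarrow> nat set \<Rightarrow> 'b" where
  "matrix_minor M d = M (1, Min d) * M (2, Max d) - M (1, Max d) * M (2, Min d)"

lemma signed_matrix_minor: "signed (matrix_minor M) k l = M (1, k) * M (2, l) - M (1, l) * M (2, k)"
  unfolding signed_def matrix_minor_def by (cases k l rule: linorder_cases) (auto simp: algebra_simps)

lemma minor_eq: "minor = matrix_minor var"
  unfolding minor_def[abs_def] matrix_minor_def[abs_def] ..

lemma signed_var_closed:
  assumes "a \<in> {1..n}" "b \<in> {1..n}"
  shows "signed var a b \<in> carrier (poly_ring (pairs n))"
proof -
  have "var {a, b} \<in> carrier (poly_ring (pairs n))" if "a \<noteq> b"
    using assms that pair_mem[OF that] unfolding var_def by (intro mring_intros) simp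
  then show ?thesis unfolding signed_def by (auto intro: mring_intros)
qed

text \<open>An identity between minors of the generic matrix; the antisymmetric coordinates
  \<open>signed\<close> make it valid for indices in any order, including coincident ones.\<close>

lemma plucker_relation:
  assumes "a \<in> {1..n}" "b \<in> {1..n}" "c \<in> {1..n}" "d \<in> {1..n}"
  shows "signed var a b * signed var c d - signed var a c * signed var b d + signed var a d * signed var b c
    \<in> (plucker_ideal n :: ((nat set \<Rightarrow>\<^sub>0 nat) \<Rightarrow>\<^sub>0 'k::field) set)"
proof -
  let ?\<phi> = "subst const (minor :: _ \<Rightarrow> (nat \<times> nat \<Rightarrow>\<^sub>0 nat) \<Rightarrow>\<^sub>0 'k)"
  have h: "unital_hom ?\<phi>" by (rule subst_hom[OF const_hom])
  have sv: "?\<phi> (signed var k l) = var (1, k) * var (2, l) - var (1, l) * var (2, k)" for k l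
  proof -
    have "?\<phi> \<circ> var = minor" by (simp add: fun_eq_iff subst_var[OF const_hom])
    then show ?thesis unfolding signed_hom[OF h] by (simp only: minor_eq signed_matrix_minor)
  qed
  let ?f = "signed var a b * signed var c d - signed var a c * signed var b d + signed var a d * signed var b c"
  have "?\<phi> ?f = 0"
    by (simp only: unital_homD[OF h] sv) (simp add: algebra_simps)
  moreover have "?f \<in> carrier (poly_ring (pairs n))"
    by (intro mring_intros signed_var_closed assms)
  ultimately show ?thesis unfolding plucker_ideal_def by blast
qed

lemma subst_cong:
  assumes "f \<in> carrier (poly_ring A)" "\<And>d. d \<in> A \<Longrightarrow> \<sigma> d = \<rho> d"
  shows "subst h \<sigma> f = subst h \<rho> f"
  unfolding subst_def
proof (intro sum.cong refl arg_cong2[where f = "(*)"] prod.cong)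
  fix \<alpha> d assume "\<alpha> \<in> keys f" "d \<in> keys \<alpha>"
  then have "d \<in> A" using assms(1) unfolding mem_monoid_ring by auto
  then show "\<sigma> d ^ lookup \<alpha> d = \<rho> d ^ lookup \<alpha> d" using assms(2) by simp
qed

lemma subst_closed:
  assumes f: "f \<in> carrier (poly_ring A)" and \<sigma>: "\<And>d. d \<in> A \<Longrightarrow> \<sigma> d \<in> carrier (laurent_ring E)"
  shows "subst const \<sigma> f \<in> carrier (laurent_ring E)"
  unfolding subst_def
proof (intro mring_intros)
  fix \<alpha> d assume "\<alpha> \<in> keys f" "d \<in> keys \<alpha>"
  then have "d \<in> A" using f unfolding mem_monoid_ring by auto
  then show "\<sigma> d \<in> carrier (laurent_ring E)" by (rule \<sigma>)
qed

lemma stratum_coord_closed: "d \<in> pairs n \<Longrightarrow> stratum_coord J e d \<in> carrier (laurent_ring (torus_coords n J e))"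
  unfolding stratum_coord_def torus_coords_def var_def by (auto intro!: mring_intros)

lemma stratum_generators_closed:
  "subst const (stratum_coord J e) ` plucker_ideal n \<subseteq> carrier (laurent_ring (torus_coords n J e))"
  using subst_closed[OF _ stratum_coord_closed] unfolding plucker_ideal_def by auto

lemma kernel_ideal:
  fixes \<phi> :: "(('x \<Rightarrow>\<^sub>0 int) \<Rightarrow>\<^sub>0 'a::comm_ring_1) \<Rightarrow> 'b::comm_ring_1"
  assumes "unital_hom \<phi>"
  shows "ideal {f \<in> carrier (laurent_ring E). \<phi> f = 0} (laurent_ring E)"
  unfolding ideal_monoid_ring_iff by (auto simp: unital_homD[OF assms] mring_intros)

lemma stratum_ideal_eq:
  fixes n J e
  defines "G \<equiv> genideal (laurent_ring (torus_coords n J e)) (subst const (stratum_coord J e) ` plucker_ideal n)"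
  shows "stratum_ideal n J e = {f \<in> carrier (laurent_ring (torus_coords n J e)). \<exists>m::nat. f ^ m \<in> G}"
  unfolding stratum_ideal_def Let_def radical_def G_def by (simp add: monoid_ring_pow)

locale stratum =
  fixes \<iota> :: "'k::field \<Rightarrow> 'l::field" and n :: nat and J :: "nat set set" and e :: "nat set"
  assumes \<iota>: "unital_hom \<iota>"
begin

abbreviation "E \<equiv> torus_coords n J e"
abbreviation "I \<equiv> extended_ideal \<iota> E (stratum_ideal n J e)"

lemma stratum_ideal_closed: "Poly_Mapping.map \<iota> ` stratum_ideal n J e \<subseteq> carrier (laurent_ring E)"
proof (rule image_subsetI)
  fix f :: "(nat set \<Rightarrow>\<^sub>0 int) \<Rightarrow>\<^sub>0 'k" assume "f \<in> stratum_ideal n J e"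
  then have "f \<in> carrier (laurent_ring E)" unfolding stratum_ideal_eq by blast
  then show "Poly_Mapping.map \<iota> f \<in> carrier (laurent_ring E)"
    unfolding mem_monoid_ring using keys_map[of \<iota> f] by blast
qed

lemma ideal_I: "ideal I (laurent_ring E)"
  unfolding extended_ideal_def by (rule monoid_ring_genideal(1)[OF stratum_ideal_closed])

lemma generator_in_I:
  assumes "f \<in> plucker_ideal n"
  shows "subst (const \<circ> \<iota>) (stratum_coord J e) f \<in> I"
proof -
  let ?g = "subst const (stratum_coord J e) f"
  have "?g ^ 1 \<in> genideal (laurent_ring E) (subst const (stratum_coord J e) ` plucker_ideal n)"
    using monoid_ring_genideal(2)[OF stratum_generators_closed, of J e n] assms by auto
  then have "?g \<in> stratum_ideal n J e"
    using stratum_generators_closed assms unfolding stratum_ideal_eq by blast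
  then have "Poly_Mapping.map \<iota> ?g \<in> I"
    using monoid_ring_genideal(2)[OF stratum_ideal_closed] unfolding extended_ideal_def by blast
  moreover have "Poly_Mapping.map \<iota> \<circ> const = (const \<circ> \<iota> :: _ \<Rightarrow> (nat set \<Rightarrow>\<^sub>0 int) \<Rightarrow>\<^sub>0 'l)" "Poly_Mapping.map \<iota> \<circ> stratum_coord J e = stratum_coord J e"
    by (simp_all add: fun_eq_iff const_def stratum_coord_def var_def unital_homD[OF \<iota>] unital_homD[OF map_hom[OF \<iota>]])
  ultimately show ?thesis unfolding hom_subst[OF map_hom[OF \<iota>]] by simp
qed

abbreviation q :: "nat \<Rightarrow> nat \<Rightarrow> (nat set \<Rightarrow>\<^sub>0 int) \<Rightarrow>\<^sub>0 'l" where
  "q \<equiv> signed (stratum_coord J e)"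

lemma relation_in_I:
  assumes "a \<in> {1..n}" "b \<in> {1..n}" "c \<in> {1..n}" "d \<in> {1..n}"
  shows "q a b * q c d - q a c * q b d + q a d * q b c \<in> I"
proof -
  let ?\<phi> = "subst (const \<circ> \<iota>) (stratum_coord J e :: _ \<Rightarrow> (nat set \<Rightarrow>\<^sub>0 int) \<Rightarrow>\<^sub>0 'l)"
  have ci: "unital_hom (const \<circ> \<iota> :: _ \<Rightarrow> (nat set \<Rightarrow>\<^sub>0 int) \<Rightarrow>\<^sub>0 'l)"
    using \<iota> const_hom unfolding unital_hom_def by auto
  have h: "unital_hom ?\<phi>" by (rule subst_hom[OF ci])
  have "?\<phi> (signed var k l) = q k l" for k l
  proof -
    have "?\<phi> \<circ> var = stratum_coord J e" by (simp only: fun_eq_iff comp_apply subst_var[OF ci] simp_thms)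
    then show ?thesis unfolding signed_hom[OF h] by simp
  qed
  then show ?thesis using generator_in_I[OF plucker_relation[OF assms]] by (simp add: unital_homD[OF h])
qed

text \<open>Elements of the Plucker ideal are relations between minors, hence vanish at the minors
  of \<open>M\<close>. The radical adds nothing since the values lie in a field, and extension of
  scalars adds only combinations over \<open>'l\<close> of functions that already vanish.\<close>

lemma I_vanishes:
  assumes p: "\<And>d. p d \<noteq> 0"
    and M: "\<And>d. d \<in> J \<Longrightarrow> matrix_minor M d = 0" "matrix_minor M e = 1" "\<And>d. d \<in> E \<Longrightarrow> matrix_minor M d = p d"
    and f: "f \<in> I"
  shows "monoid_eval id (exp_eval p) f = 0"
proof -
  let ?\<phi> = "monoid_eval \<iota> (exp_eval p)" and ?\<psi> = "subst \<iota> M"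
  have h: "unital_hom ?\<phi>" by (rule laurent_eval_hom[OF \<iota> p])
  have h': "unital_hom ?\<psi>" by (rule subst_hom[OF \<iota>])
  have "?\<phi> (subst const (stratum_coord J e) f) = 0" if f: "f \<in> plucker_ideal n" for f
  proof -
    have car: "f \<in> carrier (poly_ring (pairs n))" and 0: "subst const minor f = 0"
      using f unfolding plucker_ideal_def by auto
    have 1: "?\<phi> \<circ> const = \<iota>" unfolding const_def
      by (simp add: fun_eq_iff monoid_eval_single unital_homD[OF \<iota>] exp_eval_zero)
    have 2: "?\<psi> \<circ> const = \<iota>" by (simp add: fun_eq_iff subst_const[OF \<iota>])
    have 3: "?\<psi> \<circ> minor = matrix_minor M"
      unfolding minor_def by (simp add: fun_eq_iff matrix_minor_def unital_homD[OF h'] subst_var[OF \<iota>])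
    have "?\<phi> (subst const (stratum_coord J e) f) = subst \<iota> (?\<phi> \<circ> stratum_coord J e) f"
      unfolding hom_subst[OF h] 1 ..
    also have "\<dots> = subst \<iota> (matrix_minor M) f"
    proof (rule subst_cong[OF car])
      fix d assume "d \<in> pairs n"
      have var: "?\<phi> (var d) = p d" unfolding var_def
        by (simp add: monoid_eval_single unital_homD[OF \<iota>] exp_eval_single)
      show "(?\<phi> \<circ> stratum_coord J e) d = matrix_minor M d"
        using M \<open>d \<in> pairs n\<close> var unfolding stratum_coord_def
        by (auto simp: unital_homD[OF h] torus_coords_def)
    qed
    also have "\<dots> = ?\<psi> (subst const minor f)" unfolding hom_subst[OF h'] 2 3 ..
    also have "\<dots> = 0" unfolding 0 by (rule unital_homD(4)[OF h'])
    finally show ?thesis .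
  qed
  then have "subst const (stratum_coord J e) ` plucker_ideal n \<subseteq> {f \<in> carrier (laurent_ring E). ?\<phi> f = 0}"
    using stratum_generators_closed[of J e n] by auto
  then have "genideal (laurent_ring E) (subst const (stratum_coord J e) ` plucker_ideal n)
    \<subseteq> {f \<in> carrier (laurent_ring E). ?\<phi> f = 0}"
    by (rule monoid_ring_genideal(3)[OF stratum_generators_closed kernel_ideal[OF h]])
  then have "?\<phi> (f ^ m) = 0 \<Longrightarrow> ?\<phi> f = 0" and
    "f \<in> stratum_ideal n J e \<Longrightarrow> \<exists>m. ?\<phi> (f ^ m) = 0" for f and m :: nat
    unfolding stratum_ideal_eq by (auto simp: unital_homD[OF h])
  then have 0: "?\<phi> f = 0" if "f \<in> stratum_ideal n J e" for f using that by blast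
  have id: "unital_hom (id :: 'l \<Rightarrow> 'l)" unfolding unital_hom_def by simp
  have "Poly_Mapping.map \<iota> ` stratum_ideal n J e \<subseteq> {f \<in> carrier (laurent_ring E). monoid_eval id (exp_eval p) f = 0}"
    using stratum_ideal_closed 0 by (auto simp: monoid_eval_map unital_homD[OF \<iota>] comp_def)
  then have "I \<subseteq> {f \<in> carrier (laurent_ring E). monoid_eval id (exp_eval p) f = 0}"
    unfolding extended_ideal_def
    by (rule monoid_ring_genideal(3)[OF stratum_ideal_closed kernel_ideal[OF laurent_eval_hom[OF id p]]])
  then show ?thesis using f by blast
qed

end

section \<open>The stratum as a monomial twist of a linear space\<close>

lemma id_hom: "unital_hom id"
  unfolding unital_hom_def by simp

lemma single_eq_0_iff: "single \<alpha> c = 0 \<longleftrightarrow> c = 0"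
  by (metis lookup_single_eq lookup_zero single_zero)

lemma lookup_sum_singles:
  "finite A \<Longrightarrow> lookup (\<Sum>d\<in>A. single d (k d)) x = (if x \<in> A then k x else (0::'b::comm_monoid_add))"
  by (simp add: lookup_sum lookup_single when_def)

lemma prod_var_power:
  "finite A \<Longrightarrow> (\<Prod>d\<in>A. var d ^ m d) = (single (\<Sum>d\<in>A. single d (int (m d))) 1 :: ('x \<Rightarrow>\<^sub>0 int) \<Rightarrow>\<^sub>0 'a::comm_ring_1)"
proof (induction A rule: finite_induct)
  case (insert a A)
  have "(var a ^ k :: ('x \<Rightarrow>\<^sub>0 int) \<Rightarrow>\<^sub>0 'a) = single (single a (int k)) 1" for k
    by (induction k) (simp_all add: var_def mult_single single_add[symmetric])
  then show ?case using insert by (simp add: mult_single)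
qed simp

locale initial_stratum = stratum \<iota> n J "{i, j}" + torus_reduction v res \<tau>
  for \<iota> :: "'k::field \<Rightarrow> 'l::field" and n :: nat and J and i j :: nat
    and v :: "'l \<Rightarrow> real" and res :: "'l \<Rightarrow> 'r::field" and \<tau> :: "nat set \<Rightarrow> 'l" +
  assumes less: "i < j" and ij: "{i, j} \<in> pairs n - J" and J: "J \<subseteq> pairs n"
begin

definition init_I :: "((nat set \<Rightarrow>\<^sub>0 int) \<Rightarrow>\<^sub>0 'r) set" where
  "init_I = {red f | f. f \<in> I \<and> integral_form f}"

lemma init_memI: "f \<in> I \<Longrightarrow> integral_form f \<Longrightarrow> red f \<in> init_I"
  unfolding init_I_def by blast

lemma init_ideal: "ideal init_I (laurent_ring E)"
  unfolding init_I_def by (rule red_ideal[OF ideal_I])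

lemma I_closed:
  "f \<in> I \<Longrightarrow> f \<in> carrier (laurent_ring E)" "0 \<in> I"
  "f \<in> I \<Longrightarrow> g \<in> I \<Longrightarrow> f + g \<in> I"
  "r \<in> carrier (laurent_ring E) \<Longrightarrow> f \<in> I \<Longrightarrow> r * f \<in> I"
  using ideal_I[unfolded ideal_monoid_ring_iff] by auto

lemma I_uminus: "f \<in> I \<Longrightarrow> - f \<in> I"
  using I_closed(4)[of "- 1" f] by (simp add: mring_intros)

lemma I_diff: "f \<in> I \<Longrightarrow> g \<in> I \<Longrightarrow> f - g \<in> I"
  using I_closed(3)[of f "- g"] I_uminus[of g] by simp

lemma I_const: "f \<in> I \<Longrightarrow> const c * f \<in> I"
  by (rule I_closed(4)) (simp add: mring_intros)

lemma init_closed: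
  "f \<in> init_I \<Longrightarrow> f \<in> carrier (laurent_ring E)" "0 \<in> init_I"
  "f \<in> init_I \<Longrightarrow> g \<in> init_I \<Longrightarrow> f + g \<in> init_I"
  "r \<in> carrier (laurent_ring E) \<Longrightarrow> f \<in> init_I \<Longrightarrow> r * f \<in> init_I"
  using init_ideal[unfolded ideal_monoid_ring_iff] by auto

lemma range_ij: "i \<in> {1..n}" "j \<in> {1..n}"
  using ij less pair_mem[of i j n] by auto

lemma finite_E: "finite E"
proof -
  have "pairs n \<subseteq> Pow {1..n}" unfolding nsets_def by auto
  then show ?thesis unfolding torus_coords_def by (meson finite_Diff finite_Pow_iff finite_atLeastAtMost finite_subset)
qed

definition ex :: "nat set \<Rightarrow> nat set \<Rightarrow>\<^sub>0 int" where
  "ex d = (if d = {i, j} then 0 else single d 1)"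

text \<open>The signs are polymorphic in the ring, so that the same expression serves over
  \<open>'l\<close> and over the residue field and \<open>res\<close> maps one to the other.\<close>

definition sg :: "nat \<Rightarrow> nat \<Rightarrow> 'b::comm_ring_1" where
  "sg k l = (if k < l then 1 else - 1)"

lemma q_nonzero_iff: "q k l \<noteq> 0 \<longleftrightarrow> k \<noteq> l \<and> {k, l} \<notin> J"
  unfolding signed_def stratum_coord_def var_def by (auto simp: insert_commute single_eq_0_iff)

lemma q_eq: "q k l \<noteq> 0 \<Longrightarrow> q k l = single (ex {k, l}) (sg k l)"
  unfolding q_nonzero_iff unfolding signed_def stratum_coord_def var_def ex_def sg_def
  by (auto simp: insert_commute single_uminus)

lemma q_ij: "q i j = 1"
  using less ij unfolding signed_def stratum_coord_def by auto

text \<open>Scaling the columns of a matrix with \<open>p\<^sub>i\<^sub>j = 1\<close> so that a column becomes \<open>(x, 1)\<close>, \<open>(1, 0)\<close> or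
  \<open>(0, 0)\<close>: the finite points, the points at infinity and the loops.\<close>

definition fin :: "nat \<Rightarrow> bool" where
  "fin k \<longleftrightarrow> k \<in> {1..n} \<and> q i k \<noteq> 0"

definition infty :: "nat \<Rightarrow> bool" where
  "infty k \<longleftrightarrow> k \<in> {1..n} \<and> q i k = 0 \<and> q k j \<noteq> 0"

text \<open>The columns \<open>i\<close> and \<open>j\<close> are normalized to
  \<open>(1, 0)\<close> and \<open>(0, 1)\<close>. Hence the minor \<open>ik\<close> is
  \<open>s_k\<close> for a column \<open>s_k (x_k, 1)\<close>, and the minor \<open>kj\<close> is
  \<open>s_k\<close> for a column \<open>s_k (1, 0)\<close>; this is the exponent of that
  coordinate.\<close>

definition sexp :: "nat \<Rightarrow> nat set \<Rightarrow>\<^sub>0 int" where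
  "sexp k = (if fin k then ex {i, k} else ex {k, j})"

definition ssgn :: "nat \<Rightarrow> 'b::comm_ring_1" where
  "ssgn k = (if fin k then sg i k else sg k j)"

definition scale :: "nat \<Rightarrow> (nat set \<Rightarrow>\<^sub>0 int) \<Rightarrow>\<^sub>0 'l" where
  "scale k = single (sexp k) (ssgn k)"

definition scale_inv :: "nat \<Rightarrow> (nat set \<Rightarrow>\<^sub>0 int) \<Rightarrow>\<^sub>0 'l" where
  "scale_inv k = single (- sexp k) (ssgn k)"

text \<open>The coordinate \<open>x_k\<close> of a finite point, since the minor of
  \<open>s_k (x_k, 1)\<close> and \<open>(0, 1)\<close> is \<open>s_k x_k\<close>.\<close>

definition pt :: "nat \<Rightarrow> (nat set \<Rightarrow>\<^sub>0 int) \<Rightarrow>\<^sub>0 'l" where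
  "pt k = q k j * scale_inv k"

lemma ssgn_square: "ssgn k * ssgn k = 1"
  unfolding ssgn_def sg_def by simp

lemma scale_inv: "scale k * scale_inv k = 1"
  unfolding scale_def scale_inv_def by (simp add: mult_single ssgn_square)

lemma scale_fin: "fin k \<Longrightarrow> q i k = scale k"
  unfolding scale_def sexp_def ssgn_def using q_eq[of i k] by (simp add: fin_def)

lemma scale_infty: "infty k \<Longrightarrow> q k j = scale k"
  unfolding scale_def sexp_def ssgn_def using q_eq[of k j] by (auto simp: fin_def infty_def)

lemma fin_j: "fin j" and infty_i: "infty i"
  using range_ij q_ij unfolding fin_def infty_def by (simp_all add: signed_refl)

lemma scale_ij: "scale i = 1" "scale j = 1"
  using scale_infty[OF infty_i] scale_fin[OF fin_j] q_ij by simp_all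

lemma fin_not_infty: "fin k \<Longrightarrow> \<not> infty k"
  unfolding fin_def infty_def by simp

lemma pt_scale: "q k j = pt k * scale k"
  unfolding pt_def using scale_inv[of k] by (simp add: mult.assoc mult.commute[of "scale_inv k"])

definition scale_edges :: "nat set set" where
  "scale_edges = {d \<in> E. \<exists>k. fin k \<and> d = {i, k} \<or> infty k \<and> d = {k, j}}"

lemma sexp_keys: "fin k \<or> infty k \<Longrightarrow> keys (sexp k) \<subseteq> scale_edges"
proof -
  assume a: "fin k \<or> infty k"
  have A: "keys (ex d) \<subseteq> scale_edges" if "d \<in> pairs n" "d \<notin> J" "\<exists>k. fin k \<and> d = {i, k} \<or> infty k \<and> d = {k, j}" for d
  proof (cases "d = {i, j}")
    case False
    then have "d \<in> E" using that unfolding torus_coords_def by blast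
    then have "d \<in> scale_edges" using that(3) unfolding scale_edges_def by blast
    then show ?thesis using False unfolding ex_def by simp
  qed (simp add: ex_def)
  have B: "{i, k} \<in> pairs n" "{i, k} \<notin> J" if "fin k"
    using that range_ij q_nonzero_iff[of i k] pair_mem[of i k n] unfolding fin_def by auto
  have C: "{k, j} \<in> pairs n" "{k, j} \<notin> J" if "infty k"
    using that range_ij q_nonzero_iff[of k j] pair_mem[of k j n] unfolding infty_def by auto
  show ?thesis
  proof (cases "fin k")
    case True
    then show ?thesis using A[OF B] unfolding sexp_def by auto
  next
    case False
    then show ?thesis using a A[OF C] unfolding sexp_def by auto
  qed
qed

lemma scale_edges_subset: "scale_edges \<subseteq> E"
  unfolding scale_edges_def by blast

lemma scale_closed:
  assumes "fin k \<or> infty k"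
  shows "scale k \<in> carrier (laurent_ring E)" "scale_inv k \<in> carrier (laurent_ring E)"
  using sexp_keys[OF assms] scale_edges_subset unfolding scale_def scale_inv_def
  by (auto intro!: mring_intros)

text \<open>With \<open>q i j = 1\<close> the three-term relation can be solved for
  \<open>q k l\<close>: modulo \<open>I\<close> all coordinates are determined by those involving
  \<open>i\<close> or \<open>j\<close>.\<close>

lemma relation_ij:
  assumes "k \<in> {1..n}" "l \<in> {1..n}"
  shows "q k l - (q i k * q j l - q i l * q j k) \<in> I"
  using relation_in_I[OF range_ij assms] by (simp add: q_ij algebra_simps)

lemma relation_fin_fin:
  assumes "fin k" "fin l"
  shows "q k l - scale k * scale l * (pt k - pt l) \<in> I"
proof -
  have "q i k * q j l - q i l * q j k = scale k * scale l * (pt k - pt l)"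
    unfolding scale_fin[OF assms(1)] scale_fin[OF assms(2)] signed_swap[of _ j] pt_scale by (simp add: algebra_simps)
  then show ?thesis using relation_ij[of k l] assms unfolding fin_def by auto
qed

lemma relation_infty_fin:
  assumes "infty k" "fin l"
  shows "q k l - scale k * scale l \<in> I"
proof -
  have "q i k * q j l - q i l * q j k = scale k * scale l"
  proof -
    have "q j k = - scale k" using scale_infty[OF assms(1)] signed_swap[of _ j k] by metis
    moreover have "q i k = 0" using assms(1) unfolding infty_def by simp
    ultimately show ?thesis using scale_fin[OF assms(2)] by (simp add: mult.commute)
  qed
  then show ?thesis using relation_ij[of k l] assms unfolding fin_def infty_def by auto
qed

text \<open>In the remaining cases one column is a loop or both are points at infinity, so the two
  columns are linearly dependent.\<close>

lemma relation_other:
  assumes "k \<in> {1..n}" "l \<in> {1..n}" "\<not> (fin k \<and> fin l)" "\<not> (infty k \<and> fin l)" "\<not> (fin k \<and> infty l)"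
  shows "q k l \<in> I"
proof -
  have "q j l = - q l j" "q j k = - q k j" by (rule signed_swap)+
  then have "q i k * q j l - q i l * q j k = 0"
    using assms unfolding fin_def infty_def by auto
  then show ?thesis using relation_ij[of k l] assms by simp
qed

end

section \<open>Linear forms normalized by the torus point\<close>

context initial_stratum
begin

abbreviation "lo \<equiv> (Min :: nat set \<Rightarrow> nat)"
abbreviation "hi \<equiv> (Max :: nat set \<Rightarrow> nat)"

lemma edge:
  assumes "d \<in> E"
  shows "lo d < hi d" "lo d \<in> {1..n}" "hi d \<in> {1..n}" "{lo d, hi d} = d"
    "q (lo d) (hi d) = single (single d 1) 1" "q (hi d) (lo d) = - single (single d 1) 1"
proof -
  have d: "d \<in> pairs n" "d \<notin> J" "d \<noteq> {i, j}" using assms unfolding torus_coords_def by auto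
  obtain k l where kl: "k < l" "k \<in> {1..n}" "l \<in> {1..n}" "d = {k, l}" using d(1) by (rule pairsE)
  then have *: "lo d = k" "hi d = l" by auto
  have "q k l = single (single d 1) 1"
    using kl d unfolding signed_def stratum_coord_def var_def by simp
  moreover have "q l k = - q k l" by (rule signed_swap)
  ultimately show "q (lo d) (hi d) = single (single d 1) 1" "q (hi d) (lo d) = - single (single d 1) 1"
    using * by auto
  show "lo d < hi d" "lo d \<in> {1..n}" "hi d \<in> {1..n}" "{lo d, hi d} = d" using * kl by auto
qed

definition lin_edges :: "nat set set" where
  "lin_edges = {d \<in> E. fin (lo d) \<and> fin (hi d)}"

text \<open>On the stratum the monomial \<open>u\<^sub>k\<^sub>l/(s\<^sub>k s\<^sub>l)\<close> with exponent \<open>nu d\<close>, \<open>d = kl\<close>, is the linear form \<open>x\<^sub>k - x\<^sub>l\<close>;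
  \<open>nrm d\<close> is this monomial scaled so that its coefficient relative to \<open>\<tau>\<close> is \<open>\<plusminus>1\<close>.\<close>

definition nu :: "nat set \<Rightarrow> nat set \<Rightarrow>\<^sub>0 int" where
  "nu d = single d 1 - (sexp (lo d) + sexp (hi d))"

definition dl :: "nat set \<Rightarrow> 'b::comm_ring_1" where
  "dl d = ssgn (lo d) * ssgn (hi d)"

definition kp :: "nat set \<Rightarrow> 'l" where
  "kp d = inverse (exp_eval \<tau> (nu d))"

definition nrm :: "nat set \<Rightarrow> (nat set \<Rightarrow>\<^sub>0 int) \<Rightarrow>\<^sub>0 'l" where
  "nrm d = single (nu d) (kp d * dl d)"

lemma dl_square: "dl d * dl d = 1"
  unfolding dl_def using ssgn_square[of "lo d"] ssgn_square[of "hi d"]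
  by (metis (no_types, lifting) mult.assoc mult.left_commute mult.right_neutral)

lemma exp_eval_\<tau>_add: "exp_eval \<tau> (\<alpha> + \<beta>) = exp_eval \<tau> \<alpha> * exp_eval \<tau> \<beta>"
  by (rule exp_eval_add) (rule \<tau>)

lemma kp_exp: "kp d * exp_eval \<tau> (nu d) = 1" "kp d \<noteq> 0"
  unfolding kp_def using exp_eval_\<tau> by simp_all

lemma res_ssgn: "ssgn k \<in> valuation_ring v" "res (ssgn k) = ssgn k"
proof -
  have "ssgn k = (1 :: 'l) \<and> ssgn k = (1 :: 'r) \<or> ssgn k = (- 1 :: 'l) \<and> ssgn k = (- 1 :: 'r)"
    unfolding ssgn_def sg_def by simp
  then show "ssgn k \<in> valuation_ring v" "res (ssgn k) = ssgn k"
    using O_closed res_uminus[OF O_closed(2)] res_one by auto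
qed

lemma res_dl: "dl d \<in> valuation_ring v" "res (dl d) = dl d"
  unfolding dl_def using res_ssgn res_mult[OF res_ssgn(1) res_ssgn(1)] O_closed(4) by simp_all

lemma dl_nonzero: "dl d \<noteq> (0 :: 'b::idom)"
  using dl_square[of d, where 'a = 'b] by auto

lemma nrm_red: "integral_form (nrm d)" "red (nrm d) = single (nu d) (dl d)"
proof -
  have eq: "kp d * dl d * exp_eval \<tau> (nu d) = dl d" using kp_exp(1)[of d] by (simp add: mult.assoc mult.commute)
  show "integral_form (nrm d)" unfolding nrm_def by (rule integral_single) (simp only: eq res_dl(1))
  show "red (nrm d) = single (nu d) (dl d)" unfolding nrm_def red_single eq res_dl(2) ..
qed

lemma lin_edge:
  assumes "d \<in> lin_edges"
  shows "d \<in> E" "fin (lo d)" "fin (hi d)"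
  using assms unfolding lin_edges_def by auto

lemma scale_inv_mult:
  "scale k * scale l * (scale_inv k * scale_inv l * f) = f"
proof -
  have "scale k * scale l * (scale_inv k * scale_inv l * f) = (scale k * scale_inv k) * (scale l * scale_inv l) * f"
    by (simp add: mult_ac)
  then show ?thesis by (simp add: scale_inv)
qed

text \<open>The relation \<open>relation_fin_fin\<close> divided by the invertible scaling monomials
  and multiplied by \<open>kp d\<close>.\<close>

lemma nrm_relation:
  assumes d: "d \<in> lin_edges"
  shows "nrm d - const (kp d) * (pt (lo d) - pt (hi d)) \<in> I"
proof -
  let ?k = "lo d" and ?l = "hi d"
  let ?u = "const (kp d) * (scale_inv ?k * scale_inv ?l)"
  have u: "?u \<in> carrier (laurent_ring E)" using lin_edge[OF d] scale_closed by (intro mring_intros) auto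
  have "?u * (q ?k ?l - scale ?k * scale ?l * (pt ?k - pt ?l)) \<in> I"
    using I_closed(4)[OF u relation_fin_fin] lin_edge[OF d] by blast
  moreover have "?u * q ?k ?l = nrm d"
    unfolding edge(5)[OF lin_edge(1)[OF d]] scale_inv_def const_def nrm_def nu_def dl_def
    by (simp add: mult_single algebra_simps)
  moreover have "?u * (scale ?k * scale ?l * (pt ?k - pt ?l)) = const (kp d) * (pt ?k - pt ?l)"
    using scale_inv_mult[of ?k ?l "const (kp d) * (pt ?k - pt ?l)"] by (simp add: mult_ac)
  ultimately show ?thesis by (simp add: right_diff_distrib)
qed

end

text \<open>The lattice basis \<open>Bl\<close> of \<open>lattice_basis\<close> for the normalized linear forms \<open>nrm\<close>.\<close>

locale proper_stratum = initial_stratum \<iota> n J i j v res \<tau>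
  for \<iota> :: "'k::field \<Rightarrow> 'l::field" and n :: nat and J and i j :: nat
    and v :: "'l \<Rightarrow> real" and res :: "'l \<Rightarrow> 'r::field" and \<tau> :: "nat set \<Rightarrow> 'l" +
  fixes Bl :: "nat set set" and c :: "nat set \<Rightarrow> nat set \<Rightarrow> 'l"
  assumes proper: "1 \<notin> init_I"
    and Bl: "Bl \<subseteq> lin_edges"
    and c: "\<And>d b. d \<in> lin_edges \<Longrightarrow> b \<in> Bl \<Longrightarrow> c d b \<in> valuation_ring v"
    and gen: "\<And>d. d \<in> lin_edges \<Longrightarrow> nrm d - (\<Sum>b\<in>Bl. const (c d b) * nrm b) \<in> I"
    and indep: "\<And>f. (\<Sum>b\<in>Bl. const (f b) * nrm b) \<in> I \<Longrightarrow> \<forall>b\<in>Bl. f b = 0"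
begin

lemma finite_Bl: "finite Bl"
  using Bl lin_edge(1) finite_E finite_subset by (metis subsetI subset_trans)

text \<open>Monomials are units of the Laurent ring, and the initial ideal is proper.\<close>

lemma single_notin_init:
  assumes "keys \<alpha> \<subseteq> E" "a \<noteq> 0"
  shows "single \<alpha> a \<notin> init_I"
proof
  assume "single \<alpha> a \<in> init_I"
  then have "single (- \<alpha>) (inverse a) * single \<alpha> a \<in> init_I"
    using assms by (intro init_closed(4)) (auto intro!: mring_intros)
  then show False using assms(2) proper by (simp add: mult_single)
qed

lemma single_notin_I:
  assumes "keys \<alpha> \<subseteq> E" "a \<noteq> 0"
  shows "single \<alpha> a \<notin> I"
proof
  assume "single \<alpha> a \<in> I"
  then have "single (- \<alpha>) (inverse a) * single \<alpha> a \<in> I"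
    using assms by (intro I_closed(4)) (auto intro!: mring_intros)
  then have "1 \<in> I" using assms(2) by (simp add: mult_single)
  moreover have "integral_form 1" "red 1 = 1"
    using integral_single[of 1 0] red_single[of 0 1] O_closed(2) res_one by (simp_all add: exp_eval_zero)
  ultimately show False using init_memI[of 1] proper by simp
qed

text \<open>Otherwise, after scaling the rescaled coefficient at \<alpha> to 1, the term at \<beta>
  would reduce to 0 and the binomial to a monomial, which a proper initial ideal does not
  contain.\<close>

lemma binomial_val_le:
  assumes "single \<alpha> a - single \<beta> b \<in> I" "keys \<alpha> \<subseteq> E" "a \<noteq> 0" "b \<noteq> 0"
  shows "v (b * exp_eval \<tau> \<beta>) \<le> v (a * exp_eval \<tau> \<alpha>)"
proof (rule ccontr)
  assume n: "\<not> ?thesis"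
  let ?s = "inverse (a * exp_eval \<tau> \<alpha>)"
  have nz: "a * exp_eval \<tau> \<alpha> \<noteq> 0" "b * exp_eval \<tau> \<beta> \<noteq> 0" using assms exp_eval_\<tau> by auto
  have 1: "?s * a * exp_eval \<tau> \<alpha> = 1" by (subst mult.assoc) (rule left_inverse[OF nz(1)])
  have "v (?s * (b * exp_eval \<tau> \<beta>)) = v ?s + v (b * exp_eval \<tau> \<beta>)"
    using nz by (intro val_mult[OF val]) auto
  then have "v (?s * (b * exp_eval \<tau> \<beta>)) > 0" using val_inverse[OF val nz(1)] n by simp
  then have 2: "?s * b * exp_eval \<tau> \<beta> \<in> valuation_ring v" "res (?s * b * exp_eval \<tau> \<beta>) = 0"
    using res_eq_0[of "?s * b * exp_eval \<tau> \<beta>"] by (auto simp: valuation_ring_def mult.assoc)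
  have "const ?s * (single \<alpha> a - single \<beta> b) \<in> I" by (rule I_const[OF assms(1)])
  then have mem: "single \<alpha> (?s * a) - single \<beta> (?s * b) \<in> I" by (simp add: const_def right_diff_distrib mult_single)
  have int: "integral_form (single \<alpha> (?s * a))" "integral_form (single \<beta> (?s * b))"
    using 1 2 O_closed(2) by (auto intro!: integral_single)
  have "red (single \<alpha> (?s * a) - single \<beta> (?s * b)) = single \<alpha> 1"
    unfolding red_diff[OF int] red_single 1 2 res_one by simp
  then have "single \<alpha> 1 \<in> init_I" using init_memI[OF mem integral_diff[OF int]] by simp
  then show False using single_notin_init[OF assms(2)] by simp
qed

lemma binomial_val:
  assumes "single \<alpha> a - single \<beta> b \<in> I" "keys \<alpha> \<subseteq> E" "keys \<beta> \<subseteq> E" "a \<noteq> 0" "b \<noteq> 0"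
  shows "v (a * exp_eval \<tau> \<alpha>) = v (b * exp_eval \<tau> \<beta>)"
  using binomial_val_le[OF assms(1,2,4,5)] binomial_val_le[of \<beta> b \<alpha> a] I_uminus[OF assms(1)] assms by simp

text \<open>In any other configuration \<open>relation_other\<close> would put the unit
  \<open>u_d\<close> into \<open>I\<close>.\<close>

lemma edge_cases:
  assumes d: "d \<in> E" "d \<notin> lin_edges"
  shows "infty (lo d) \<and> fin (hi d) \<or> fin (lo d) \<and> infty (hi d)"
proof (rule ccontr)
  assume n: "\<not> ?thesis"
  have "q (lo d) (hi d) \<in> I"
    by (rule relation_other) (use edge[OF d(1)] n d in \<open>auto simp: lin_edges_def\<close>)
  then show False using single_notin_I[of "single d 1" 1] edge(5)[OF d(1)] d(1) by simp
qed

text \<open>Orientation sign: the minor of a column at infinity followed by a finite one is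
  \<open>s_k s_l\<close>, and in the opposite order its negative.\<close>

definition eta :: "nat set \<Rightarrow> 'b::comm_ring_1" where
  "eta d = (if infty (lo d) then 1 else - 1)"

lemma scale_mult: "scale k * scale l = single (sexp k + sexp l) (ssgn k * ssgn l)"
  unfolding scale_def by (simp add: mult_single)

lemma const_edge_relation:
  assumes d: "d \<in> E" "d \<notin> lin_edges"
  shows "single (single d 1) 1 - single (sexp (lo d) + sexp (hi d)) (eta d * dl d) \<in> I"
  using edge_cases[OF d]
proof
  assume a: "infty (lo d) \<and> fin (hi d)"
  then show ?thesis using relation_infty_fin[of "lo d" "hi d"] edge(5)[OF d(1)]
    by (simp add: scale_mult dl_def eta_def)
next
  assume a: "fin (lo d) \<and> infty (hi d)"
  then have "- single (single d 1) 1 - scale (lo d) * scale (hi d) \<in> I"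
    using relation_infty_fin[of "hi d" "lo d"] edge(6)[OF d(1)] by (simp add: mult.commute)
  from I_uminus[OF this] have "single (single d 1) 1 + scale (lo d) * scale (hi d) \<in> I" by (simp add: add.commute)
  moreover have "\<not> infty (lo d)" using a fin_not_infty by blast
  ultimately show ?thesis by (simp add: scale_mult dl_def eta_def single_uminus)
qed

lemma sexp_edge_keys:
  assumes "d \<in> E"
  shows "keys (sexp (lo d) + sexp (hi d)) \<subseteq> scale_edges"
proof -
  have "fin (lo d) \<or> infty (lo d)" "fin (hi d) \<or> infty (hi d)"
    using edge_cases[OF assms] lin_edge[of d] by blast+
  then show ?thesis using keys_add[of "sexp (lo d)" "sexp (hi d)"] sexp_keys by blast
qed

text \<open>For a coordinate joining a finite point to one at infinity, \<open>u_d\<close> is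
  congruent to a monomial in the scaling factors; this is the coefficient of that monomial after
  both sides are rescaled by \<tau>. Comparing valuations in the binomial relation shows that it is
  a unit of the valuation ring.\<close>

definition ka :: "nat set \<Rightarrow> 'l" where
  "ka d = eta d * dl d * exp_eval \<tau> (sexp (lo d) + sexp (hi d)) / \<tau> d"

lemma eta_nonzero: "eta d \<noteq> (0 :: 'b::idom)"
  unfolding eta_def by simp

lemma ka:
  assumes d: "d \<in> E" "d \<notin> lin_edges"
  shows "ka d \<noteq> 0" "v (ka d) = 0"
proof -
  let ?b = "eta d * dl d * exp_eval \<tau> (sexp (lo d) + sexp (hi d))"
  have b: "?b \<noteq> 0" using eta_nonzero dl_nonzero exp_eval_\<tau> by (metis mult_eq_0_iff)
  then show "ka d \<noteq> 0" unfolding ka_def using \<tau> by simp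
  have "v (1 * exp_eval \<tau> (single d 1)) = v ?b"
    by (rule binomial_val[OF const_edge_relation[OF d]])
      (use d sexp_edge_keys[OF d(1)] scale_edges_subset eta_nonzero dl_nonzero in auto)
  then show "v (ka d) = 0" unfolding ka_def using val_divide[OF val b \<tau>] by (simp add: exp_eval_single)
qed

text \<open>Coefficients of \<open>x_k\<close> in the lattice basis, for finite \<open>k\<close>.
  They are elements of the field; integrality is known only for the combinations
  \<open>c d b\<close> of \<open>dd_edge\<close>.\<close>

definition dd :: "nat \<Rightarrow> nat set \<Rightarrow> 'l" where
  "dd k = (SOME f. pt k - (\<Sum>b\<in>Bl. const (f b) * nrm b) \<in> I)"

lemmas const_simps = unital_homD[OF const_hom]

text \<open>Since \<open>x_j = 0\<close>, the coordinate \<open>x_k\<close> is up to sign and the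
  factor \<open>kp\<close> the linear form of the edge \<open>kj\<close>, which has an expansion in
  the basis; if the coordinate \<open>kj\<close> is 0 then so is \<open>x_k\<close>.\<close>

lemma pt_basis:
  assumes k: "fin k"
  shows "pt k - (\<Sum>b\<in>Bl. const (dd k b) * nrm b) \<in> I"
proof -
  have "\<exists>f. pt k - (\<Sum>b\<in>Bl. const (f b) * nrm b) \<in> I"
  proof (cases "q k j = 0")
    case True
    then have "pt k = 0" unfolding pt_def by simp
    then show ?thesis using I_closed(2) by (intro exI[of _ "\<lambda>_. 0"]) (simp add: const_simps)
  next
    case False
    then have kj: "k \<noteq> j" "{k, j} \<notin> J" unfolding q_nonzero_iff by auto
    let ?d = "{k, j}"
    have "?d \<in> E" using kj k range_ij pair_mem[of k j n] unfolding torus_coords_def fin_def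
      by (auto simp: doubleton_eq_iff signed_refl)
    moreover have lohi: "lo ?d = k \<and> hi ?d = j \<or> lo ?d = j \<and> hi ?d = k" by auto
    ultimately have d: "?d \<in> lin_edges" using k fin_j unfolding lin_edges_def by auto
    have "pt j = 0" unfolding pt_def by (simp add: signed_refl)
    \<comment> \<open>The sign accounts for whether \<open>k\<close> is the smaller or the larger
      index of the edge.\<close>
    define s :: 'l where "s = (if lo ?d = k then 1 else - 1)"
    have s: "s * s = 1" unfolding s_def by simp
    have "const (kp ?d) * (pt (lo ?d) - pt (hi ?d)) = const (kp ?d * s) * pt k"
      using lohi \<open>pt j = 0\<close> kj(1) unfolding s_def by (auto simp: const_simps)
    then have "nrm ?d - const (kp ?d * s) * pt k \<in> I" using nrm_relation[OF d] by simp
    from I_diff[OF gen[OF d] this]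
    have "const (kp ?d * s) * pt k - (\<Sum>b\<in>Bl. const (c ?d b) * nrm b) \<in> I" by simp
    from I_const[OF this, of "inverse (kp ?d) * s"]
    have "const (inverse (kp ?d) * s * (kp ?d * s)) * pt k
      - (\<Sum>b\<in>Bl. const (inverse (kp ?d) * s * c ?d b) * nrm b) \<in> I"
      by (simp add: right_diff_distrib sum_distrib_left const_simps mult.assoc)
    moreover have "inverse (kp ?d) * s * (kp ?d * s) = 1"
      using kp_exp(2)[of ?d] s by (simp add: mult_ac)
    ultimately show ?thesis by (intro exI[of _ "\<lambda>b. inverse (kp ?d) * s * c ?d b"]) (simp add: const_simps)
  qed
  then show ?thesis unfolding dd_def by (rule someI_ex)
qed

text \<open>Both sides are coefficients of the form \<open>nrm d\<close> in the basis, which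
  independence makes unique.\<close>

lemma dd_edge:
  assumes d: "d \<in> lin_edges" and b: "b \<in> Bl"
  shows "c d b = kp d * (dd (lo d) b - dd (hi d) b)"
proof -
  let ?k = "lo d" and ?l = "hi d"
  let ?S = "\<lambda>f. \<Sum>b\<in>Bl. const (f b) * nrm b"
  have "(nrm d - const (kp d) * (pt ?k - pt ?l)) - (nrm d - ?S (c d))
    + const (kp d) * ((pt ?k - ?S (dd ?k)) - (pt ?l - ?S (dd ?l))) \<in> I"
    by (intro I_closed(3) I_diff I_const nrm_relation gen pt_basis d lin_edge[OF d])
  also have "(nrm d - const (kp d) * (pt ?k - pt ?l)) - (nrm d - ?S (c d))
    + const (kp d) * ((pt ?k - ?S (dd ?k)) - (pt ?l - ?S (dd ?l))) =
    ?S (c d) - const (kp d) * (?S (dd ?k) - ?S (dd ?l))"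
    by (simp add: algebra_simps)
  also have "\<dots> = ?S (\<lambda>b. c d b - kp d * (dd ?k b - dd ?l b))"
    by (simp add: const_simps left_diff_distrib right_diff_distrib sum_subtractf sum_distrib_left mult.assoc)
  finally show ?thesis using indep b by fastforce
qed

text \<open>A coordinate set to zero turns its relation into \<open>x_k - x_l \<in> I\<close>. This
  is what makes the minors in \<open>J\<close> of a matrix built from the \<open>dd\<close>
  vanish.\<close>

lemma dd_J:
  assumes k: "fin k" and l: "fin l" and kl: "q k l = 0" and b: "b \<in> Bl"
  shows "dd k b = dd l b"
proof -
  let ?S = "\<lambda>f. \<Sum>b\<in>Bl. const (f b) * nrm b"
  have "- (scale_inv k * scale_inv l) * (q k l - scale k * scale l * (pt k - pt l)) \<in> I"
    by (rule I_closed(4)[OF _ relation_fin_fin[OF k l]]) (use k l scale_closed in \<open>auto intro!: mring_intros\<close>)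
  then have ptI: "pt k - pt l \<in> I"
    using scale_inv_mult[of k l "pt k - pt l"] kl by (simp add: mult_ac)
  have "(pt k - pt l) - ((pt k - ?S (dd k)) - (pt l - ?S (dd l))) \<in> I"
    by (rule I_diff[OF ptI I_diff[OF pt_basis[OF k] pt_basis[OF l]]])
  also have "(pt k - pt l) - ((pt k - ?S (dd k)) - (pt l - ?S (dd l))) = ?S (\<lambda>b. dd k b - dd l b)"
    by (simp add: const_simps left_diff_distrib sum_subtractf)
  finally show ?thesis using indep b by fastforce
qed

text \<open>Independence forces a basis form to be its own expansion, so that its value at a lifted
  point can be prescribed.\<close>

lemma c_diag:
  assumes d: "d \<in> Bl" and b: "b \<in> Bl"
  shows "c d b = (if b = d then 1 else 0)"
proof -
  have "(\<Sum>b\<in>Bl. const (if b = d then 1 else 0) * nrm b) = (\<Sum>b\<in>Bl. if b = d then nrm b else 0)"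
    by (intro sum.cong) (simp_all add: const_simps)
  then have "(\<Sum>b\<in>Bl. const ((if b = d then 1 else 0) - c d b) * nrm b) = nrm d - (\<Sum>b\<in>Bl. const (c d b) * nrm b)"
    using d finite_Bl by (simp add: const_simps left_diff_distrib sum_subtractf)
  then have "(\<Sum>b\<in>Bl. const ((if b = d then 1 else 0) - c d b) * nrm b) \<in> I"
    using gen[of d] Bl d by auto
  from indep[OF this] b show ?thesis by force
qed

end

section \<open>Primality of the initial ideal\<close>

context proper_stratum
begin

text \<open>The free parameters of the stratum: values of the scaling factors and of the basis forms
  determine a matrix.\<close>

definition base :: "nat set set" where
  "base = scale_edges \<union> Bl"

lemma base_subset: "base \<subseteq> E"
  using scale_edges_subset Bl lin_edge(1) unfolding base_def by blast

lemma finite_base: "finite base"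
  using base_subset finite_E finite_subset by blast

definition slope :: "nat set \<Rightarrow> nat set \<Rightarrow>\<^sub>0 int" where
  "slope d = sexp (lo d) + sexp (hi d)"

lemma slope_keys: "d \<in> E \<Longrightarrow> keys (slope d) \<subseteq> base"
  using sexp_edge_keys unfolding slope_def base_def by blast

lemma slope_nu: "slope d + nu d = single d 1"
  unfolding nu_def slope_def by simp

lemma nu_keys:
  assumes "b \<in> Bl"
  shows "keys (nu b) \<subseteq> base"
proof -
  have "b \<in> E" using assms Bl lin_edge(1) by blast
  then show ?thesis using assms slope_keys[of b] keys_diff[of "single b 1" "slope b"]
    unfolding nu_def slope_def[symmetric] base_def by auto
qed

text \<open>The Laurent polynomial in the coordinates of \<open>base\<close> to which \<open>u\<^sub>d\<close> is congruent modulo the initial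
  ideal.\<close>

definition gbar :: "nat set \<Rightarrow> (nat set \<Rightarrow>\<^sub>0 int) \<Rightarrow>\<^sub>0 'r" where
  "gbar d = (if d \<in> lin_edges
     then single (slope d) (dl d) * (\<Sum>b\<in>Bl. const (res (c d b)) * single (nu b) (dl b))
     else single (slope d) (res (ka d)))"

lemma gbar_closed: "d \<in> E \<Longrightarrow> gbar d \<in> carrier (laurent_ring base)"
  unfolding gbar_def using slope_keys nu_keys by (auto intro!: mring_intros)

text \<open>The coefficients \<open>c d b\<close> and \<open>ka d\<close> lie in the valuation ring,
  so the relations in \<open>I\<close> become integral after normalization and can be reduced; in
  the linear case a multiplication by the monomial of \<open>slope d\<close> recovers
  \<open>u_d\<close>.\<close>

lemma gbar_relation:
  assumes d: "d \<in> E"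
  shows "single (single d 1) 1 - gbar d \<in> init_I"
proof (cases "d \<in> lin_edges")
  case True
  have int: "integral_form (const (c d b) * nrm b)" if "b \<in> Bl" for b
    by (rule integral_const_mult[OF c[OF True that] nrm_red(1)])
  have int_sum: "integral_form (\<Sum>b\<in>Bl. const (c d b) * nrm b)" by (rule integral_sum) (rule int)
  have "red (\<Sum>b\<in>Bl. const (c d b) * nrm b) = (\<Sum>b\<in>Bl. red (const (c d b) * nrm b))"
    by (rule red_sum) (rule int)
  also have "\<dots> = (\<Sum>b\<in>Bl. const (res (c d b)) * single (nu b) (dl b))"
    by (intro sum.cong refl) (simp add: red_const_mult[OF c[OF True] nrm_red(1)] nrm_red(2))
  finally have "red (nrm d - (\<Sum>b\<in>Bl. const (c d b) * nrm b)) =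
    single (nu d) (dl d) - (\<Sum>b\<in>Bl. const (res (c d b)) * single (nu b) (dl b))"
    by (simp only: red_diff[OF nrm_red(1) int_sum] nrm_red(2))
  then have "single (nu d) (dl d) - (\<Sum>b\<in>Bl. const (res (c d b)) * single (nu b) (dl b)) \<in> init_I"
    using init_memI[OF gen[OF True] integral_diff[OF nrm_red(1) int_sum]] by simp
  then have "single (slope d) (dl d) * (single (nu d) (dl d)
    - (\<Sum>b\<in>Bl. const (res (c d b)) * single (nu b) (dl b))) \<in> init_I"
    using slope_keys[OF d] base_subset by (intro init_closed(4) mring_intros) auto
  then show ?thesis using True
    by (simp add: gbar_def right_diff_distrib mult_single slope_nu dl_square)
next
  case False
  have 1: "inverse (\<tau> d) * 1 * exp_eval \<tau> (single d 1) = 1" using \<tau> by (simp add: exp_eval_single)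
  have 2: "inverse (\<tau> d) * (eta d * dl d) * exp_eval \<tau> (slope d) = ka d"
    unfolding ka_def slope_def by (simp add: divide_inverse mult_ac)
  have "const (inverse (\<tau> d)) * (single (single d 1) 1 - single (slope d) (eta d * dl d)) \<in> I"
    unfolding slope_def by (rule I_const[OF const_edge_relation[OF d False]])
  then have mem: "single (single d 1) (inverse (\<tau> d) * 1) - single (slope d) (inverse (\<tau> d) * (eta d * dl d)) \<in> I"
    by (simp only: const_def right_diff_distrib mult_single add_0_left)
  have int: "integral_form (single (single d 1) (inverse (\<tau> d) * 1))"
    "integral_form (single (slope d) (inverse (\<tau> d) * (eta d * dl d)))"
    by (rule integral_single; simp only: 1 2 O_closed(2) unit_in_O[OF ka(2)[OF d False]])+
  have "red (single (single d 1) (inverse (\<tau> d) * 1) - single (slope d) (inverse (\<tau> d) * (eta d * dl d))) =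
    single (single d 1) 1 - gbar d"
    unfolding red_diff[OF int] red_single 1 2 res_one using False by (simp add: gbar_def)
  then show ?thesis using init_memI[OF mem integral_diff[OF int]] by simp
qed

text \<open>If \<open>gbar d\<close> were 0, the unit \<open>u_d\<close> would itself lie in the
  proper initial ideal.\<close>

lemma gbar_nonzero: "d \<in> E \<Longrightarrow> gbar d \<noteq> 0"
  using gbar_relation[of d] single_notin_init[of "single d 1" 1] by auto

text \<open>The congruences only bound the initial ideal from below; that it vanishes at a point has
  to come from a point of the stratum over \<open>'l\<close>. A matrix is assembled from lifts of
  \<sigma> on \<open>base\<close>. Its minors, divided by \<tau>, are integral with residues
  \<open>gbar d\<close> at \<sigma>; by \<open>good\<close> they are units, so vanishing of
  \<open>I\<close> at the minors passes to the reductions by \<open>red_eval\<close>.\<close>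

lemma lifted_point:
  assumes \<sigma>: "\<And>d. \<sigma> d \<noteq> 0" and good: "\<And>d. d \<in> E \<Longrightarrow> monoid_eval id (exp_eval \<sigma>) (gbar d) \<noteq> 0"
  obtains \<rho> where "\<forall>d. \<rho> d \<noteq> 0" "\<forall>b\<in>base. \<rho> b = \<sigma> b"
    "\<forall>f\<in>init_I. monoid_eval id (exp_eval \<rho>) f = 0"
proof -
  obtain l where l: "\<And>r. l r \<in> valuation_ring v" "\<And>r. res (l r) = r" using res_lift by (elim exE conjE) blast
  define z where "z d = l (\<sigma> d)" for d
  have z: "z d \<in> valuation_ring v" "res (z d) = \<sigma> d" "z d \<noteq> 0" "v (z d) = 0" for d
    unfolding z_def using unitI[OF l(1), of "\<sigma> d"] l \<sigma>[of d] by auto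
  have ez: "exp_eval z \<alpha> \<in> valuation_ring v" "res (exp_eval z \<alpha>) = exp_eval \<sigma> \<alpha>"
    "exp_eval z (\<alpha> + \<beta>) = exp_eval z \<alpha> * exp_eval z \<beta>" for \<alpha> \<beta>
    using unit_in_O[OF res_exp_eval(1)[of z \<alpha>]] res_exp_eval(2)[of z \<alpha>] exp_eval_add[of z \<alpha> \<beta>] z(2-4) by auto
  \<comment> \<open>The point \<open>p0\<close> prescribes the coordinates in \<open>base\<close>;
    the remaining coordinates of the lift are minors of \<open>M\<close> and in general differ from
    it.\<close>
  define p0 where "p0 = (\<lambda>d. \<tau> d * z d)"
  define ev where "ev = monoid_eval id (exp_eval p0)"
  have p0: "exp_eval p0 \<alpha> = exp_eval \<tau> \<alpha> * exp_eval z \<alpha>" for \<alpha> unfolding p0_def by (rule exp_eval_mult)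
  have "unital_hom ev" unfolding ev_def by (rule laurent_eval_hom[OF id_hom]) (simp add: p0_def \<tau> z)
  note ev = unital_homD[OF this]
  have ev_single: "ev (single \<alpha> a) = a * (exp_eval \<tau> \<alpha> * exp_eval z \<alpha>)" for \<alpha> a
    unfolding ev_def p0[symmetric] by (simp add: monoid_eval_single)
  define s where "s k = ev (scale k)" for k
  \<comment> \<open>The value of \<open>nrm b\<close> at \<open>p0\<close>, where
    \<open>kp b\<close> has cancelled the monomial in \<tau>.\<close>
  define t where "t b = dl b * exp_eval z (nu b)" for b
  define X where "X k = (\<Sum>b\<in>Bl. dd k b * t b)" for k
  \<comment> \<open>The columns are \<open>s_k (X_k, 1)\<close> for finite points,
    \<open>s_k (1, 0)\<close> for points at infinity and 0 for loops, with \<open>X_k\<close> the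
    value of \<open>x_k\<close> computed from the basis.\<close>
  define M where "M = (\<lambda>(r::nat, k). if fin k then (if r = 1 then s k * X k else s k)
    else if infty k then (if r = 1 then s k else 0) else 0)"
  let ?m = "matrix_minor M"
  have s_ij: "s i = 1" "s j = 1" unfolding s_def scale_ij by (simp_all add: ev)
  have s_mult: "s (lo d) * s (hi d) = dl d * (exp_eval \<tau> (slope d) * exp_eval z (slope d))" for d
    unfolding s_def ev(3)[symmetric] scale_mult ev_single dl_def slope_def ..
  have det: "signed ?m k l = (if fin k \<and> fin l then s k * s l * (X k - X l) else
    if infty k \<and> fin l then s k * s l else if fin k \<and> infty l then - (s k * s l) else 0)" for k l
    unfolding signed_matrix_minor M_def using fin_not_infty[of k] fin_not_infty[of l] by (auto simp: algebra_simps)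
  have mE: "?m d = signed ?m (lo d) (hi d)" if "d \<in> E" for d
    using edge(1,4)[OF that] unfolding signed_def by simp
  have m_ij: "?m {i, j} = 1"
    using det[of i j] less fin_j infty_i fin_not_infty[of i] s_ij unfolding signed_def by auto
  have mJ: "?m d = 0" if "d \<in> J" for d
  proof -
    obtain k l where kl: "k < l" "d = {k, l}" using pairsE J \<open>d \<in> J\<close> by blast
    then have q0: "q k l = 0" "q l k = 0" using q_nonzero_iff[of k l] q_nonzero_iff[of l k] \<open>d \<in> J\<close> by (auto simp: insert_commute)
    \<comment> \<open>Otherwise the product of two scaling monomials, which is a unit, would lie in
      \<open>I\<close>.\<close>
    have no: "\<not> (infty a \<and> fin b \<and> q a b = 0)" for a b
    proof
      assume a: "infty a \<and> fin b \<and> q a b = 0"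
      then have "scale a * scale b \<in> I" using relation_infty_fin[of a b] I_uminus by fastforce
      moreover have "keys (sexp a + sexp b) \<subseteq> E"
        using keys_add[of "sexp a" "sexp b"] sexp_keys[of a] sexp_keys[of b] a scale_edges_subset by blast
      moreover have "ssgn a * ssgn b \<noteq> (0 :: 'l)" using ssgn_square[of a, where 'a = 'l] ssgn_square[of b, where 'a = 'l] by auto
      ultimately show False using single_notin_I unfolding scale_mult by blast
    qed
    have "X k = X l" if "fin k" "fin l" unfolding X_def using dd_J[OF that q0(1)] by simp
    then have "signed ?m k l = 0" using det[of k l] no[of k l] no[of l k] q0 by auto
    then show ?thesis using kl unfolding signed_def by simp
  qed
  define P where "P d = ?m d / \<tau> d" for d
  have P_lin: "P d = dl d * exp_eval z (slope d) * (\<Sum>b\<in>Bl. c d b * t b)" if d: "d \<in> lin_edges" for d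
  proof -
    have 1: "exp_eval \<tau> (slope d) * exp_eval \<tau> (nu d) = \<tau> d"
      unfolding exp_eval_\<tau>_add[symmetric] slope_nu by (rule exp_eval_single)
    have "dd (lo d) b - dd (hi d) b = exp_eval \<tau> (nu d) * c d b" if "b \<in> Bl" for b
      using dd_edge[OF d that] kp_exp(1)[of d] by (simp add: mult.assoc[symmetric] mult.commute)
    then have "X (lo d) - X (hi d) = exp_eval \<tau> (nu d) * (\<Sum>b\<in>Bl. c d b * t b)"
      unfolding X_def sum_subtractf[symmetric] left_diff_distrib[symmetric] sum_distrib_left
      by (intro sum.cong refl) (simp add: mult.assoc)
    then have "?m d = dl d * (exp_eval \<tau> (slope d) * exp_eval z (slope d)) * (exp_eval \<tau> (nu d) * (\<Sum>b\<in>Bl. c d b * t b))"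
      using mE[OF lin_edge(1)[OF d]] det[of "lo d" "hi d"] lin_edge[OF d] s_mult[of d] by simp
    also have "\<dots> = (exp_eval \<tau> (slope d) * exp_eval \<tau> (nu d)) * (dl d * exp_eval z (slope d) * (\<Sum>b\<in>Bl. c d b * t b))"
      by (simp only: mult_ac)
    finally show ?thesis unfolding 1 P_def using \<tau>[of d] by simp
  qed
  have P_const: "P d = ka d * exp_eval z (slope d)" if d: "d \<in> E" "d \<notin> lin_edges" for d
  proof -
    have "?m d = eta d * (s (lo d) * s (hi d))"
      using mE[OF d(1)] det[of "lo d" "hi d"] edge_cases[OF d] fin_not_infty unfolding eta_def by auto
    then show ?thesis unfolding P_def ka_def s_mult slope_def[symmetric] by (simp add: divide_inverse mult_ac)
  qed
  have res_t: "t b \<in> valuation_ring v" "res (t b) = dl b * exp_eval \<sigma> (nu b)" for b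
    unfolding t_def using res_dl[of b] ez(1,2) by (auto simp: O_closed res_mult)
  have \<sigma>_hom: "unital_hom (monoid_eval id (exp_eval \<sigma>))" by (rule laurent_eval_hom[OF id_hom \<sigma>])
  have P: "P d \<in> valuation_ring v \<and> res (P d) = monoid_eval id (exp_eval \<sigma>) (gbar d)" if d: "d \<in> E" for d
  proof (cases "d \<in> lin_edges")
    case True
    have ct: "c d b * t b \<in> valuation_ring v" if "b \<in> Bl" for b using c[OF True that] res_t(1) O_closed(4) by blast
    have sO: "(\<Sum>b\<in>Bl. c d b * t b) \<in> valuation_ring v" by (rule valuation_ring_sum[OF val ct])
    have "res (\<Sum>b\<in>Bl. c d b * t b) = (\<Sum>b\<in>Bl. res (c d b) * (dl b * exp_eval \<sigma> (nu b)))"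
      proof -
      have "res (\<Sum>b\<in>Bl. c d b * t b) = (\<Sum>b\<in>Bl. res (c d b * t b))" by (rule res_sum) (rule ct)
      also have "\<dots> = (\<Sum>b\<in>Bl. res (c d b) * (dl b * exp_eval \<sigma> (nu b)))"
        by (intro sum.cong refl) (simp add: res_mult[OF c[OF True] res_t(1)] res_t(2))
      finally show ?thesis .
    qed
    then show ?thesis unfolding P_lin[OF True] using True sO res_dl[of d] ez(1,2)
      by (simp add: gbar_def unital_homD[OF \<sigma>_hom] unital_hom_sum[OF \<sigma>_hom] O_closed(4) res_mult
          monoid_eval_single const_def exp_eval_zero)
  next
    case False
    show ?thesis unfolding P_const[OF d False] using False unit_in_O[OF ka(2)[OF d False]] ez(1,2)
      by (simp add: gbar_def O_closed(4) res_mult monoid_eval_single)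
  qed
  \<comment> \<open>A basis form takes its prescribed value by \<open>c_diag\<close>; a scaling
    factor is recovered as the minor with column \<open>i\<close> or \<open>j\<close>.\<close>
  have P_base: "P b = z b" if in_base: "b \<in> base" for b
  proof (cases "b \<in> Bl")
    case True
    then have b: "b \<in> lin_edges" using Bl by blast
    have "(\<Sum>b'\<in>Bl. c b b' * t b') = (\<Sum>b'\<in>Bl. if b' = b then t b' else 0)"
      by (intro sum.cong refl) (simp add: c_diag[OF True])
    then have "(\<Sum>b'\<in>Bl. c b b' * t b') = t b" using True finite_Bl by simp
    then have "P b = (dl b * dl b) * (exp_eval z (slope b) * exp_eval z (nu b))"
      unfolding P_lin[OF b] t_def by (simp only: mult_ac)
    then show ?thesis unfolding dl_square ez(3)[symmetric] slope_nu by (simp add: exp_eval_single)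
  next
    case False
    then obtain k where k: "b \<in> E" "fin k \<and> b = {i, k} \<or> infty k \<and> b = {k, j}"
      using in_base unfolding base_def scale_edges_def by blast
    have sgn: "sg a a' * sg a a' = (1 :: 'l)" for a a' unfolding sg_def by simp
    have b: "b \<noteq> {i, j}" using k(1) unfolding torus_coords_def by blast
    have sk: "s k = sg a a' * (\<tau> b * z b)" if "sexp k = ex b" "ssgn k = (sg a a' :: 'l)" for a a'
      unfolding s_def scale_def ev_single that using b by (simp add: ex_def exp_eval_single)
    have m: "?m b = sg a a' * signed ?m a a'" if "b = {a, a'}" "a \<noteq> a'" for a a'
      using that unfolding signed_def sg_def by (auto simp: insert_commute)
    have "?m b = \<tau> b * z b" using k(2)
    proof
      assume k: "fin k \<and> b = {i, k}"
      then have "i \<noteq> k" using fin_not_infty infty_i by blast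
      have "signed ?m i k = s k" using det[of i k] k fin_not_infty[of i] infty_i s_ij by auto
      then have "?m b = sg i k * s k" using m[of i k] k \<open>i \<noteq> k\<close> by simp
      moreover have "s k = sg i k * (\<tau> b * z b)" using k by (intro sk) (simp_all add: sexp_def ssgn_def)
      ultimately show ?thesis using sgn[of i k] by (simp add: mult.assoc[symmetric])
    next
      assume k: "infty k \<and> b = {k, j}"
      then have "k \<noteq> j" "\<not> fin k" using fin_not_infty fin_j by blast+
      have "signed ?m k j = s k" using det[of k j] k \<open>\<not> fin k\<close> fin_j s_ij by auto
      then have "?m b = sg k j * s k" using m[of k j] k \<open>k \<noteq> j\<close> by simp
      moreover have "s k = sg k j * (\<tau> b * z b)" using k \<open>\<not> fin k\<close> by (intro sk) (simp_all add: sexp_def ssgn_def)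
      ultimately show ?thesis using sgn[of k j] by (simp add: mult.assoc[symmetric])
    qed
    then show ?thesis unfolding P_def using \<tau>[of b] by simp
  qed
  define P' where "P' d = (if d \<in> E then P d else 1)" for d
  have P': "P' d \<noteq> 0" "v (P' d) = 0" for d
    using P[of d] good[of d] unitI[of "P d"] val_one[OF val] unfolding P'_def by auto
  show thesis
  proof (rule that[of "\<lambda>d. res (P' d)"]; intro allI ballI)
    show "res (P' d) \<noteq> 0" for d by (rule res_unit[OF P'])
    show "res (P' b) = \<sigma> b" if "b \<in> base" for b
      using P_base[OF that] z(2) base_subset that unfolding P'_def by auto
    fix f assume "f \<in> init_I"
    then obtain g where g: "f = red g" "g \<in> I" "integral_form g" unfolding init_I_def by blast
    have "monoid_eval id (exp_eval (\<lambda>d. \<tau> d * P' d)) g = 0"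
    proof (rule I_vanishes[OF _ mJ m_ij _ g(2)])
      show "\<tau> d * P' d \<noteq> 0" for d using \<tau> P'(1) by simp
      show "?m d = \<tau> d * P' d" if "d \<in> E" for d using that \<tau>[of d] unfolding P'_def P_def by simp
    qed
    then show "monoid_eval id (exp_eval (\<lambda>d. res (P' d))) f = 0"
      unfolding g(1) red_eval[OF g(3) P'] by (simp add: res_0)
  qed
qed

section \<open>Elimination of the coordinates outside the base\<close>

definition reducible :: "((nat set \<Rightarrow>\<^sub>0 int) \<Rightarrow>\<^sub>0 'r) \<Rightarrow> bool" where
  "reducible h \<longleftrightarrow> h \<in> carrier (laurent_ring E) \<and> (\<exists>F\<in>carrier (laurent_ring base). h - F \<in> init_I)"

lemma base_carrier: "F \<in> carrier (laurent_ring base) \<Longrightarrow> F \<in> carrier (laurent_ring E)"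
  using base_subset unfolding mem_monoid_ring by blast

lemma reducible_base: "F \<in> carrier (laurent_ring base) \<Longrightarrow> reducible F"
  unfolding reducible_def using base_carrier init_closed(2) by (auto intro!: bexI[of _ F])

lemma reducible_add:
  assumes "reducible g" "reducible h"
  shows "reducible (g + h)"
proof -
  obtain F G where F: "F \<in> carrier (laurent_ring base)" "g - F \<in> init_I"
    and G: "G \<in> carrier (laurent_ring base)" "h - G \<in> init_I" using assms unfolding reducible_def by blast
  have "(g - F) + (h - G) \<in> init_I" by (rule init_closed(3)[OF F(2) G(2)])
  also have "(g - F) + (h - G) = g + h - (F + G)" by simp
  finally show ?thesis using assms F(1) G(1) unfolding reducible_def by (blast intro: mring_intros)
qed

lemma reducible_mult:
  assumes "reducible g" "reducible h"
  shows "reducible (g * h)"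
proof -
  obtain F G where F: "F \<in> carrier (laurent_ring base)" "g - F \<in> init_I"
    and G: "G \<in> carrier (laurent_ring base)" "h - G \<in> init_I" using assms unfolding reducible_def by blast
  have car: "g \<in> carrier (laurent_ring E)" "h \<in> carrier (laurent_ring E)" using assms unfolding reducible_def by auto
  have "h * (g - F) + F * (h - G) \<in> init_I"
    by (intro init_closed(3) init_closed(4) F G car base_carrier)
  also have "h * (g - F) + F * (h - G) = g * h - F * G" by (simp add: algebra_simps)
  finally show ?thesis using car F(1) G(1) unfolding reducible_def by (blast intro: mring_intros)
qed

lemma reducible_var: "d \<in> E \<Longrightarrow> reducible (var d)"
  unfolding reducible_def using gbar_relation gbar_closed
  by (auto simp: var_def intro!: mring_intros)

lemma reducible_prod: "(\<And>x. x \<in> A \<Longrightarrow> reducible (g x)) \<Longrightarrow> reducible (prod g A)"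
  by (induction A rule: infinite_finite_induct) (auto intro: reducible_mult reducible_base mring_intros)

lemma reducible_sum: "(\<And>x. x \<in> A \<Longrightarrow> reducible (g x)) \<Longrightarrow> reducible (sum g A)"
  by (induction A rule: infinite_finite_induct) (auto intro: reducible_add reducible_base mring_intros)

lemma reducible_power: "reducible g \<Longrightarrow> reducible (g ^ m)"
  by (induction m) (auto intro: reducible_mult reducible_base mring_intros)

text \<open>The polynomial \<open>gbar d\<close> need not be invertible among Laurent polynomials in
  \<open>base\<close>, so a negative power of \<open>u_d\<close> cannot simply be replaced. A
  monomial of large degree clears all negative exponents, after which only products of variables
  remain.\<close>

lemma monomial_multiple_reducible:
  assumes f: "f \<in> carrier (laurent_ring E)"
  obtains \<mu> where "keys \<mu> \<subseteq> E" "reducible (single \<mu> 1 * f)"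
proof -
  \<comment> \<open>A common bound for the absolute values of all exponents that occur in
    \<open>f\<close>.\<close>
  define N where "N = (\<Sum>\<alpha>\<in>keys f. \<Sum>d\<in>E. \<bar>lookup \<alpha> d\<bar>)"
  define \<mu> where "\<mu> = (\<Sum>d\<in>E. single d N)"
  have N: "0 \<le> lookup \<alpha> d + N" if "\<alpha> \<in> keys f" "d \<in> E" for \<alpha> d
  proof -
    have "\<bar>lookup \<alpha> d\<bar> \<le> (\<Sum>d\<in>E. \<bar>lookup \<alpha> d\<bar>)" using finite_E that by (intro member_le_sum) auto
    also have "\<dots> \<le> N" unfolding N_def using that by (intro member_le_sum) (auto intro: sum_nonneg)
    finally show ?thesis by linarith
  qed
  have mono: "reducible (single (\<mu> + \<alpha>) a)" if \<alpha>: "\<alpha> \<in> keys f" for \<alpha> a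
  proof -
    have "keys \<alpha> \<subseteq> E" using f \<alpha> unfolding mem_monoid_ring by blast
    then have "lookup (\<mu> + \<alpha>) d = lookup (\<Sum>d\<in>E. single d (int (nat (lookup \<alpha> d + N)))) d" for d
      unfolding \<mu>_def lookup_add lookup_sum_singles[OF finite_E] using N[OF \<alpha>, of d]
      by (auto simp: in_keys_iff subset_iff)
    then have "\<mu> + \<alpha> = (\<Sum>d\<in>E. single d (int (nat (lookup \<alpha> d + N))))" by (rule poly_mapping_eqI)
    then have eq: "single (\<mu> + \<alpha>) a = const a * (\<Prod>d\<in>E. var d ^ nat (lookup \<alpha> d + N))"
      unfolding prod_var_power[OF finite_E] const_def by (simp add: mult_single)
    show ?thesis unfolding eq
      by (rule reducible_mult[OF reducible_base[OF monoid_ring_closed(3)]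
            reducible_prod[OF reducible_power[OF reducible_var]]])
  qed
  have sum: "single \<mu> 1 * f = (\<Sum>\<alpha>\<in>keys f. single (\<mu> + \<alpha>) (lookup f \<alpha>))"
    by (subst (1) poly_mapping_sum_singles[of f, symmetric]) (simp add: sum_distrib_left mult_single)
  have "reducible (single \<mu> 1 * f)" unfolding sum by (rule reducible_sum) (rule mono)
  moreover have "keys \<mu> \<subseteq> E" unfolding \<mu>_def
    by (auto simp: in_keys_iff lookup_sum_singles[OF finite_E] split: if_splits)
  ultimately show thesis using that by blast
qed

text \<open>The multiplier is a unit, so a zero reduction would put \<open>f\<close> itself into the
  initial ideal.\<close>

lemma nonmember_reduction:
  assumes f: "f \<in> carrier (laurent_ring E)" "f \<notin> init_I"
  obtains \<mu> F where "F \<in> carrier (laurent_ring base)" "F \<noteq> 0" "single \<mu> 1 * f - F \<in> init_I"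
proof -
  obtain \<mu> where \<mu>: "keys \<mu> \<subseteq> E" "reducible (single \<mu> 1 * f)" by (rule monomial_multiple_reducible[OF f(1)])
  then obtain F where F: "F \<in> carrier (laurent_ring base)" "single \<mu> 1 * f - F \<in> init_I"
    unfolding reducible_def by blast
  have "F \<noteq> 0"
  proof
    assume "F = 0"
    then have "single (- \<mu>) 1 * (single \<mu> 1 * f) \<in> init_I"
      using F(2) \<mu>(1) by (intro init_closed(4)[of _ "single \<mu> 1 * f"]) (simp_all add: mring_intros)
    then show False using f(2) by (simp add: mult.assoc[symmetric] mult_single)
  qed
  then show thesis using that F by blast
qed

lemma init_prime:
  assumes inf: "infinite (UNIV :: 'r set)"
    and f: "f \<in> carrier (laurent_ring E)" and g: "g \<in> carrier (laurent_ring E)" and fg: "f * g \<in> init_I"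
  shows "f \<in> init_I \<or> g \<in> init_I"
proof (rule ccontr)
  assume "\<not> ?thesis"
  then have nf: "f \<notin> init_I" "g \<notin> init_I" by simp_all
  obtain \<mu> F where F: "F \<in> carrier (laurent_ring base)" "F \<noteq> 0" "single \<mu> 1 * f - F \<in> init_I"
    by (rule nonmember_reduction[OF f nf(1)])
  obtain \<nu> G where G: "G \<in> carrier (laurent_ring base)" "G \<noteq> 0" "single \<nu> 1 * g - G \<in> init_I"
    by (rule nonmember_reduction[OF g nf(2)])
  \<comment> \<open>\<open>F\<close> and \<open>G\<close> stand for the two factors; the
    \<open>gbar d\<close> join them so that \<open>lifted_point\<close> applies to \<sigma>.\<close>
  let ?Fs = "insert F (insert G (gbar ` E))"
  have Fs: "finite ?Fs" "\<And>h. h \<in> ?Fs \<Longrightarrow> h \<noteq> 0" "?Fs \<subseteq> carrier (laurent_ring base)"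
    using finite_E F(1,2) G(1,2) gbar_nonzero gbar_closed by auto
  obtain \<sigma> where \<sigma>': "\<forall>d. \<sigma> d \<noteq> 0" "\<forall>h\<in>?Fs. monoid_eval id (exp_eval \<sigma>) h \<noteq> 0"
    by (rule laurent_nonvanishing[OF inf finite_base Fs])
  note \<sigma> = spec[OF \<sigma>'(1)] bspec[OF \<sigma>'(2)]
  obtain \<rho> where "\<forall>d. \<rho> d \<noteq> 0" "\<forall>b\<in>base. \<rho> b = \<sigma> b"
    "\<forall>f\<in>init_I. monoid_eval id (exp_eval \<rho>) f = 0"
    by (rule lifted_point[OF \<sigma>(1) \<sigma>(2)[OF insertI2[OF insertI2[OF imageI]]]])
  then have \<rho>: "\<And>d. \<rho> d \<noteq> 0" "\<And>b. b \<in> base \<Longrightarrow> \<rho> b = \<sigma> b"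
    "\<And>f. f \<in> init_I \<Longrightarrow> monoid_eval id (exp_eval \<rho>) f = 0" by simp_all
  note ev = unital_homD[OF laurent_eval_hom[of id \<rho>, OF id_hom \<rho>(1)]]
  \<comment> \<open>At \<rho> a monomial multiple of \<open>f\<close> takes the value of
    \<open>F\<close>, which involves only coordinates in \<open>base\<close>, where \<rho> agrees
    with \<sigma>.\<close>
  have nz: "monoid_eval id (exp_eval \<rho>) f \<noteq> 0"
    if "F \<in> carrier (laurent_ring base)" "F \<in> ?Fs" "single \<mu> 1 * f - F \<in> init_I" for F f \<mu>
  proof -
    have "exp_eval \<rho> \<alpha> = exp_eval \<sigma> \<alpha>" if "\<alpha> \<in> keys F" for \<alpha>
      using \<rho>(2) that \<open>F \<in> carrier _\<close> unfolding mem_monoid_ring by (intro exp_eval_cong) auto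
    then have "monoid_eval id (exp_eval \<rho>) F \<noteq> 0"
      using \<sigma>(2)[OF that(2)] monoid_eval_cong[of F "exp_eval \<rho>" "exp_eval \<sigma>" id] by simp
    moreover have "monoid_eval id (exp_eval \<rho>) (single \<mu> 1) * monoid_eval id (exp_eval \<rho>) f = monoid_eval id (exp_eval \<rho>) F"
      using \<rho>(3)[OF that(3)] by (simp add: ev)
    ultimately show ?thesis by auto
  qed
  have "monoid_eval id (exp_eval \<rho>) f * monoid_eval id (exp_eval \<rho>) g = 0" using \<rho>(3)[OF fg] by (simp add: ev)
  then show False using nz[OF F(1) _ F(3)] nz[OF G(1) _ G(3)] by auto
qed

end

theorem theorem6p4:
  fixes vK :: "'k::field \<Rightarrow> real"
    and vL :: "'l::alg_closed_field \<Rightarrow> real"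
    and \<iota> :: "'k \<Rightarrow> 'l"
    and res :: "'l \<Rightarrow> 'r::field"
    and n i j :: nat
    and J :: "nat set set"
    and y :: "nat set \<Rightarrow> real"
    and \<tau> :: "nat set \<Rightarrow> 'l"
  assumes "complete_valuation vK"
    and "complete_valuation vL"
    and "vL ` (UNIV - {0}) = UNIV"
    and "valued_extension vK vL \<iota>"
    and "residue_map vL res"
    and "J \<subset> pairs n"
    and "is_vanishing_set vK n J"
    and "{i, j} \<in> pairs n - J"
    and "torus_point vL (torus_coords n J {i, j}) \<tau> y"
  shows "integral_scheme (Spec (initial_coordinate_ring vL \<iota> res n J {i, j} \<tau> y))"
proof -
  define E where "E = torus_coords n J {i, j}"
  have val: "valuation vL" using assms(2) unfolding complete_valuation_def by blast
  have \<iota>: "unital_hom \<iota>" using assms(4) unfolding valued_extension_def unital_hom_def by (elim conjE) (intro conjI; assumption)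
  have inf: "infinite (UNIV :: 'r set)" by (rule residue_field_infinite[OF val assms(5)])
  have "i \<noteq> j" using assms(8) unfolding nsets_def by (auto simp: card_insert_if)
  \<comment> \<open>The coordinate \<open>p_e\<close> of a set \<open>e\<close> is the minor with
    increasing columns, so the normalized pair is ordered before its columns are taken as
    \<open>(1, 0)\<close> and \<open>(0, 1)\<close>.\<close>
  then obtain a b where ab: "a < b" "{i, j} = {a, b}" by (metis insert_commute linorder_neqE_nat)
  \<comment> \<open>Outside the torus coordinates \<tau> may vanish; the value 1 there makes
    \<open>exp_eval\<close> multiplicative on all exponents and leaves the initial ideal
    unchanged.\<close>
  define \<tau>' where "\<tau>' d = (if d \<in> E then \<tau> d else 1)" for d
  have \<tau>': "\<tau>' d \<noteq> 0" for d using assms(9) unfolding \<tau>'_def E_def torus_point_def by simp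
  interpret S: initial_stratum \<iota> n J a b vL res \<tau>'
    by unfold_locales (use \<iota> val assms(5,6,8) \<tau>' ab in auto)
  have E: "E = torus_coords n J {a, b}" unfolding E_def ab(2) ..
  have ideal: "ideal S.init_I (laurent_ring E)" using S.init_ideal unfolding E .
  have "initial_ideal vL res E \<tau> y (extended_ideal \<iota> E (stratum_ideal n J {i, j})) = S.init_I"
    unfolding S.init_I_def ab(2) E
    by (rule S.initial_ideal_eq[OF S.ideal_I]) (use assms(9) in \<open>simp_all add: \<tau>'_def E_def ab(2)\<close>)
  then have ring: "initial_coordinate_ring vL \<iota> res n J {i, j} \<tau> y = laurent_ring E Quot S.init_I"
    unfolding initial_coordinate_ring_def Let_def E_def[symmetric] by simp
  have "f \<in> S.init_I \<or> g \<in> S.init_I"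
    if f: "f \<in> carrier (laurent_ring E)" and g: "g \<in> carrier (laurent_ring E)"
      and fg: "f \<otimes>\<^bsub>laurent_ring E\<^esub> g \<in> S.init_I" and ne: "S.init_I \<noteq> carrier (laurent_ring E)" for f g
  proof -
    have proper: "1 \<notin> S.init_I"
    proof
      assume "1 \<in> S.init_I"
      then have "r \<in> S.init_I" if "r \<in> carrier (laurent_ring E)" for r
        using S.init_closed(4)[of r 1] that unfolding E by simp
      moreover have "S.init_I \<subseteq> carrier (laurent_ring E)" using S.init_closed(1) unfolding E by blast
      ultimately show False using ne by blast
    qed
    have fin: "finite S.lin_edges" using S.finite_E unfolding S.lin_edges_def by simp
    obtain B c where B: "B \<subseteq> S.lin_edges" "\<forall>d\<in>S.lin_edges. \<forall>b\<in>B. c d b \<in> valuation_ring vL"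
      "\<forall>d\<in>S.lin_edges. S.nrm d - (\<Sum>b\<in>B. const (c d b) * S.nrm b) \<in> S.I"
      "\<forall>h. (\<Sum>b\<in>B. const (h b) * S.nrm b) \<in> S.I \<longrightarrow> (\<forall>b\<in>B. h b = 0)"
      by (rule lattice_basis[OF val const_hom fin S.I_closed(2,3) S.I_const, of S.nrm])
    interpret P: proper_stratum \<iota> n J a b vL res \<tau>' B c
      by unfold_locales (rule proper, rule B(1), rule bspec[OF bspec[OF B(2)]], assumption+,
        rule bspec[OF B(3)], assumption, rule mp[OF spec[OF B(4)]], assumption)
    show ?thesis using P.init_prime[OF inf, of f g] f g fg unfolding E by simp
  qed
  then show ?thesis unfolding ring by (rule integral_scheme_Spec_Quot[OF cring_monoid_ring ideal])
qed

end
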